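(* Let $n\ge 2$. Fix $1<p,q,r<\infty$ and $0<t<s$. Set $\theta:=t/s\in(0,1)$ and suppose that $$\frac1r=\frac{\theta}{p}+\frac{1-\theta}{q}.$$ Let $\alpha_0,\alpha_1,\beta_0,\beta_1,\gamma_0,\gamma_1\in\mathbb R$ satisfy $$p(\alpha_1,\beta_1,\gamma_1)\in(\mathcal A\cup\mathcal B)\cap(\mathcal C_p\cup\mathcal D_p),\qquad q(\alpha_0,\beta_0,\gamma_0)\in(\mathcal A\cup\mathcal B)\cap(\mathcal C_q\cup\mathcal D_q),$$ $$(\alpha_j,\beta_k,\gamma_\ell)\in\mathcal A\cup\mathcal B\quad\text{for all } j,k,\ell\in\{0,1\}.$$ Put $(\alpha_\theta,\beta_\theta,\gamma_\theta):=\theta(\alpha_1,\beta_1,\gamma_1)+(1-\theta)(\alpha_0,\beta_0,\gamma_0)$. Then there is a constant $C>0$, independent of $f$, such that $$\big\||x'|^{\alpha_\theta}|x|^{\beta_\theta}|x_n|^{\gamma_\theta}D^tf\big\|_{L^r}\le C\,\big\||x'|^{\alpha_1}|x|^{\beta_1}|x_n|^{\gamma_1}D^sf\big\|_{L^p}^{\theta}\,\big\||x'|^{\alpha_0}|x|^{\beta_0}|x_n|^{\gamma_0}f\big\|_{L^q}^{1-\theta}$$ for every $f$ in the Schwartz class $\mathcal S(\mathbb R^n)$.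
   Context: Write $x=(x',x_n)\in\mathbb R^n$ with $x'=(x_1,\dots,x_{n-1})\in\mathbb R^{n-1}$. All Lebesgue norms are over $\mathbb R^n$ with Lebesgue measure. For $s>0$, $D^s$ is the homogeneous fractional derivative defined by $\widehat{D^sf}=|\cdot|^s\hat f$. For $1<p<\infty$ the following subsets of $\mathbb R^3$ are used: $\mathcal A=\{(\theta_1,\theta_2,\theta_3):\theta_1>-(n-1),\ \theta_2\ge0,\ \theta_3>-1\}$, $\mathcal B=\{(\theta_1,\theta_2,\theta_3):\theta_1>-(n-1),\ \theta_2<0,\ \theta_3>-1,\ \theta_1+\theta_2+\theta_3>-n\}$, $\mathcal C_p=\{(\theta_1,\theta_2,\theta_3):\theta_1<(n-1)(p-1),\ \theta_2\le0,\ \theta_3<p-1\}$, $\mathcal D_p=\{(\theta_1,\theta_2,\theta_3):\theta_1<(n-1)(p-1),\ \theta_2>0,\ \theta_3<p-1,\ \theta_1+\theta_2+\theta_3<n(p-1)\}$. Equivalently, $\mathcal A\cup\mathcal B=\{\theta_1>-(n-1),\ \theta_3>-1,\ \theta_1+\theta_2+\theta_3>-n\}$ and $\mathcal C_p\cup\mathcal D_p=\{\theta_1<(n-1)(p-1),\ \theta_3<p-1,\ \theta_1+\theta_2+\theta_3<n(p-1)\}$. *)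

theory Defs
  imports "HOL-Analysis.Analysis"
begin

section \<open>Schwartz functions\<close>

text \<open>Iterated partial derivatives along the listed directions; multi-indices are encoded as lists
  of standard basis vectors.\<close>

primrec iter_pderiv :: "'a list \<Rightarrow> ('a::euclidean_space \<Rightarrow> complex) \<Rightarrow> 'a \<Rightarrow> complex" where
  "iter_pderiv [] f = f"
| "iter_pderiv (b # bs) f = (\<lambda>x. frechet_derivative (iter_pderiv bs f) (at x) b)"

definition smooth :: "('a::euclidean_space \<Rightarrow> complex) \<Rightarrow> bool" where
  "smooth f \<longleftrightarrow> (\<forall>bs x. set bs \<subseteq> Basis \<longrightarrow> iter_pderiv bs f differentiable (at x))"

definition schwartz :: "('a::euclidean_space \<Rightarrow> complex) set" where
  "schwartz = {f. smooth f \<and>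
     (\<forall>bs k. set bs \<subseteq> Basis \<longrightarrow> (\<exists>M. \<forall>x. norm x ^ k * norm (iter_pderiv bs f x) \<le> M))}"


section \<open>Fourier transform and homogeneous fractional derivative\<close>

text \<open>Normalisation: $\hat f(\xi) = \int f(x) e^{-2\pi i x\cdot\xi}\,dx$, so that the inverse
  transform carries no constant.\<close>

definition fourier :: "('a::euclidean_space \<Rightarrow> complex) \<Rightarrow> 'a \<Rightarrow> complex" where
  "fourier f \<xi> = (LINT x|lborel. cis (- (2 * pi * (x \<bullet> \<xi>))) * f x)"

definition inv_fourier :: "('a::euclidean_space \<Rightarrow> complex) \<Rightarrow> 'a \<Rightarrow> complex" where
  "inv_fourier g x = (LINT \<xi>|lborel. cis (2 * pi * (x \<bullet> \<xi>)) * g \<xi>)"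

text \<open>$D^s f$ is the function whose Fourier transform is $|\xi|^s \hat f(\xi)$. For a Schwartz
  function $f$ and $s > 0$ this symbol is absolutely integrable, so the inversion integral
  converges at every point.\<close>

definition frac_deriv :: "real \<Rightarrow> ('a::euclidean_space \<Rightarrow> complex) \<Rightarrow> 'a \<Rightarrow> complex" where
  "frac_deriv s f = inv_fourier (\<lambda>\<xi>. of_real (norm \<xi> powr s) * fourier f \<xi>)"


section \<open>Weighted Lebesgue norms\<close>

definition ennreal_powr :: "ennreal \<Rightarrow> real \<Rightarrow> ennreal" where
  \<comment> \<open>meant for positive exponents only\<close>
  "ennreal_powr u a = (if u = \<infinity> then \<infinity> else ennreal (enn2real u powr a))"

text \<open>The $L^p$ norm for $0 < p < \infty$, with value $\infty$ outside $L^p$.\<close>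

definition Lp_norm :: "real \<Rightarrow> ('a::euclidean_space \<Rightarrow> complex) \<Rightarrow> ennreal" where
  "Lp_norm p f = ennreal_powr (\<integral>\<^sup>+x. ennreal (norm (f x) powr p) \<partial>lborel) (1 / p)"

text \<open>Points of $\mathbb{R}^n$ are pairs $(x', x_n)$; the norm on the product type is the Euclidean
  one. Since 0 powr a = 0 for every a, the value differs from the usual conventions
  only on the null set where x' = 0 or the last coordinate vanishes.\<close>

definition weight :: "real \<times> real \<times> real \<Rightarrow> (real ^ 'm) \<times> real \<Rightarrow> real" where
  "weight = (\<lambda>(a, b, c) x. norm (fst x) powr a * norm x powr b * \<bar>snd x\<bar> powr c)"

definition wLp_norm ::
    "real \<Rightarrow> real \<times> real \<times> real \<Rightarrow> ((real ^ 'm) \<times> real \<Rightarrow> complex) \<Rightarrow> ennreal" where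
  "wLp_norm p w f = Lp_norm p (\<lambda>x. of_real (weight w x) * f x)"


section \<open>Exponent regions\<close>

definition region_A :: "nat \<Rightarrow> (real \<times> real \<times> real) set" where
  "region_A n = {(t1, t2, t3). t1 > - (real n - 1) \<and> t2 \<ge> 0 \<and> t3 > -1}"

definition region_B :: "nat \<Rightarrow> (real \<times> real \<times> real) set" where
  "region_B n = {(t1, t2, t3). t1 > - (real n - 1) \<and> t2 < 0 \<and> t3 > -1 \<and> t1 + t2 + t3 > - real n}"

definition region_C :: "nat \<Rightarrow> real \<Rightarrow> (real \<times> real \<times> real) set" where
  "region_C n p = {(t1, t2, t3). t1 < (real n - 1) * (p - 1) \<and> t2 \<le> 0 \<and> t3 < p - 1}"

definition region_D :: "nat \<Rightarrow> real \<Rightarrow> (real \<times> real \<times> real) set" where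
  "region_D n p = {(t1, t2, t3). t1 < (real n - 1) * (p - 1) \<and> t2 > 0 \<and> t3 < p - 1 \<and>
     t1 + t2 + t3 < real n * (p - 1)}"

end

theory Submission
  imports Defs "HOL-Probability.Characteristic_Functions"
begin

text \<open>Let \<open>M\<close> be the uncentred Hardy--Littlewood maximal operator and \<open>\<theta> = t / s\<close>. The estimate follows from the
  pointwise inequality \<open>|D\<^sup>t f| \<le> C (M\<^sup>k |f|) powr (1 - \<theta>) * (M\<^sup>k |D\<^sup>s f|) powr \<theta>\<close>, Hoelder's inequality (the
  three weights are related by the same exponents as the three norms) and the boundedness of \<open>M\<close> on
  weighted Lebesgue spaces, since the conditions on the exponents say exactly that the weights, raised
  to the powers \<open>p\<close> and \<open>q\<close>, are Muckenhoupt weights.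

  For the pointwise inequality put \<open>X = 2 \<pi>\<^sup>2 |\<xi>|\<^sup>2\<close>, so that \<open>exp (- v X)\<close> is the transform of a Gaussian of variance
  \<open>v\<close>. The multiplier \<open>X exp (- v X)\<close> is a limit of difference quotients of Gaussians and is therefore
  bounded by \<open>C M / v\<close>; iterating, \<open>P\<^sub>u := X\<^sup>k exp (- u X)\<close> is bounded by \<open>C u powr (- k) * M\<^sup>k\<close>. Writing powers of \<open>X\<close> as
  Gamma integrals of exponentials, \<open>D\<^sup>t f\<close> is an integral of the \<open>P\<^sub>u f\<close>, and \<open>P\<^sub>u f\<close> is an integral of the \<open>P\<^sub>v D\<^sup>s f\<close> over
  \<open>v > u\<close>. The first bound is used for large \<open>u\<close>, the second for small \<open>u\<close>.\<close>

subsection \<open>Powers of extended nonnegative reals and Hoelder's inequality\<close>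

text \<open>The symbol of \<open>D^t\<close> is not smooth at the origin, so kernels of fractional
  derivatives are avoided: every kernel estimate concerns a difference of two Gaussians, and real
  powers of the symbol enter only through scalar Gamma integrals. Iterating the first-order bound
  replaces estimates of higher Gaussian derivatives; the price, \<open>k\<close> copies of
  \<open>M\<close>, is harmless because \<open>M\<close> maps each weighted space to itself. The
  number \<open>k\<close> has to exceed \<open>s / 2\<close>, since otherwise the integral of
  \<open>v powr (s / 2 - 1 - k)\<close> diverges at infinity. The weighted bound treats a weight and
  its dual symmetrically and rests on the maximal operators of the two doubling measures they
  define, so no reverse Hoelder inequality appears. Maximal functions and norms may be infinite,
  hence extended nonnegative reals throughout. As \<open>frac_deriv\<close> is an inversion
  integral, the pointwise estimates are made for \<open>inv_fourier h\<close> with \<open>h\<close>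
  integrable; Schwartz functions enter at the end, through the decay of their transforms and Fourier
  inversion.\<close>

lemma ennreal_powr_ennreal: "0 \<le> x \<Longrightarrow> ennreal_powr (ennreal x) a = ennreal (x powr a)"
  by (simp add: ennreal_powr_def)

lemma ennreal_powr_top [simp]: "ennreal_powr top a = top"
  by (simp add: ennreal_powr_def)

lemma ennreal_powr_0 [simp]: "ennreal_powr 0 a = 0"
  by (simp add: ennreal_powr_def)

lemma ennreal_powr_1 [simp]: "ennreal_powr 1 a = 1"
  by (simp add: ennreal_powr_def)

lemma ennreal_powr_one [simp]: "ennreal_powr u 1 = u"
  by (cases u) (simp_all add: ennreal_powr_ennreal)

lemma ennreal_powr_eq_0_iff [simp]: "ennreal_powr u a = 0 \<longleftrightarrow> u = 0"
  by (cases u) (auto simp: ennreal_powr_ennreal order.order_iff_strict ennreal_eq_0_iff)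

lemma ennreal_powr_eq_top_iff [simp]: "ennreal_powr u a = top \<longleftrightarrow> u = top"
  by (cases u) (auto simp: ennreal_powr_ennreal)

lemma ennreal_powr_mono:
  assumes "0 \<le> a" "u \<le> v" shows "ennreal_powr u a \<le> ennreal_powr v a"
  using assms by (cases u; cases v) (auto simp: ennreal_powr_ennreal powr_mono2 top_unique)

lemma ennreal_powr_le_iff:
  assumes "0 < a" shows "ennreal_powr u a \<le> ennreal_powr v a \<longleftrightarrow> u \<le> v"
proof
  assume le: "ennreal_powr u a \<le> ennreal_powr v a"
  show "u \<le> v"
  proof (rule ccontr)
    assume "\<not> u \<le> v"
    then have "ennreal_powr v a < ennreal_powr u a"
      using assms by (cases u; cases v) (auto simp: ennreal_powr_ennreal ennreal_less_iff not_le intro!: powr_less_mono2)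
    with le show False by simp
  qed
qed (use assms in \<open>auto intro: ennreal_powr_mono\<close>)

text \<open>Every power, even a negative one, fixes 0 and \<open>top\<close>; together with
  \<open>0 * top = 0\<close> this makes multiplicativity hold without side conditions.\<close>

lemma ennreal_powr_mult:
  "ennreal_powr (u * v) a = ennreal_powr u a * ennreal_powr v a"
proof (cases "u = 0 \<or> v = 0")
  case False
  then show ?thesis
    by (cases u; cases v)
      (auto simp: ennreal_powr_ennreal ennreal_mult[symmetric] powr_mult ennreal_mult_top ennreal_top_mult)
qed auto

lemma ennreal_powr_powr: "ennreal_powr (ennreal_powr u a) b = ennreal_powr u (a * b)"
  by (cases u) (auto simp: ennreal_powr_ennreal powr_powr)

lemma ennreal_powr_add: "ennreal_powr u (a + b) = ennreal_powr u a * ennreal_powr u b"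
  by (cases u) (auto simp: ennreal_powr_ennreal powr_add ennreal_mult)

lemma measurable_ennreal_powr [measurable (raw)]:
  assumes [measurable]: "f \<in> borel_measurable M"
  shows "(\<lambda>x. ennreal_powr (f x) a) \<in> borel_measurable M"
  unfolding ennreal_powr_def by measurable

lemma ennreal_Young:
  assumes a: "0 < a" "a < 1"
  shows "ennreal_powr u a * ennreal_powr v (1 - a) \<le> ennreal a * u + ennreal (1 - a) * v"
proof (cases "u = 0 \<or> v = 0 \<or> u = top \<or> v = top")
  case True
  then show ?thesis using a by (auto simp: ennreal_mult_top)
next
  case False
  then obtain x y where xy: "u = ennreal x" "0 < x" "v = ennreal y" "0 < y"
    by (cases u; cases v) (auto simp: order.order_iff_strict)
  have "x powr a * y powr (1 - a) \<le> a * x + (1 - a) * y"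
    using Youngs_inequality_0[of a "1 - a" x y] a xy by simp
  then show ?thesis
    using xy a by (simp add: ennreal_powr_ennreal ennreal_mult[symmetric] ennreal_plus[symmetric] del: ennreal_plus)
qed

text \<open>Young's inequality for \<open>U / A\<close> and \<open>V / B\<close>, where
  \<open>A\<close> and \<open>B\<close> are the two integrals, integrates to
  \<open>a + (1 - a) = 1\<close>. The form with exponents \<open>a\<close> and \<open>1 - a\<close>
  outside the integrals suits both the Muckenhoupt condition and the final interpolation.\<close>

lemma nn_integral_Holder:
  assumes a: "0 < a" "a < 1"
    and [measurable]: "U \<in> borel_measurable M" "V \<in> borel_measurable M"
  shows "(\<integral>\<^sup>+x. ennreal_powr (U x) a * ennreal_powr (V x) (1 - a) \<partial>M)
     \<le> ennreal_powr (\<integral>\<^sup>+x. U x \<partial>M) a * ennreal_powr (\<integral>\<^sup>+x. V x \<partial>M) (1 - a)"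
    (is "?L \<le> ennreal_powr ?A a * ennreal_powr ?B (1 - a)")
proof -
  consider "?A = 0 \<or> ?B = 0" | "?A \<noteq> 0" "?B \<noteq> 0" "?A = top \<or> ?B = top"
    | "?A \<noteq> 0" "?B \<noteq> 0" "?A \<noteq> top" "?B \<noteq> top" by blast
  then show ?thesis
  proof cases
    case 1
    then have "(AE x in M. U x = 0) \<or> (AE x in M. V x = 0)"
      by (auto simp: nn_integral_0_iff_AE)
    then have "AE x in M. ennreal_powr (U x) a * ennreal_powr (V x) (1 - a) = 0"
      by (elim disjE) (auto elim: eventually_mono)
    then have "?L = (\<integral>\<^sup>+x. 0 \<partial>M)" by (intro nn_integral_cong_AE) auto
    then show ?thesis by simp
  next
    case 2
    then have "ennreal_powr ?A a * ennreal_powr ?B (1 - a) = top"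
      by (auto simp: ennreal_mult_eq_top_iff)
    then show ?thesis by simp
  next
    case 3
    then obtain A B where AB: "?A = ennreal A" "0 < A" "?B = ennreal B" "0 < B"
      by (cases ?A; cases ?B) (auto simp: order.order_iff_strict)
    let ?c = "ennreal_powr ?A a * ennreal_powr ?B (1 - a)"
    have scale: "ennreal_powr u a * ennreal_powr v (1 - a)
       \<le> ?c * (ennreal (a / A) * u + ennreal ((1 - a) / B) * v)" for u v
    proof -
      have e: "u = ennreal A * (ennreal (1 / A) * u)" "v = ennreal B * (ennreal (1 / B) * v)"
        using AB by (simp_all add: mult.assoc[symmetric] ennreal_mult[symmetric])
      have "ennreal_powr u a * ennreal_powr v (1 - a)
         = ?c * (ennreal_powr (ennreal (1 / A) * u) a * ennreal_powr (ennreal (1 / B) * v) (1 - a))"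
      proof -
        have "ennreal_powr u a = ennreal_powr ?A a * ennreal_powr (ennreal (1 / A) * u) a"
          by (metis AB(1) e(1) ennreal_powr_mult)
        moreover have "ennreal_powr v (1 - a) = ennreal_powr ?B (1 - a) * ennreal_powr (ennreal (1 / B) * v) (1 - a)"
          by (metis AB(3) e(2) ennreal_powr_mult)
        ultimately show ?thesis by (simp only: mult_ac)
      qed
      also have "\<dots> \<le> ?c * (ennreal a * (ennreal (1 / A) * u) + ennreal (1 - a) * (ennreal (1 / B) * v))"
        by (intro mult_left_mono ennreal_Young a) simp
      also have "\<dots> = ?c * (ennreal (a / A) * u + ennreal ((1 - a) / B) * v)"
        using a AB by (simp add: mult.assoc[symmetric] ennreal_mult[symmetric])
      finally show ?thesis .
    qed
    have "?L \<le> (\<integral>\<^sup>+x. ?c * (ennreal (a / A) * U x + ennreal ((1 - a) / B) * V x) \<partial>M)"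
      by (intro nn_integral_mono scale)
    also have "\<dots> = ?c * (ennreal (a / A) * ?A + ennreal ((1 - a) / B) * ?B)"
      by (simp add: nn_integral_cmult nn_integral_add)
    also have "ennreal (a / A) * ?A + ennreal ((1 - a) / B) * ?B = ennreal (a / A * A + (1 - a) / B * B)"
    proof -
      have "ennreal (a / A) * ?A = ennreal (a / A * A)"
        unfolding AB(1) by (rule ennreal_mult[symmetric]) (use AB a in auto)
      moreover have "ennreal ((1 - a) / B) * ?B = ennreal ((1 - a) / B * B)"
        unfolding AB(3) by (rule ennreal_mult[symmetric]) (use AB a in auto)
      ultimately show ?thesis using AB(2,4) a by (simp flip: ennreal_plus)
    qed
    also have "a / A * A + (1 - a) / B * B = 1"
      using AB(2,4) by simp
    finally have "?L \<le> ?c * ennreal 1" .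
    then show ?thesis by simp
  qed
qed

subsection \<open>Maximal operators of doubling measures\<close>

text \<open>Balls need only contain \<open>x\<close>. Hence the sets where the function exceeds a
  level are unions of open balls, and an average over a ball bounds the function from below on the
  whole ball, which the weighted bound exploits. The measure is a parameter because three different
  ones occur: Lebesgue measure and those with densities \<open>w\<close> and \<sigma>.\<close>

definition maximal :: "'a::euclidean_space measure \<Rightarrow> ('a \<Rightarrow> ennreal) \<Rightarrow> 'a \<Rightarrow> ennreal" where
  "maximal \<mu> F x =
     (SUP (a, r) \<in> {(a, r). 0 < r \<and> x \<in> ball a r}. (\<integral>\<^sup>+y\<in>ball a r. F y \<partial>\<mu>) / emeasure \<mu> (ball a r))"

lemma maximal_upper:
  assumes "x \<in> ball a r"
  shows "(\<integral>\<^sup>+y\<in>ball a r. F y \<partial>\<mu>) / emeasure \<mu> (ball a r) \<le> maximal \<mu> F x"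
proof -
  have "0 < r" using assms by (metis ball_eq_empty empty_iff not_le)
  then show ?thesis unfolding maximal_def using assms
    by (intro SUP_upper2[of "(a, r)"]) auto
qed

lemma less_maximal_iff:
  "l < maximal \<mu> F x \<longleftrightarrow>
     (\<exists>a r. 0 < r \<and> x \<in> ball a r \<and> l < (\<integral>\<^sup>+y\<in>ball a r. F y \<partial>\<mu>) / emeasure \<mu> (ball a r))"
  unfolding maximal_def less_SUP_iff by auto

lemma maximal_mono:
  assumes "\<And>x. F x \<le> G x" shows "maximal \<mu> F x \<le> maximal \<mu> G x"
  unfolding maximal_def
  by (intro SUP_mono' case_prodI2)
     (auto split: prod.split intro!: divide_right_mono_ennreal nn_integral_mono mult_right_mono assms)

lemma maximal_cmult:
  assumes [measurable]: "F \<in> borel_measurable \<mu>" and "sets \<mu> = sets borel"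
  shows "maximal \<mu> (\<lambda>x. c * F x) x = c * maximal \<mu> F x"
proof -
  have [measurable]: "ball a r \<in> sets \<mu>" for a r using assms by simp
  show ?thesis
    unfolding maximal_def
    by (subst SUP_mult_left_ennreal)
       (auto simp: mult.assoc nn_integral_cmult ennreal_times_divide intro!: SUP_cong)
qed

lemma open_less_maximal: "open {x. l < maximal \<mu> F x}"
proof -
  have "{x. l < maximal \<mu> F x} =
    (\<Union>(a, r)\<in>{(a, r). 0 < r \<and> l < (\<integral>\<^sup>+y\<in>ball a r. F y \<partial>\<mu>) / emeasure \<mu> (ball a r)}. ball a r)"
    by (auto simp: less_maximal_iff; blast)
  then show ?thesis by auto
qed

lemma borel_measurable_maximal [measurable]: "maximal \<mu> F \<in> borel_measurable borel"
  by (rule borel_measurableI_greater) (simp add: open_less_maximal borel_open)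

text \<open>The fundamental theorem of calculus for \<open>l powr q\<close>. The strong type bound
  applies it twice, with exponents \<open>q\<close> and \<open>q - 1\<close>.\<close>

lemma ennreal_powr_layer_cake:
  assumes q: "0 < q"
  shows "(\<integral>\<^sup>+l. ennreal (q * l powr (q - 1)) * indicator {l. 0 < l \<and> ennreal l < z} l \<partial>lborel) = ennreal_powr z q"
    (is "?I z = _")
proof -
  have fin: "?I (ennreal c) = ennreal (c powr q)" if c: "0 \<le> c" for c
  proof -
    have "((\<lambda>x. q * x powr (q - 1)) has_integral (q * (c powr (q - 1 + 1) / (q - 1 + 1)))) {0..c}"
      using q c by (intro has_integral_mult_right has_integral_powr_from_0) auto
    then have "((\<lambda>x. q * x powr (q - 1)) has_integral c powr q) {0..c}"
      using q by simp
    then have "((\<lambda>x. q * x powr (q - 1) * indicator {0..c} x) has_integral c powr q) UNIV"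
      by (subst (asm) has_integral_restrict_UNIV[symmetric]) (simp add: indicator_def of_bool_def if_distrib cong: if_cong)
    then have "(\<integral>\<^sup>+x. ennreal (q * x powr (q - 1) * indicator {0..c} x) \<partial>lborel) = ennreal (c powr q)"
      using q by (intro nn_integral_has_integral_lborel) auto
    moreover have "?I (ennreal c) = (\<integral>\<^sup>+x. ennreal (q * x powr (q - 1) * indicator {0..c} x) \<partial>lborel)"
    proof (intro nn_integral_cong_AE)
      show "AE x in lborel. ennreal (q * x powr (q - 1)) * indicator {l. 0 < l \<and> ennreal l < ennreal c} x
        = ennreal (q * x powr (q - 1) * indicator {0..c} x)"
        using AE_lborel_singleton[of 0] AE_lborel_singleton[of c]
        by eventually_elim (use c in \<open>auto simp: indicator_def ennreal_less_iff\<close>)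
    qed
    ultimately show ?thesis by simp
  qed
  show ?thesis
  proof (cases z)
    case (real c)
    then show ?thesis using fin[of c] by (simp add: ennreal_powr_ennreal)
  next
    case top
    \<comment> \<open>For an infinite height the integral exceeds its value at every finite height,
      and those values are unbounded.\<close>
    have "ennreal x \<le> ?I top" if "0 \<le> x" for x
    proof -
      have "ennreal x = ?I (ennreal (x powr (1 / q)))"
        using that q by (subst fin) (auto simp: powr_powr)
      also have "\<dots> \<le> ?I top"
        by (intro nn_integral_mono mult_left_mono) (auto simp: indicator_def)
      finally show ?thesis .
    qed
    note le = this
    have "?I top = top"
    proof (rule ccontr)
      assume "?I top \<noteq> top"
      then obtain x where "?I top = ennreal x" "0 \<le> x" by (cases "?I top") auto
      then show False using le[of "x + 1"] by simp
    qed
    then show ?thesis using top by simp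
  qed
qed

text \<open>Countable subadditivity over an arbitrary countable index set, because the covering
  lemma selects a countable set of centre-radius pairs and not a sequence.\<close>

lemma emeasure_UN_countable_le:
  assumes [measurable]: "\<And>i. i \<in> I \<Longrightarrow> X i \<in> sets M" and I: "countable I"
  shows "emeasure M (\<Union>(X ` I)) \<le> (\<integral>\<^sup>+i. emeasure M (X i) \<partial>count_space I)"
proof -
  have [measurable]: "\<Union>(X ` I) \<in> sets M" using I by auto
  have "emeasure M (\<Union>(X ` I)) = (\<integral>\<^sup>+x. indicator (\<Union>(X ` I)) x \<partial>M)" by simp
  also have "\<dots> \<le> (\<integral>\<^sup>+x. \<integral>\<^sup>+i. indicator (X i) x \<partial>count_space I \<partial>M)"
  proof (intro nn_integral_mono)
    fix x show "indicator (\<Union>(X ` I)) x \<le> (\<integral>\<^sup>+i. indicator (X i) x \<partial>count_space I)"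
    proof (cases "x \<in> \<Union>(X ` I)")
      case True
      then obtain j where "j \<in> I" "x \<in> X j" by blast
      then show ?thesis
        using nn_integral_ge_point[of j I "\<lambda>i. indicator (X i) x"] True by simp
    qed simp
  qed
  also have "\<dots> = (\<integral>\<^sup>+i. emeasure M (X i) \<partial>count_space I)"
    using I by (simp add: nn_integral_count_space_nn_integral cong: nn_integral_cong_simp)
  finally show ?thesis .
qed

text \<open>The dilation factor is 5 because this is the enlargement in the Vitali covering
  lemma.\<close>

locale doubling_measure =
  fixes \<mu> :: "'a::euclidean_space measure" and D :: real
  assumes sets_eq [measurable_cong]: "sets \<mu> = sets borel"
    and ball_pos: "0 < r \<Longrightarrow> emeasure \<mu> (ball a r) \<noteq> 0"
    and ball_finite: "emeasure \<mu> (ball a r) \<noteq> top"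
    and doubling: "0 < r \<Longrightarrow> emeasure \<mu> (ball a (5 * r)) \<le> ennreal D * emeasure \<mu> (ball a r)"
    and D_nonneg: "0 \<le> D"
begin

lemma space_eq [simp]: "space \<mu> = UNIV"
  using sets_eq_imp_space_eq[OF sets_eq] by simp

lemma sigma_finite: "sigma_finite_measure \<mu>"
proof
  show "\<exists>A. countable A \<and> A \<subseteq> sets \<mu> \<and> \<Union> A = space \<mu> \<and> (\<forall>a\<in>A. emeasure \<mu> a \<noteq> \<infinity>)"
  proof (intro exI[of _ "range (\<lambda>n. ball 0 (real n))"] conjI)
    show "\<Union> (range (\<lambda>n. ball 0 (real n))) = space \<mu>"
      using reals_Archimedean2 by fastforce
  qed (auto simp: ball_finite sets_eq)
qed

text \<open>Vitali's argument: among the balls with average above \<open>l\<close>, disjoint ones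
  are selected whose fivefold enlargements still cover. Doubling pays for the enlargement, and
  disjointness sums the integrals of \<open>F\<close> to at most the total.\<close>

lemma weak_type:
  assumes [measurable]: "F \<in> borel_measurable borel" and l: "0 < l"
  shows "ennreal l * emeasure \<mu> {x. ennreal l < maximal \<mu> F x} \<le> ennreal D * (\<integral>\<^sup>+x. F x \<partial>\<mu>)"
proof -
  \<comment> \<open>The covering lemma requires bounded radii; the bound \<open>N\<close> is removed
    at the end by monotone convergence along \<open>E\<close>.\<close>
  define K where "K N = {(a, r). 0 < r \<and> r \<le> real N
    \<and> ennreal l < (\<integral>\<^sup>+y\<in>ball a r. F y \<partial>\<mu>) / emeasure \<mu> (ball a r)}" for N
  define E where "E N = (\<Union>i\<in>K N. ball (fst i) (snd i))" for N
  have [measurable]: "E N \<in> sets \<mu>" for N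
    unfolding E_def sets_eq by (intro borel_open) auto
  have "incseq E"
    unfolding E_def K_def incseq_def by (auto intro!: UN_mono)
  have un: "{x. ennreal l < maximal \<mu> F x} = (\<Union>N. E N)"
  proof (intro set_eqI iffI)
    fix x assume "x \<in> {x. ennreal l < maximal \<mu> F x}"
    then obtain a r where *: "0 < r" "x \<in> ball a r" "ennreal l < (\<integral>\<^sup>+y\<in>ball a r. F y \<partial>\<mu>) / emeasure \<mu> (ball a r)"
      unfolding less_maximal_iff by blast
    obtain N where "r \<le> real N" using real_arch_simple by blast
    with * have "(a, r) \<in> K N" by (auto simp: K_def)
    then have "x \<in> E N" using * unfolding E_def by force
    then show "x \<in> (\<Union>N. E N)" by blast
  next
    fix x assume "x \<in> (\<Union>N. E N)"
    then show "x \<in> {x. ennreal l < maximal \<mu> F x}"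
      unfolding E_def K_def less_maximal_iff mem_Collect_eq by fastforce
  qed
  have E_le: "ennreal l * emeasure \<mu> (E N) \<le> ennreal D * (\<integral>\<^sup>+x. F x \<partial>\<mu>)" for N
  proof -
    obtain C where C: "countable C" "C \<subseteq> K N"
      "pairwise (\<lambda>i j. disjnt (ball (fst i) (snd i)) (ball (fst j) (snd j))) C"
      "E N \<subseteq> (\<Union>i\<in>C. ball (fst i) (5 * snd i))"
    proof (rule Vitali_covering_lemma_balls[where S = "E N" and K = "K N" and a = fst and r = snd and B = "real N"])
      show "E N \<subseteq> (\<Union>i\<in>K N. ball (fst i) (snd i))" by (simp add: E_def)
      show "0 < snd i \<and> snd i \<le> real N" if "i \<in> K N" for i using that by (auto simp: K_def)
    qed
    have lball: "ennreal l * emeasure \<mu> (ball (fst i) (snd i)) \<le> (\<integral>\<^sup>+y\<in>ball (fst i) (snd i). F y \<partial>\<mu>)"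
      if "i \<in> C" for i
    proof -
      have i: "0 < snd i" "ennreal l < (\<integral>\<^sup>+y\<in>ball (fst i) (snd i). F y \<partial>\<mu>) / emeasure \<mu> (ball (fst i) (snd i))"
        using that C(2) by (auto simp: K_def)
      have "ennreal l * emeasure \<mu> (ball (fst i) (snd i))
        \<le> (\<integral>\<^sup>+y\<in>ball (fst i) (snd i). F y \<partial>\<mu>) / emeasure \<mu> (ball (fst i) (snd i)) * emeasure \<mu> (ball (fst i) (snd i))"
        using i by (intro mult_right_mono) auto
      also have "\<dots> = (\<integral>\<^sup>+y\<in>ball (fst i) (snd i). F y \<partial>\<mu>)"
        using ball_pos[OF i(1)] ball_finite
        by (simp add: ennreal_divide_times ennreal_divide_self less_top[symmetric])
      finally show ?thesis .
    qed
    have meas: "ball (fst i) r \<in> sets \<mu>" for i :: "'a \<times> real" and r by (simp add: sets_eq)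
    have "emeasure \<mu> (E N) \<le> emeasure \<mu> (\<Union>i\<in>C. ball (fst i) (5 * snd i))"
      using C by (intro emeasure_mono) (auto simp: sets_eq)
    also have "\<dots> \<le> (\<integral>\<^sup>+i. emeasure \<mu> (ball (fst i) (5 * snd i)) \<partial>count_space C)"
      using C(1) meas by (intro emeasure_UN_countable_le)
    finally have "ennreal l * emeasure \<mu> (E N) \<le> ennreal l * \<dots>"
      by (intro mult_left_mono) auto
    also have "\<dots> = (\<integral>\<^sup>+i. ennreal l * emeasure \<mu> (ball (fst i) (5 * snd i)) \<partial>count_space C)"
      by (simp add: nn_integral_cmult)
    also have "\<dots> \<le> (\<integral>\<^sup>+i. ennreal D * (\<integral>\<^sup>+y\<in>ball (fst i) (snd i). F y \<partial>\<mu>) \<partial>count_space C)"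
    proof (intro nn_integral_mono)
      fix i assume "i \<in> space (count_space C)"
      then have i: "i \<in> C" by simp
      then have "0 < snd i" using C(2) by (auto simp: K_def)
      from doubling[OF this, of "fst i"]
      have "ennreal l * emeasure \<mu> (ball (fst i) (5 * snd i))
        \<le> ennreal l * (ennreal D * emeasure \<mu> (ball (fst i) (snd i)))"
        by (intro mult_left_mono) auto
      also have "\<dots> = ennreal D * (ennreal l * emeasure \<mu> (ball (fst i) (snd i)))"
        by (simp add: mult_ac)
      also have "\<dots> \<le> ennreal D * (\<integral>\<^sup>+y\<in>ball (fst i) (snd i). F y \<partial>\<mu>)"
        using lball[OF i] by (intro mult_left_mono) auto
      finally show "ennreal l * emeasure \<mu> (ball (fst i) (5 * snd i))
        \<le> ennreal D * (\<integral>\<^sup>+y\<in>ball (fst i) (snd i). F y \<partial>\<mu>)" .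
    qed
    \<comment> \<open>Reading the integrals of \<open>F\<close> as values of the measure
      \<open>density \<mu> F\<close> turns the disjointness of the balls into countable
      additivity.\<close>
    also have "\<dots> = ennreal D * (\<integral>\<^sup>+i. emeasure (density \<mu> F) (ball (fst i) (snd i)) \<partial>count_space C)"
      by (simp add: nn_integral_cmult emeasure_density meas)
    also have "(\<integral>\<^sup>+i. emeasure (density \<mu> F) (ball (fst i) (snd i)) \<partial>count_space C)
       = emeasure (density \<mu> F) (\<Union>i\<in>C. ball (fst i) (snd i))"
      using C by (intro emeasure_UN_countable[symmetric])
        (auto simp: sets_eq pairwise_def disjnt_def disjoint_family_on_def)
    also have "ennreal D * \<dots> \<le> ennreal D * emeasure (density \<mu> F) (space (density \<mu> F))"
      by (intro mult_left_mono emeasure_space) auto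
    also have "emeasure (density \<mu> F) (space (density \<mu> F)) = (\<integral>\<^sup>+x. F x \<partial>\<mu>)"
      by (simp add: emeasure_density)
    finally show ?thesis .
  qed
  have "ennreal l * emeasure \<mu> (\<Union>N. E N) = ennreal l * (SUP N. emeasure \<mu> (E N))"
    using \<open>incseq E\<close> by (subst SUP_emeasure_incseq) auto
  also have "\<dots> = (SUP N. ennreal l * emeasure \<mu> (E N))"
    by (simp add: SUP_mult_left_ennreal)
  also have "\<dots> \<le> ennreal D * (\<integral>\<^sup>+x. F x \<partial>\<mu>)"
    by (intro SUP_least E_le)
  finally show ?thesis unfolding un .
qed

text \<open>\<open>F\<close> is at most its part above \<open>c\<close> plus the constant
  \<open>c\<close>, and averaging a constant returns it. With \<open>c\<close> half of a level, only
  large values of \<open>F\<close> contribute to the set where the maximal function exceeds that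
  level.\<close>

lemma maximal_le_truncated:
  assumes [measurable]: "F \<in> borel_measurable borel" and c: "c \<noteq> top"
  shows "maximal \<mu> F x \<le> maximal \<mu> (\<lambda>y. F y * indicator {y. c < F y} y) x + c"
  unfolding maximal_def[of _ F]
proof (intro SUP_least, clarify)
  fix a r assume r: "0 < (r::real)" "x \<in> ball a r"
  have [measurable]: "ball a r \<in> sets \<mu>" by (simp add: sets_eq)
  have "(\<integral>\<^sup>+y\<in>ball a r. F y \<partial>\<mu>) \<le> (\<integral>\<^sup>+y. F y * indicator {y. c < F y} y * indicator (ball a r) y
      + c * indicator (ball a r) y \<partial>\<mu>)"
    by (intro nn_integral_mono) (auto simp: indicator_def)
  also have "\<dots> = (\<integral>\<^sup>+y\<in>ball a r. F y * indicator {y. c < F y} y \<partial>\<mu>) + c * emeasure \<mu> (ball a r)"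
    by (simp add: nn_integral_add nn_integral_cmult)
  finally have "(\<integral>\<^sup>+y\<in>ball a r. F y \<partial>\<mu>) / emeasure \<mu> (ball a r)
     \<le> \<dots> / emeasure \<mu> (ball a r)" by (rule divide_right_mono_ennreal)
  also have "\<dots> = (\<integral>\<^sup>+y\<in>ball a r. F y * indicator {y. c < F y} y \<partial>\<mu>) / emeasure \<mu> (ball a r) + c"
    using ball_pos[OF r(1), of a] ball_finite[of a r]
    by (simp add: divide_ennreal_def ring_distribs mult.assoc ennreal_divide_self[unfolded divide_ennreal_def] less_top[symmetric])
  also have "\<dots> \<le> maximal \<mu> (\<lambda>y. F y * indicator {y. c < F y} y) x + c"
    by (intro add_right_mono maximal_upper r)
  finally show "(\<integral>\<^sup>+y\<in>ball a r. F y \<partial>\<mu>) / emeasure \<mu> (ball a r)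
     \<le> maximal \<mu> (\<lambda>y. F y * indicator {y. c < F y} y) x + c" .
qed

text \<open>Marcinkiewicz interpolation between the weak type bound and the trivial bound for
  bounded functions: at each level \<open>l\<close> the weak bound is applied to the part of
  \<open>F\<close> above \<open>l / 2\<close>, and Tonelli's theorem exchanges the integrals over
  levels and points.\<close>

lemma strong_type:
  assumes [measurable]: "F \<in> borel_measurable borel" and q: "1 < q"
  shows "(\<integral>\<^sup>+x. ennreal_powr (maximal \<mu> F x) q \<partial>\<mu>)
    \<le> ennreal (2 powr q * D * q / (q - 1)) * (\<integral>\<^sup>+x. ennreal_powr (F x) q \<partial>\<mu>)"
proof -
  interpret sigma_finite_measure \<mu> by (rule sigma_finite)
  interpret pair_sigma_finite lborel \<mu> ..
  have level: "ennreal (q * l powr (q - 1)) * indicator {0<..} l * emeasure \<mu> {x. ennreal l < maximal \<mu> F x}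
    \<le> (\<integral>\<^sup>+x. ennreal (2 * D * q * l powr (q - 2)) * (F x * indicator {l. 0 < l \<and> ennreal l < 2 * F x} l) \<partial>\<mu>)" for l
  proof (cases "0 < l")
    case False then show ?thesis by simp
  next
    case True
    let ?G = "\<lambda>y. F y * indicator {y. ennreal (l / 2) < F y} y"
    let ?m = "emeasure \<mu> {x. ennreal l < maximal \<mu> F x}"
    have two: "ennreal l = 2 * ennreal (l / 2)"
      using True by (simp add: ennreal_mult[symmetric] flip: ennreal_numeral)
    have "?m \<le> emeasure \<mu> {x. ennreal (l / 2) < maximal \<mu> ?G x}"
    proof (intro emeasure_mono)
      show "{x. ennreal l < maximal \<mu> F x} \<subseteq> {x. ennreal (l / 2) < maximal \<mu> ?G x}"
      proof clarify
        fix x assume "ennreal l < maximal \<mu> F x"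
        also have "\<dots> \<le> maximal \<mu> ?G x + ennreal (l / 2)"
          by (rule maximal_le_truncated) auto
        finally have "ennreal (l / 2) + ennreal (l / 2) < maximal \<mu> ?G x + ennreal (l / 2)"
          unfolding two mult_2 .
        then show "ennreal (l / 2) < maximal \<mu> ?G x"
          by (meson add_right_mono linorder_not_le)
      qed
      show "{x. ennreal (l / 2) < maximal \<mu> ?G x} \<in> sets \<mu>"
        unfolding sets_eq by (intro borel_open open_less_maximal)
    qed
    then have "ennreal (l / 2) * ?m \<le> ennreal (l / 2) * emeasure \<mu> {x. ennreal (l / 2) < maximal \<mu> ?G x}"
      by (intro mult_left_mono) auto
    also have "\<dots> \<le> ennreal D * (\<integral>\<^sup>+x. ?G x \<partial>\<mu>)"
      using True by (intro weak_type) auto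
    finally have *: "ennreal (l / 2) * ?m \<le> ennreal D * (\<integral>\<^sup>+x. ?G x \<partial>\<mu>)" .
    have "q * l powr (q - 1) = (2 * q * l powr (q - 2)) * (l / 2)"
      using True by (simp add: powr_diff power2_eq_square field_simps)
    then have "ennreal (q * l powr (q - 1)) * ?m = ennreal (2 * q * l powr (q - 2)) * (ennreal (l / 2) * ?m)"
      using True q by (simp only: mult.assoc[symmetric]) (subst ennreal_mult, auto)
    also have "\<dots> \<le> ennreal (2 * q * l powr (q - 2)) * (ennreal D * (\<integral>\<^sup>+x. ?G x \<partial>\<mu>))"
      using * by (intro mult_left_mono) auto
    also have "\<dots> = ennreal (2 * q * l powr (q - 2) * D) * (\<integral>\<^sup>+x. ?G x \<partial>\<mu>)"
      using q D_nonneg by (subst ennreal_mult) (auto simp: mult.assoc)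
    also have "\<dots> = (\<integral>\<^sup>+x. ennreal (2 * D * q * l powr (q - 2)) * ?G x \<partial>\<mu>)"
      by (subst nn_integral_cmult) (auto simp: mult_ac)
    also have "\<dots> = (\<integral>\<^sup>+x. ennreal (2 * D * q * l powr (q - 2)) * (F x * indicator {l. 0 < l \<and> ennreal l < 2 * F x} l) \<partial>\<mu>)"
    proof (intro nn_integral_cong)
      fix x
      have "ennreal (l / 2) < F x \<longleftrightarrow> ennreal l < 2 * F x"
        unfolding two
        by (simp add: ennreal_mult_le_mult_iff flip: linorder_not_le)
      then show "ennreal (2 * D * q * l powr (q - 2)) * ?G x =
        ennreal (2 * D * q * l powr (q - 2)) * (F x * indicator {l. 0 < l \<and> ennreal l < 2 * F x} l)"
        using True by (auto simp: indicator_def)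
    qed
    finally show ?thesis using True by simp
  qed
  have "(\<integral>\<^sup>+x. ennreal_powr (maximal \<mu> F x) q \<partial>\<mu>)
    = (\<integral>\<^sup>+x. (\<integral>\<^sup>+l. ennreal (q * l powr (q - 1)) * indicator {l. 0 < l \<and> ennreal l < maximal \<mu> F x} l \<partial>lborel) \<partial>\<mu>)"
    using q by (simp add: ennreal_powr_layer_cake)
  also have "\<dots> = (\<integral>\<^sup>+l. (\<integral>\<^sup>+x. ennreal (q * l powr (q - 1)) * indicator {l. 0 < l \<and> ennreal l < maximal \<mu> F x} l \<partial>\<mu>) \<partial>lborel)"
    by (rule Fubini') (simp add: indicator_def; measurable)
  also have "\<dots> = (\<integral>\<^sup>+l. ennreal (q * l powr (q - 1)) * indicator {0<..} l * emeasure \<mu> {x. ennreal l < maximal \<mu> F x} \<partial>lborel)"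
  proof (intro nn_integral_cong)
    fix l :: real
    have [measurable]: "{x. ennreal l < maximal \<mu> F x} \<in> sets \<mu>"
      unfolding sets_eq by (intro borel_open open_less_maximal)
    have "(\<integral>\<^sup>+x. ennreal (q * l powr (q - 1)) * indicator {l. 0 < l \<and> ennreal l < maximal \<mu> F x} l \<partial>\<mu>)
      = (\<integral>\<^sup>+x. ennreal (q * l powr (q - 1)) * indicator {0<..} l * indicator {x. ennreal l < maximal \<mu> F x} x \<partial>\<mu>)"
      by (intro nn_integral_cong) (auto simp: indicator_def)
    then show "(\<integral>\<^sup>+x. ennreal (q * l powr (q - 1)) * indicator {l. 0 < l \<and> ennreal l < maximal \<mu> F x} l \<partial>\<mu>)
      = ennreal (q * l powr (q - 1)) * indicator {0<..} l * emeasure \<mu> {x. ennreal l < maximal \<mu> F x}"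
      by (simp add: nn_integral_cmult_indicator)
  qed
  also have "\<dots> \<le> (\<integral>\<^sup>+l. (\<integral>\<^sup>+x. ennreal (2 * D * q * l powr (q - 2)) * (F x * indicator {l. 0 < l \<and> ennreal l < 2 * F x} l) \<partial>\<mu>) \<partial>lborel)"
    by (intro nn_integral_mono level)
  also have "\<dots> = (\<integral>\<^sup>+x. (\<integral>\<^sup>+l. ennreal (2 * D * q * l powr (q - 2)) * (F x * indicator {l. 0 < l \<and> ennreal l < 2 * F x} l) \<partial>lborel) \<partial>\<mu>)"
    by (rule Fubini'[symmetric]) (simp add: indicator_def; measurable)
  also have "\<dots> = (\<integral>\<^sup>+x. ennreal (2 powr q * D * q / (q - 1)) * ennreal_powr (F x) q \<partial>\<mu>)"
  proof (intro nn_integral_cong)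
    fix x
    have "(\<integral>\<^sup>+l. ennreal (2 * D * q * l powr (q - 2)) * (F x * indicator {l. 0 < l \<and> ennreal l < 2 * F x} l) \<partial>lborel)
      = (\<integral>\<^sup>+l. (ennreal (2 * D * q / (q - 1)) * F x) *
           (ennreal ((q - 1) * l powr (q - 1 - 1)) * indicator {l. 0 < l \<and> ennreal l < 2 * F x} l) \<partial>lborel)"
    proof (intro nn_integral_cong)
      fix l :: real
      have "2 * D * q * l powr (q - 2) = (2 * D * q / (q - 1)) * ((q - 1) * l powr (q - 1 - 1))"
        using q by (simp add: field_simps)
      then have "ennreal (2 * D * q * l powr (q - 2)) = ennreal (2 * D * q / (q - 1)) * ennreal ((q - 1) * l powr (q - 1 - 1))"
        using q D_nonneg by (simp only:) (subst ennreal_mult, auto)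
      then show "ennreal (2 * D * q * l powr (q - 2)) * (F x * indicator {l. 0 < l \<and> ennreal l < 2 * F x} l)
        = (ennreal (2 * D * q / (q - 1)) * F x) *
           (ennreal ((q - 1) * l powr (q - 1 - 1)) * indicator {l. 0 < l \<and> ennreal l < 2 * F x} l)"
        by (simp only: mult_ac)
    qed
    \<comment> \<open>Layer cake with exponent \<open>q - 1\<close>; here \<open>1 < q\<close> is
      essential. The height is \<open>2 * F x\<close> because of the truncation at half the
      level.\<close>
    also have "\<dots> = (ennreal (2 * D * q / (q - 1)) * F x) * ennreal_powr (2 * F x) (q - 1)"
      using q ennreal_powr_layer_cake[of "q - 1" "2 * F x"] by (subst nn_integral_cmult) simp_all
    also have "\<dots> = ennreal (2 * D * q / (q - 1)) * ennreal (2 powr (q - 1)) * (ennreal_powr (F x) 1 * ennreal_powr (F x) (q - 1))"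
      using ennreal_powr_ennreal[of 2 "q - 1"] by (simp add: ennreal_powr_mult mult_ac)
    also have "\<dots> = ennreal (2 * D * q / (q - 1)) * ennreal (2 powr (q - 1)) * ennreal_powr (F x) q"
      by (subst ennreal_powr_add[symmetric]) simp
    also have "ennreal (2 * D * q / (q - 1)) * ennreal (2 powr (q - 1)) = ennreal (2 powr q * D * q / (q - 1))"
      using q D_nonneg by (subst ennreal_mult[symmetric]) (auto simp: powr_diff divide_simps)
    finally show "(\<integral>\<^sup>+l. ennreal (2 * D * q * l powr (q - 2)) * (F x * indicator {l. 0 < l \<and> ennreal l < 2 * F x} l) \<partial>lborel)
      = ennreal (2 powr q * D * q / (q - 1)) * ennreal_powr (F x) q" .
  qed
  also have "\<dots> = ennreal (2 powr q * D * q / (q - 1)) * (\<integral>\<^sup>+x. ennreal_powr (F x) q \<partial>\<mu>)"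
    by (simp add: nn_integral_cmult)
  finally show ?thesis .
qed

end

subsection \<open>Muckenhoupt weights\<close>

text \<open>Hoelder's inequality bounds the volume of the small ball from above by both masses; the
  Muckenhoupt condition on the fivefold ball is the reverse inequality. Since the mass of \<sigma>
  grows with the ball it cancels, leaving the volume ratio \<open>5 ^ DIM('a)\<close>. The
  hypotheses are symmetric under exchanging \<open>w\<close> with \<sigma> and \<open>a\<close> with
  \<open>1 - a\<close>, so the lemma serves for both measures.\<close>

lemma doubling_measure_density:
  fixes w \<sigma> :: "'a::euclidean_space \<Rightarrow> ennreal"
  assumes a: "0 < a" "a < 1"
    and [measurable]: "w \<in> borel_measurable borel" "\<sigma> \<in> borel_measurable borel"
    and dual: "AE x in lborel. ennreal_powr (w x) a * ennreal_powr (\<sigma> x) (1 - a) = 1"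
    and fin: "\<And>c r. (\<integral>\<^sup>+x\<in>ball c r. w x \<partial>lborel) \<noteq> top" "\<And>c r. (\<integral>\<^sup>+x\<in>ball c r. \<sigma> x \<partial>lborel) \<noteq> top"
    and Ap: "\<And>c r. 0 < r \<Longrightarrow> ennreal_powr (\<integral>\<^sup>+x\<in>ball c r. w x \<partial>lborel) a
        * ennreal_powr (\<integral>\<^sup>+x\<in>ball c r. \<sigma> x \<partial>lborel) (1 - a) \<le> ennreal K * emeasure lborel (ball c r)"
    and K: "0 \<le> K"
  shows "doubling_measure (density lborel w) ((K * 5 ^ DIM('a)) powr (1 / a))"
proof
  have [measurable]: "ball c r \<in> sets borel" for c :: 'a and r by simp
  let ?w = "\<lambda>c r. \<integral>\<^sup>+x\<in>ball c r. w x \<partial>lborel" and ?\<sigma> = "\<lambda>c r. \<integral>\<^sup>+x\<in>ball c r. \<sigma> x \<partial>lborel"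
  have em: "emeasure (density lborel w) (ball c r) = ?w c r" for c r
    by (simp add: emeasure_density)
  have low: "emeasure lborel (ball c r) \<le> ennreal_powr (?w c r) a * ennreal_powr (?\<sigma> c r) (1 - a)" for c r
  proof -
    have "emeasure lborel (ball c r) = (\<integral>\<^sup>+x. indicator (ball c r) x \<partial>lborel)" by simp
    also have "\<dots> = (\<integral>\<^sup>+x. ennreal_powr (w x * indicator (ball c r) x) a
        * ennreal_powr (\<sigma> x * indicator (ball c r) x) (1 - a) \<partial>lborel)"
      using dual by (intro nn_integral_cong_AE) (auto elim!: eventually_mono simp: indicator_def)
    also have "\<dots> \<le> ennreal_powr (?w c r) a * ennreal_powr (?\<sigma> c r) (1 - a)"
      by (rule nn_integral_Holder[OF a]) auto
    finally show ?thesis .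
  qed
  have ball: "emeasure lborel (ball c r) \<noteq> 0" if "0 < r" for c :: 'a and r
    using that by (simp add: emeasure_ball ennreal_eq_0_iff not_le unit_ball_vol_pos)
  \<comment> \<open>A product that bounds a positive volume has no vanishing factor.\<close>
  have pos: "?w c r \<noteq> 0" "?\<sigma> c r \<noteq> 0" if "0 < r" for c r
    using low[of c r] ball[OF that, of c] by auto
  show "sets (density lborel w) = sets borel" by simp
  show "emeasure (density lborel w) (ball c r) \<noteq> 0" if "0 < r" for c r
    using pos[OF that] em by auto
  show "emeasure (density lborel w) (ball c r) \<noteq> top" for c r using fin em by auto
  show "0 \<le> (K * 5 ^ DIM('a)) powr (1 / a)" by simp
  show "emeasure (density lborel w) (ball c (5 * r))
      \<le> ennreal ((K * 5 ^ DIM('a)) powr (1 / a)) * emeasure (density lborel w) (ball c r)" if r: "0 < r" for c r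
  proof -
    let ?s = "ennreal_powr (?\<sigma> c (5 * r)) (1 - a)"
    have "?s * ennreal_powr (?w c (5 * r)) a \<le> ennreal K * emeasure lborel (ball c (5 * r))"
      using Ap[of "5 * r" c] r by (simp add: mult.commute)
    also have "\<dots> = ennreal (K * 5 ^ DIM('a)) * emeasure lborel (ball c r)"
      using r K by (simp add: emeasure_ball power_mult_distrib mult_ac ennreal_mult[symmetric])
    also have "\<dots> \<le> ennreal (K * 5 ^ DIM('a)) * (ennreal_powr (?w c r) a * ?s)"
    proof (intro mult_left_mono order.trans[OF low] ennreal_powr_mono)
      show "?\<sigma> c r \<le> ?\<sigma> c (5 * r)"
        using r by (intro nn_integral_mono mult_left_mono) (auto simp: indicator_def)
    qed (use a in auto)
    also have "\<dots> = ?s * (ennreal (K * 5 ^ DIM('a)) * ennreal_powr (?w c r) a)"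
      by (simp add: mult_ac)
    finally have "ennreal_powr (?w c (5 * r)) a \<le> ennreal (K * 5 ^ DIM('a)) * ennreal_powr (?w c r) a"
      using pos(2)[of "5 * r" c] fin(2)[of c "5 * r"] r
      by (subst (asm) ennreal_mult_le_mult_iff) auto
    also have "\<dots> = ennreal_powr (ennreal ((K * 5 ^ DIM('a)) powr (1 / a)) * ?w c r) a"
      using a K by (simp add: ennreal_powr_mult ennreal_powr_ennreal powr_powr)
    finally show ?thesis
      unfolding em using a by (simp add: ennreal_powr_le_iff)
  qed
qed

text \<open>Lerner's argument: on a ball \<open>B\<close> the average of \<open>F\<close> is \<open>\<sigma>(B)/|B|\<close> times a \<open>\<sigma>\<close>-average, which is
  below the \<open>\<sigma>\<close>-maximal function \<open>N\<close> everywhere on \<open>B\<close>; hence its power \<open>p - 1\<close> is controlled by the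
  \<open>w\<close>-average of \<open>N powr (p - 1) / w\<close>.\<close>

theorem maximal_weighted_bound:
  fixes w \<sigma> :: "'a::euclidean_space \<Rightarrow> ennreal"
  assumes p: "1 < p"
    and [measurable]: "w \<in> borel_measurable borel" "\<sigma> \<in> borel_measurable borel"
    and wfin: "\<And>x. w x \<noteq> top" "\<And>x. \<sigma> x \<noteq> top"
    and dual: "AE x in lborel. ennreal_powr (w x) (1 / p) * ennreal_powr (\<sigma> x) (1 - 1 / p) = 1"
    and fin: "\<And>c r. (\<integral>\<^sup>+x\<in>ball c r. w x \<partial>lborel) \<noteq> top" "\<And>c r. (\<integral>\<^sup>+x\<in>ball c r. \<sigma> x \<partial>lborel) \<noteq> top"
    and Ap: "\<And>c r. 0 < r \<Longrightarrow> ennreal_powr (\<integral>\<^sup>+x\<in>ball c r. w x \<partial>lborel) (1 / p)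
        * ennreal_powr (\<integral>\<^sup>+x\<in>ball c r. \<sigma> x \<partial>lborel) (1 - 1 / p) \<le> ennreal K * emeasure lborel (ball c r)"
    and K: "0 \<le> K"
  obtains C where "0 \<le> C"
    "\<And>F. F \<in> borel_measurable borel \<Longrightarrow> (\<integral>\<^sup>+x. w x * ennreal_powr (maximal lborel F x) p \<partial>lborel)
      \<le> ennreal C * (\<integral>\<^sup>+x. w x * ennreal_powr (F x) p \<partial>lborel)"
proof -
  have [measurable]: "ball c r \<in> sets borel" for c :: 'a and r by simp
  define W where "W = density lborel w"
  define S where "S = density lborel \<sigma>"
  \<comment> \<open>The conjugate exponent: because \<open>(p - 1) * q = p\<close>, the bound for
    the \<open>w\<close>-maximal operator is applied with exponent \<open>q\<close>, the one for the
    \<sigma>-maximal operator with exponent \<open>p\<close>.\<close>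
  define q where "q = p / (p - 1)"
  have q: "1 < q" using p by (simp add: q_def field_simps)
  have dual': "AE x in lborel. ennreal_powr (\<sigma> x) (1 - 1 / p) * ennreal_powr (w x) (1 - (1 - 1 / p)) = 1"
    using dual by (simp add: mult.commute)
  have Ap': "ennreal_powr (\<integral>\<^sup>+x\<in>ball c r. \<sigma> x \<partial>lborel) (1 - 1 / p)
        * ennreal_powr (\<integral>\<^sup>+x\<in>ball c r. w x \<partial>lborel) (1 - (1 - 1 / p)) \<le> ennreal K * emeasure lborel (ball c r)"
    if "0 < r" for c r using Ap[OF that, of c] by (simp add: mult.commute)
  obtain D where "doubling_measure W D"
    unfolding W_def using doubling_measure_density[OF _ _ _ _ dual fin Ap K] p by auto
  then interpret W: doubling_measure W D .
  obtain D' where "doubling_measure S D'"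
    unfolding S_def using doubling_measure_density[OF _ _ _ _ dual' fin(2,1) Ap' K] p by auto
  then interpret S: doubling_measure S D' .
  define Cw where "Cw = 2 powr q * D * q / (q - 1)"
  define Cs where "Cs = 2 powr p * D' * p / (p - 1)"
  have Cpos: "0 \<le> Cw" "0 \<le> Cs"
    unfolding Cw_def Cs_def using p q W.D_nonneg S.D_nonneg by auto
  \<comment> \<open>The duality relation in the form \<open>w * \<sigma> powr (p - 1) = 1\<close>,
    which determines each of the two weights from the other.\<close>
  have wp: "ennreal_powr (w x) 1 * ennreal_powr (\<sigma> x) (p - 1) = 1"
    if "ennreal_powr (w x) (1 / p) * ennreal_powr (\<sigma> x) (1 - 1 / p) = 1" for x
  proof -
    have "ennreal_powr (ennreal_powr (w x) (1 / p) * ennreal_powr (\<sigma> x) (1 - 1 / p)) p = 1"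
      by (simp add: that)
    then show ?thesis using p by (simp add: ennreal_powr_mult ennreal_powr_powr left_diff_distrib)
  qed
  have nz: "w x \<noteq> 0 \<and> \<sigma> x \<noteq> 0"
    if "ennreal_powr (w x) (1 / p) * ennreal_powr (\<sigma> x) (1 - 1 / p) = 1" for x
    using that by auto
  have main: "(\<integral>\<^sup>+x. w x * ennreal_powr (maximal lborel F x) p \<partial>lborel)
      \<le> ennreal (K powr (p * q) * Cw * Cs) * (\<integral>\<^sup>+x. w x * ennreal_powr (F x) p \<partial>lborel)"
    if [measurable]: "F \<in> borel_measurable borel" for F
  proof -
    \<comment> \<open>Division by \<sigma> turns Lebesgue integrals of \<open>F\<close> into
      integrals of \<open>G\<close> against \<open>S\<close>; division by \<open>w\<close> in
      \<open>H\<close> likewise turns Lebesgue integrals of \<open>N powr (p - 1)\<close> into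
      integrals against \<open>W\<close>.\<close>
    define G where "G = (\<lambda>x. F x / \<sigma> x)"
    define N where "N = maximal S G"
    define H where "H = (\<lambda>x. ennreal_powr (N x) (p - 1) / w x)"
    have [measurable]: "G \<in> borel_measurable borel" "N \<in> borel_measurable borel" "H \<in> borel_measurable borel"
      unfolding G_def H_def N_def by measurable
    have avg: "ennreal_powr ((\<integral>\<^sup>+y\<in>ball c r. F y \<partial>lborel) / emeasure lborel (ball c r)) (p - 1)
        \<le> ennreal (K powr p) * maximal W H x" if r: "0 < r" "x \<in> ball c r" for c r x
    proof -
      let ?B = "emeasure lborel (ball c r)"
      let ?W = "emeasure W (ball c r)" and ?S = "emeasure S (ball c r)"
      define k where "k = (\<integral>\<^sup>+y\<in>ball c r. G y \<partial>S) / ?S"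
      have kN: "k \<le> N y" if "y \<in> ball c r" for y
        unfolding k_def N_def by (rule maximal_upper[OF that])
      have eqs: "?W = (\<integral>\<^sup>+x\<in>ball c r. w x \<partial>lborel)" "?S = (\<integral>\<^sup>+x\<in>ball c r. \<sigma> x \<partial>lborel)"
        unfolding W_def S_def by (simp_all add: emeasure_density)
      have nz': "?W \<noteq> 0" "?W \<noteq> top" "?S \<noteq> 0" "?S \<noteq> top"
        using W.ball_pos W.ball_finite S.ball_pos S.ball_finite r by auto
      have B: "?B \<noteq> 0" "?B \<noteq> top"
        using r by (auto simp add: emeasure_ball ennreal_eq_0_iff not_le unit_ball_vol_pos)
      have "(\<integral>\<^sup>+y\<in>ball c r. G y \<partial>S) = (\<integral>\<^sup>+y. \<sigma> y * (G y * indicator (ball c r) y) \<partial>lborel)"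
        unfolding S_def by (subst nn_integral_density) auto
      also have "\<dots> = (\<integral>\<^sup>+y\<in>ball c r. F y \<partial>lborel)"
        using dual
      proof (intro nn_integral_cong_AE, eventually_elim)
        fix x assume "ennreal_powr (w x) (1 / p) * ennreal_powr (\<sigma> x) (1 - 1 / p) = 1"
        then have "\<sigma> x / \<sigma> x = 1" using nz wfin by (intro ennreal_divide_self) (auto simp: less_top)
        then show "\<sigma> x * (G x * indicator (ball c r) x) = F x * indicator (ball c r) x"
          unfolding G_def by (metis ennreal_times_divide mult.assoc mult.commute mult.right_neutral)
      qed
      finally have F: "(\<integral>\<^sup>+y\<in>ball c r. F y \<partial>lborel) = k * ?S"
        unfolding k_def using nz' by (simp add: ennreal_divide_times ennreal_divide_self less_top[symmetric])
      have "ennreal_powr k (p - 1) * ?B = (\<integral>\<^sup>+y. ennreal_powr k (p - 1) * indicator (ball c r) y \<partial>lborel)"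
        by (simp add: nn_integral_cmult)
      also have "\<dots> \<le> (\<integral>\<^sup>+y. w y * (H y * indicator (ball c r) y) \<partial>lborel)"
        using dual
      proof (intro nn_integral_mono_AE, eventually_elim)
        fix x assume "ennreal_powr (w x) (1 / p) * ennreal_powr (\<sigma> x) (1 - 1 / p) = 1"
        then have "w x / w x = 1" using nz wfin by (intro ennreal_divide_self) (auto simp: less_top)
        then have "w x * (H x * indicator (ball c r) x) = ennreal_powr (N x) (p - 1) * indicator (ball c r) x"
          unfolding H_def by (metis ennreal_times_divide mult.assoc mult.commute mult.right_neutral)
        then show "ennreal_powr k (p - 1) * indicator (ball c r) x \<le> w x * (H x * indicator (ball c r) x)"
          using kN p by (auto simp: indicator_def intro!: ennreal_powr_mono)
      qed
      also have "\<dots> = (\<integral>\<^sup>+y\<in>ball c r. H y \<partial>W)"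
        unfolding W_def by (subst nn_integral_density) auto
      finally have low: "ennreal_powr k (p - 1) * ?B \<le> (\<integral>\<^sup>+y\<in>ball c r. H y \<partial>W)" .
      have "?W * ennreal_powr ?S (p - 1) = ennreal_powr (ennreal_powr ?W (1 / p) * ennreal_powr ?S (1 - 1 / p)) p"
        using p by (simp add: ennreal_powr_mult ennreal_powr_powr left_diff_distrib)
      also have "\<dots> \<le> ennreal_powr (ennreal K * ?B) p"
        using p Ap[OF r(1), of c] unfolding eqs by (intro ennreal_powr_mono) auto
      finally have up: "?W * ennreal_powr ?S (p - 1) \<le> ennreal (K powr p) * ennreal_powr ?B p"
        using K by (simp add: ennreal_powr_mult ennreal_powr_ennreal)
      let ?Z = "(k * ?S) / ?B"
      have Z: "k * ?S = ?Z * ?B" using B by (simp add: ennreal_divide_times ennreal_divide_self less_top[symmetric])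
      \<comment> \<open>Both sides are carried with the factor \<open>?W * ?B powr p\<close>, so
        that a single cancellation of a positive finite quantity at the end replaces all divisions.
        The Muckenhoupt condition \<open>up\<close> and the lower bound \<open>low\<close> each
        account for one factor on the right.\<close>
      have "(?W * ennreal_powr ?B p) * ennreal_powr ?Z (p - 1) = ?W * ennreal_powr (k * ?S) (p - 1) * ?B"
      proof -
        have "ennreal_powr (k * ?S) (p - 1) = ennreal_powr ?Z (p - 1) * ennreal_powr ?B (p - 1)"
          by (metis Z ennreal_powr_mult)
        moreover have "ennreal_powr ?B p = ennreal_powr ?B (p - 1) * ?B"
          using ennreal_powr_add[of ?B "p - 1" 1] by simp
        ultimately show ?thesis by (simp only: mult_ac)
      qed
      also have "\<dots> = (?W * ennreal_powr ?S (p - 1)) * (ennreal_powr k (p - 1) * ?B)"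
        by (simp add: ennreal_powr_mult mult_ac)
      also have "\<dots> \<le> (ennreal (K powr p) * ennreal_powr ?B p) * (\<integral>\<^sup>+y\<in>ball c r. H y \<partial>W)"
        by (intro mult_mono low up) auto
      also have "(\<integral>\<^sup>+y\<in>ball c r. H y \<partial>W) \<le> maximal W H x * ?W"
      proof -
        have "(\<integral>\<^sup>+y\<in>ball c r. H y \<partial>W) = (\<integral>\<^sup>+y\<in>ball c r. H y \<partial>W) / ?W * ?W"
          using nz' by (simp add: ennreal_divide_times ennreal_divide_self less_top[symmetric])
        also have "\<dots> \<le> maximal W H x * ?W"
          by (intro mult_right_mono maximal_upper r) auto
        finally show ?thesis .
      qed
      also have "(ennreal (K powr p) * ennreal_powr ?B p) * (maximal W H x * ?W)
        = (?W * ennreal_powr ?B p) * (ennreal (K powr p) * maximal W H x)"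
        by (simp add: mult_ac)
      finally have "(?W * ennreal_powr ?B p) * ennreal_powr ?Z (p - 1)
        \<le> (?W * ennreal_powr ?B p) * (ennreal (K powr p) * maximal W H x)"
        by (simp add: mult_left_mono)
      then show ?thesis
        unfolding F using nz' B by (subst (asm) ennreal_mult_le_mult_iff) (auto simp: ennreal_mult_eq_top_iff)
    qed
    have pt: "maximal lborel F x \<le> ennreal_powr (ennreal (K powr p) * maximal W H x) (1 / (p - 1))" for x
      unfolding maximal_def[of lborel F]
    proof (intro SUP_least, clarify)
      fix c r assume "0 < (r::real)" "x \<in> ball c r"
      from ennreal_powr_mono[OF _ avg[OF this], of "1 / (p - 1)"]
      show "(\<integral>\<^sup>+y\<in>ball c r. F y \<partial>lborel) / emeasure lborel (ball c r)
        \<le> ennreal_powr (ennreal (K powr p) * maximal W H x) (1 / (p - 1))"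
        using p by (simp add: ennreal_powr_powr)
    qed
    have "(\<integral>\<^sup>+x. w x * ennreal_powr (maximal lborel F x) p \<partial>lborel)
      = (\<integral>\<^sup>+x. ennreal_powr (maximal lborel F x) p \<partial>W)"
      unfolding W_def by (subst nn_integral_density) auto
    also have "\<dots> \<le> (\<integral>\<^sup>+x. ennreal (K powr (p * q)) * ennreal_powr (maximal W H x) q \<partial>W)"
    proof (intro nn_integral_mono)
      fix x
      have "ennreal_powr (maximal lborel F x) p
        \<le> ennreal_powr (ennreal_powr (ennreal (K powr p) * maximal W H x) (1 / (p - 1))) p"
        using p by (intro ennreal_powr_mono pt) auto
      also have "\<dots> = ennreal (K powr (p * q)) * ennreal_powr (maximal W H x) q"
        using p by (simp add: ennreal_powr_powr q_def ennreal_powr_mult ennreal_powr_ennreal powr_powr)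
      finally show "ennreal_powr (maximal lborel F x) p \<le> ennreal (K powr (p * q)) * ennreal_powr (maximal W H x) q" .
    qed
    also have "\<dots> = ennreal (K powr (p * q)) * (\<integral>\<^sup>+x. ennreal_powr (maximal W H x) q \<partial>W)"
      by (rule nn_integral_cmult) simp
    also have "\<dots> \<le> ennreal (K powr (p * q)) * (ennreal Cw * (\<integral>\<^sup>+x. ennreal_powr (H x) q \<partial>W))"
      unfolding Cw_def by (intro mult_left_mono W.strong_type q) auto
    also have "(\<integral>\<^sup>+x. ennreal_powr (H x) q \<partial>W) = (\<integral>\<^sup>+x. w x * ennreal_powr (H x) q \<partial>lborel)"
      unfolding W_def by (subst nn_integral_density) auto
    \<comment> \<open>\<open>H powr q\<close> is \<open>N powr p\<close> times
      \<open>w powr (- q)\<close>, and \<open>w powr (1 - q) = \<sigma>\<close>: the outer maximal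
      operator hands over exactly the norm on which the inner one is bounded.\<close>
    also have "\<dots> = (\<integral>\<^sup>+x. \<sigma> x * ennreal_powr (N x) p \<partial>lborel)"
      using dual
    proof (intro nn_integral_cong_AE, eventually_elim)
      fix x assume *: "ennreal_powr (w x) (1 / p) * ennreal_powr (\<sigma> x) (1 - 1 / p) = 1"
      obtain v where v: "w x = ennreal v" "0 < v"
        using wfin(1)[of x] nz[OF *] by (cases "w x") (auto simp: order.order_iff_strict)
      obtain u where u: "\<sigma> x = ennreal u" "0 < u"
        using wfin(2)[of x] nz[OF *] by (cases "\<sigma> x") (auto simp: order.order_iff_strict)
      have "v * u powr (p - 1) = 1"
        using wp[OF *] v u by (simp add: ennreal_powr_ennreal ennreal_mult[symmetric] flip: ennreal_1)
      then have "(v * u powr (p - 1)) powr (1 / (p - 1)) = 1" by simp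
      then have e: "v powr (1 / (p - 1)) * u = 1"
        using v u p by (simp add: powr_mult powr_powr)
      have qe: "1 - q = - (1 / (p - 1))" using p by (simp add: q_def field_simps)
      have "v / v powr q = v powr (1 - q)" using v by (simp add: powr_diff)
      also have "\<dots> = u" unfolding qe powr_minus using e
        by (metis inverse_unique)
      finally have vu: "v * inverse v powr q = u"
        using v by (simp add: powr_divide inverse_eq_divide)
      have "w x * ennreal_powr (H x) q = (ennreal v * ennreal (inverse v powr q)) * ennreal_powr (N x) p"
        using v p unfolding H_def divide_ennreal_def
        by (simp add: ennreal_powr_mult ennreal_powr_powr inverse_ennreal ennreal_powr_ennreal q_def mult_ac)
      also have "ennreal v * ennreal (inverse v powr q) = \<sigma> x"
        using v vu u by (simp add: ennreal_mult[symmetric])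
      finally show "w x * ennreal_powr (H x) q = \<sigma> x * ennreal_powr (N x) p" .
    qed
    also have "\<dots> = (\<integral>\<^sup>+x. ennreal_powr (maximal S G x) p \<partial>S)"
      unfolding N_def[symmetric] unfolding S_def by (rule nn_integral_density[symmetric]) auto
    also have "ennreal (K powr (p * q)) * (ennreal Cw * \<dots>)
       \<le> ennreal (K powr (p * q)) * (ennreal Cw * (ennreal Cs * (\<integral>\<^sup>+x. ennreal_powr (G x) p \<partial>S)))"
      unfolding Cs_def by (intro mult_left_mono S.strong_type p) auto
    also have "(\<integral>\<^sup>+x. ennreal_powr (G x) p \<partial>S) = (\<integral>\<^sup>+x. \<sigma> x * ennreal_powr (G x) p \<partial>lborel)"
      unfolding S_def by (subst nn_integral_density) auto
    \<comment> \<open>Here the identity is \<open>\<sigma> powr (1 - p) = w\<close>, so the initial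
      weighted norm of \<open>F\<close> returns.\<close>
    also have "\<dots> = (\<integral>\<^sup>+x. w x * ennreal_powr (F x) p \<partial>lborel)"
      using dual
    proof (intro nn_integral_cong_AE, eventually_elim)
      fix x assume *: "ennreal_powr (w x) (1 / p) * ennreal_powr (\<sigma> x) (1 - 1 / p) = 1"
      obtain v where v: "w x = ennreal v" "0 < v"
        using wfin(1)[of x] nz[OF *] by (cases "w x") (auto simp: order.order_iff_strict)
      obtain u where u: "\<sigma> x = ennreal u" "0 < u"
        using wfin(2)[of x] nz[OF *] by (cases "\<sigma> x") (auto simp: order.order_iff_strict)
      have "v * u powr (p - 1) = 1"
        using wp[OF *] v u by (simp add: ennreal_powr_ennreal ennreal_mult[symmetric] flip: ennreal_1)
      then have "v * (u powr (p - 1) * (u * inverse u powr p)) = u * inverse u powr p"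
        by (metis mult.assoc mult.left_neutral)
      moreover have "u powr (p - 1) * (u * inverse u powr p) = 1"
        using u by (simp add: powr_diff powr_divide inverse_eq_divide)
      ultimately have "u * inverse u powr p = v" by simp
      then have uv: "ennreal u * ennreal (inverse u powr p) = w x"
        using u v by (simp add: ennreal_mult[symmetric])
      have "\<sigma> x * ennreal_powr (G x) p = (ennreal u * ennreal (inverse u powr p)) * ennreal_powr (F x) p"
        using u unfolding G_def divide_ennreal_def
        by (simp add: ennreal_powr_mult inverse_ennreal ennreal_powr_ennreal mult_ac)
      then show "\<sigma> x * ennreal_powr (G x) p = w x * ennreal_powr (F x) p" unfolding uv .
    qed
    finally show ?thesis
      using Cpos by (simp add: ennreal_mult mult_ac)
  qed
  show ?thesis
    by (rule that[OF _ main]) (use Cpos in auto)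
qed

subsection \<open>Power weights\<close>

text \<open>For negative exponents the lower bound on \<open>x\<close> is the relevant one; the
  factor \<open>k powr \<bar>a\<bar>\<close> covers both signs.\<close>

lemma powr_le_of_comparable:
  fixes x X k a :: real
  assumes "0 < X" "1 \<le> k" "X / k \<le> x" "x \<le> k * X"
  shows "x powr a \<le> k powr \<bar>a\<bar> * X powr a"
proof (cases "0 \<le> a")
  case True
  have "0 \<le> x" using assms by (meson divide_nonneg_pos less_eq_real_def order_trans zero_less_one less_le_trans)
  then have "x powr a \<le> (k * X) powr a"
    using assms True by (intro powr_mono2) auto
  then show ?thesis using assms True by (simp add: powr_mult)
next
  case False
  have "0 < X / k" using assms by simp
  then have "x powr a \<le> (X / k) powr a"
    using assms False by (intro powr_mono2') auto
  also have "\<dots> = k powr \<bar>a\<bar> * X powr a"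
    using assms False by (simp add: powr_divide powr_minus_divide)
  finally show ?thesis .
qed

text \<open>Dyadic shells of radii \<open>R / 2 ^ k\<close>: on each the integrand is comparable to
  a constant, and the contributions are geometric with ratio \<open>z\<close>, which is below 1
  exactly because \<open>a\<close> exceeds minus the dimension.\<close>

lemma nn_integral_norm_powr_ball_0:
  assumes a: "- real DIM('a) < a"
  obtains C where "0 \<le> C"
    "\<And>R. 0 < R \<Longrightarrow> (\<integral>\<^sup>+x\<in>ball (0::'a::euclidean_space) R. ennreal (norm x powr a) \<partial>lborel)
       \<le> ennreal (C * R powr (real DIM('a) + a))"
proof -
  define v where "v = unit_ball_vol (real DIM('a))"
  have v: "0 \<le> v" by (simp add: v_def)
  have vol: "emeasure lborel (ball (0::'a) R) = ennreal (v * R powr real DIM('a))" if "0 < R" for R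
    using that by (simp add: emeasure_ball v_def powr_realpow)
  define z where "z = (1 / 2) powr (real DIM('a) + a)"
  have z: "0 \<le> z" "z < 1"
    unfolding z_def using a powr_less_mono2[of "real DIM('a) + a" "1 / 2" 1] by auto
  have term_le: "g k \<le> (\<Sum>k. g k)" for g :: "nat \<Rightarrow> ennreal" and k
    using sum_le_suminf[of g "{k}"] by simp
  define s where "s R k = R * (1 / 2) ^ k" for R :: real and k :: nat
  have pt: "norm x powr a \<le> 2 powr \<bar>a\<bar> * s R k powr a"
    if "s R (Suc k) \<le> norm x" "norm x \<le> s R k" "0 < R" for R k and x :: 'a
    using that by (intro powr_le_of_comparable) (auto simp: s_def)
  have main: "(\<integral>\<^sup>+x\<in>ball (0::'a) R. ennreal (norm x powr a) \<partial>lborel)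
       \<le> ennreal (v * 2 powr \<bar>a\<bar> / (1 - z) * R powr (real DIM('a) + a))" if R: "0 < R" for R
  proof -
    have sR: "0 < s R k" for k using R by (simp add: s_def)
    have "(\<integral>\<^sup>+x\<in>ball (0::'a) R. ennreal (norm x powr a) \<partial>lborel)
      \<le> (\<integral>\<^sup>+x. (\<Sum>k. ennreal (2 powr \<bar>a\<bar> * s R k powr a) * indicator (ball (0::'a) (s R k)) x) \<partial>lborel)"
    proof (intro nn_integral_mono)
      fix x :: 'a
      show "ennreal (norm x powr a) * indicator (ball 0 R) x
        \<le> (\<Sum>k. ennreal (2 powr \<bar>a\<bar> * s R k powr a) * indicator (ball (0::'a) (s R k)) x)" (is "_ \<le> (\<Sum>k. ?f k)")
      proof (cases "x \<noteq> 0 \<and> norm x < R")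
        \<comment> \<open>This case includes the origin, which lies in no shell but where
          \<open>0 powr a = 0\<close>.\<close>
        case False
        then show ?thesis by (auto simp: indicator_def)
      next
        case True
        then have "0 < norm x / R" using R by simp
        then obtain n where n: "(1 / 2) ^ n < norm x / R"
          using real_arch_pow_inv[of "norm x / R" "1 / 2"] by auto
        define k where "k = (LEAST n. s R (Suc n) \<le> norm x)"
        have "s R (Suc n) \<le> norm x"
        proof -
          have "s R n < norm x" using n R by (simp add: s_def field_simps)
          moreover have "s R (Suc n) \<le> s R n" using R by (simp add: s_def)
          ultimately show ?thesis by simp
        qed
        then have k: "s R (Suc k) \<le> norm x" unfolding k_def by (rule LeastI)
        have k2: "norm x < s R k"
        proof (cases k)
          case 0 then show ?thesis using True by (simp add: s_def)
        next
          case (Suc j)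
          then show ?thesis using not_less_Least[of j "\<lambda>n. s R (Suc n) \<le> norm x"] unfolding k_def[symmetric] by simp
        qed
        have "ennreal (norm x powr a) * indicator (ball 0 R) x \<le> ?f k"
          using True k2 pt[OF k _ R] by (auto simp: indicator_def intro!: ennreal_leI)
        also have "\<dots> \<le> (\<Sum>k. ?f k)"
          by (rule term_le[of ?f])
        finally show ?thesis .
      qed
    qed
    also have "\<dots> = (\<Sum>k. ennreal (2 powr \<bar>a\<bar> * s R k powr a) * emeasure lborel (ball (0::'a) (s R k)))"
    proof -
      have "(\<integral>\<^sup>+x. (\<Sum>k. ennreal (2 powr \<bar>a\<bar> * s R k powr a) * indicator (ball (0::'a) (s R k)) x) \<partial>lborel)
        = (\<Sum>k. \<integral>\<^sup>+x. ennreal (2 powr \<bar>a\<bar> * s R k powr a) * indicator (ball (0::'a) (s R k)) x \<partial>lborel)"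
        by (intro nn_integral_suminf borel_measurable_times_ennreal borel_measurable_const borel_measurable_indicator) simp
      moreover have "(\<integral>\<^sup>+x. ennreal (2 powr \<bar>a\<bar> * s R k powr a) * indicator (ball (0::'a) (s R k)) x \<partial>lborel)
        = ennreal (2 powr \<bar>a\<bar> * s R k powr a) * emeasure lborel (ball (0::'a) (s R k))" for k
        by (rule nn_integral_cmult_indicator) simp
      ultimately show ?thesis by (simp only:)
    qed
    also have "\<dots> = (\<Sum>k. ennreal (v * 2 powr \<bar>a\<bar> * R powr (real DIM('a) + a) * z ^ k))"
    proof (intro suminf_cong)
      fix k
      have "s R k powr a * s R k powr real DIM('a) = R powr (real DIM('a) + a) * z ^ k"
      proof -
        have "s R k powr a * s R k powr real DIM('a) = s R k powr (real DIM('a) + a)"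
          by (simp add: powr_add mult.commute)
        also have "\<dots> = R powr (real DIM('a) + a) * ((1 / 2) ^ k) powr (real DIM('a) + a)"
          unfolding s_def using R by (simp add: powr_mult)
        also have "((1 / 2 :: real) ^ k) powr (real DIM('a) + a) = z ^ k"
          unfolding z_def by (simp add: powr_realpow[symmetric] powr_powr mult.commute)
        finally show ?thesis .
      qed
      note e = this
      have "ennreal (2 powr \<bar>a\<bar> * s R k powr a) * emeasure lborel (ball (0::'a) (s R k))
        = ennreal ((2 powr \<bar>a\<bar> * v) * (s R k powr a * s R k powr real DIM('a)))"
        using v by (simp add: vol[OF sR] ennreal_mult[symmetric] mult_ac)
      also have "\<dots> = ennreal (v * 2 powr \<bar>a\<bar> * R powr (real DIM('a) + a) * z ^ k)"
        unfolding e by (simp only: mult_ac)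
      finally show "ennreal (2 powr \<bar>a\<bar> * s R k powr a) * emeasure lborel (ball (0::'a) (s R k))
        = ennreal (v * 2 powr \<bar>a\<bar> * R powr (real DIM('a) + a) * z ^ k)" .
    qed
    also have "\<dots> = ennreal (\<Sum>k. v * 2 powr \<bar>a\<bar> * R powr (real DIM('a) + a) * z ^ k)"
      using v z by (intro suminf_ennreal2 summable_mult summable_geometric) auto
    also have "(\<Sum>k. v * 2 powr \<bar>a\<bar> * R powr (real DIM('a) + a) * z ^ k)
      = v * 2 powr \<bar>a\<bar> / (1 - z) * R powr (real DIM('a) + a)"
      using z by (subst suminf_mult) (auto simp: suminf_geometric intro!: summable_geometric)
    finally show ?thesis .
  qed
  show ?thesis
    by (rule that[OF _ main]) (use v z in auto)
qed

text \<open>If \<open>R \<le> norm y / 2\<close>, the norm on the ball is comparable to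
  \<open>norm y + R\<close>. Otherwise the ball lies in the one of radius \<open>3 * R\<close> about
  the origin, and \<open>R\<close> itself is comparable to \<open>norm y + R\<close>. Volume times a
  typical value is therefore the right size in both cases.\<close>

lemma nn_integral_norm_powr_ball:
  assumes a: "- real DIM('a) < a"
  obtains C where "0 \<le> C"
    "\<And>y R. 0 < R \<Longrightarrow> (\<integral>\<^sup>+x\<in>ball (y::'a::euclidean_space) R. ennreal (norm x powr a) \<partial>lborel)
       \<le> ennreal (C * R ^ DIM('a) * (norm y + R) powr a)"
proof -
  obtain C where C: "0 \<le> C"
    "\<And>R. 0 < R \<Longrightarrow> (\<integral>\<^sup>+x\<in>ball (0::'a) R. ennreal (norm x powr a) \<partial>lborel)
       \<le> ennreal (C * R powr (real DIM('a) + a))"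
    using nn_integral_norm_powr_ball_0[OF a] by blast
  define v where "v = unit_ball_vol (real DIM('a))"
  have v: "0 \<le> v" by (simp add: v_def)
  let ?C = "3 powr \<bar>a\<bar> * v + C * 3 powr (real DIM('a) + a) * 3 powr \<bar>a\<bar>"
  have "(\<integral>\<^sup>+x\<in>ball y R. ennreal (norm x powr a) \<partial>lborel)
       \<le> ennreal (?C * R ^ DIM('a) * (norm y + R) powr a)" if R: "0 < R" for y :: 'a and R
  proof -
    have X: "0 < norm y + R" using R by (simp add: add_nonneg_pos)
    show ?thesis
    proof (cases "R \<le> norm y / 2")
      case True
      have "(\<integral>\<^sup>+x\<in>ball y R. ennreal (norm x powr a) \<partial>lborel)
        \<le> (\<integral>\<^sup>+x\<in>ball y R. ennreal (3 powr \<bar>a\<bar> * (norm y + R) powr a) \<partial>lborel)"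
      proof (intro nn_integral_mono)
        fix x
        have "norm x powr a \<le> 3 powr \<bar>a\<bar> * (norm y + R) powr a" if "x \<in> ball y R"
        proof (intro powr_le_of_comparable)
          have d: "norm (y - x) < R" using that by (simp add: dist_norm)
          have "norm y \<le> norm (y - x) + norm x" "norm x \<le> norm (y - x) + norm y"
            by (metis diff_add_cancel norm_triangle_ineq, metis add.commute norm_minus_commute norm_triangle_sub)
          then show "(norm y + R) / 3 \<le> norm x" "norm x \<le> 3 * (norm y + R)"
            using d True R by auto
        qed (use X in auto)
        then show "ennreal (norm x powr a) * indicator (ball y R) x
          \<le> ennreal (3 powr \<bar>a\<bar> * (norm y + R) powr a) * indicator (ball y R) x"
          by (auto simp: indicator_def intro: ennreal_leI)
      qed
      also have "\<dots> = ennreal (3 powr \<bar>a\<bar> * (norm y + R) powr a * (v * R ^ DIM('a)))"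
        using R v by (subst nn_integral_cmult_indicator) (auto simp: emeasure_ball ennreal_mult v_def)
      also have "\<dots> \<le> ennreal (?C * R ^ DIM('a) * (norm y + R) powr a)"
        using R v C by (intro ennreal_leI) (simp add: ring_distribs mult_ac)
      finally show ?thesis .
    next
      case False
      have "(\<integral>\<^sup>+x\<in>ball y R. ennreal (norm x powr a) \<partial>lborel)
        \<le> (\<integral>\<^sup>+x\<in>ball (0::'a) (3 * R). ennreal (norm x powr a) \<partial>lborel)"
      proof (intro nn_integral_mono mult_left_mono)
        fix x
        have "norm x < 3 * R" if "norm (y - x) < R"
          using that False norm_triangle_sub[of x y] by (simp add: norm_minus_commute)
        then show "indicator (ball y R) x \<le> (indicator (ball 0 (3 * R)) x :: ennreal)"
          by (auto simp: indicator_def dist_norm)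
      qed auto
      also have "\<dots> \<le> ennreal (C * (3 * R) powr (real DIM('a) + a))"
        using R by (intro C) auto
      also have "\<dots> \<le> ennreal (?C * R ^ DIM('a) * (norm y + R) powr a)"
      proof (intro ennreal_leI)
        have "R powr a \<le> 3 powr \<bar>a\<bar> * (norm y + R) powr a"
          using False R X by (intro powr_le_of_comparable) auto
        then have "C * 3 powr (real DIM('a) + a) * R ^ DIM('a) * R powr a
          \<le> C * 3 powr (real DIM('a) + a) * R ^ DIM('a) * (3 powr \<bar>a\<bar> * (norm y + R) powr a)"
          using C R by (intro mult_left_mono) auto
        also have "C * 3 powr (real DIM('a) + a) * R ^ DIM('a) * R powr a = C * (3 * R) powr (real DIM('a) + a)"
          using R by (simp add: powr_mult powr_add powr_realpow)
        finally show "C * (3 * R) powr (real DIM('a) + a) \<le> ?C * R ^ DIM('a) * (norm y + R) powr a"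
          using v R by (simp add: ring_distribs mult_ac add_increasing)
      qed
      finally show ?thesis .
    qed
  qed
  then show ?thesis
    by (intro that[of ?C]) (use v C in auto)
qed

lemma nn_integral_product_powr_ball:
  assumes a: "- real CARD('m::finite) < a" and c: "- 1 < c"
  obtains C where "0 \<le> C"
    "\<And>y t R. 0 < R \<Longrightarrow> (\<integral>\<^sup>+x\<in>ball (y :: real ^ 'm, t :: real) R. ennreal (norm (fst x) powr a * \<bar>snd x\<bar> powr c) \<partial>lborel)
       \<le> ennreal (C * R ^ (CARD('m) + 1) * (norm y + R) powr a * (\<bar>t\<bar> + R) powr c)"
proof -
  obtain C1 where C1: "0 \<le> C1"
    "\<And>y R. 0 < R \<Longrightarrow> (\<integral>\<^sup>+x\<in>ball (y :: real ^ 'm) R. ennreal (norm x powr a) \<partial>lborel)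
       \<le> ennreal (C1 * R ^ CARD('m) * (norm y + R) powr a)"
    using nn_integral_norm_powr_ball[where 'a = "real ^ 'm", of a] a by auto
  obtain C2 where C2: "0 \<le> C2"
    "\<And>y R. 0 < R \<Longrightarrow> (\<integral>\<^sup>+x\<in>ball (y :: real) R. ennreal (\<bar>x\<bar> powr c) \<partial>lborel)
       \<le> ennreal (C2 * R * (\<bar>y\<bar> + R) powr c)"
    using nn_integral_norm_powr_ball[where 'a = "real", of c] c by auto
  have "(\<integral>\<^sup>+x\<in>ball (y :: real ^ 'm, t :: real) R. ennreal (norm (fst x) powr a * \<bar>snd x\<bar> powr c) \<partial>lborel)
       \<le> ennreal (C1 * C2 * R ^ (CARD('m) + 1) * (norm y + R) powr a * (\<bar>t\<bar> + R) powr c)" if R: "0 < R" for y t R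
  proof -
    have [measurable]: "ball y R \<in> sets borel" "ball t R \<in> sets borel" by auto
    have "(\<integral>\<^sup>+x\<in>ball (y, t) R. ennreal (norm (fst x) powr a * \<bar>snd x\<bar> powr c) \<partial>lborel)
      \<le> (\<integral>\<^sup>+x. (ennreal (norm (fst x) powr a) * indicator (ball y R) (fst x)) * (ennreal (\<bar>snd x\<bar> powr c) * indicator (ball t R) (snd x)) \<partial>(lborel \<Otimes>\<^sub>M lborel))"
      unfolding lborel_prod
    proof (intro nn_integral_mono)
      fix x :: "(real ^ 'm) \<times> real"
      have "fst x \<in> ball y R \<and> snd x \<in> ball t R" if "x \<in> ball (y, t) R"
        using that dist_fst_le[of "(y, t)" x] dist_snd_le[of "(y, t)" x] by auto
      then show "ennreal (norm (fst x) powr a * \<bar>snd x\<bar> powr c) * indicator (ball (y, t) R) x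
        \<le> (ennreal (norm (fst x) powr a) * indicator (ball y R) (fst x)) * (ennreal (\<bar>snd x\<bar> powr c) * indicator (ball t R) (snd x))"
        by (auto simp: indicator_def ennreal_mult)
    qed
    also have "\<dots> = (\<integral>\<^sup>+x. (\<integral>\<^sup>+z. (ennreal (norm x powr a) * indicator (ball y R) x) * (ennreal (\<bar>z\<bar> powr c) * indicator (ball t R) z) \<partial>lborel) \<partial>lborel)"
      by (subst lborel.nn_integral_fst[symmetric]) auto
    also have "\<dots> = (\<integral>\<^sup>+x\<in>ball y R. ennreal (norm x powr a) \<partial>lborel) * (\<integral>\<^sup>+z\<in>ball t R. ennreal (\<bar>z\<bar> powr c) \<partial>lborel)"
      by (simp add: nn_integral_cmult nn_integral_multc)
    also have "\<dots> \<le> ennreal (C1 * R ^ CARD('m) * (norm y + R) powr a) * ennreal (C2 * R * (\<bar>t\<bar> + R) powr c)"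
      by (intro mult_mono C1 C2 R) auto
    also have "\<dots> = ennreal (C1 * C2 * R ^ (CARD('m) + 1) * (norm y + R) powr a * (\<bar>t\<bar> + R) powr c)"
      using C1 C2 R by (subst ennreal_mult[symmetric]) (auto simp: mult_ac)
    finally show ?thesis .
  qed
  then show ?thesis
    by (intro that[of "C1 * C2"]) (use C1 C2 in auto)
qed

text \<open>Away from the origin, or for \<open>b \<ge> 0\<close>, the middle factor is at most a
  multiple of its typical value and the product estimate applies. Near the origin with
  \<open>b < 0\<close> the singular factor is distributed over the two others, using that
  \<open>norm x\<close> dominates both \<open>norm (fst x)\<close> and
  \<open>\<bar>snd x\<bar>\<close>.\<close>

lemma nn_integral_weight_ball:
  assumes a: "- real CARD('m::finite) < a" and c: "- 1 < c" and abc: "- (real CARD('m) + 1) < a + b + c"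
  obtains C where "0 \<le> C"
    "\<And>y t R. 0 < R \<Longrightarrow> (\<integral>\<^sup>+x\<in>ball (y :: real ^ 'm, t :: real) R. ennreal (weight (a, b, c) x) \<partial>lborel)
       \<le> ennreal (C * R ^ (CARD('m) + 1) * (norm y + R) powr a * (norm (y, t) + R) powr b * (\<bar>t\<bar> + R) powr c)"
proof -
  \<comment> \<open>For \<open>b < 0\<close> the parts \<open>u\<close> and \<open>v\<close> of
    \<open>- b\<close> must be nonnegative and satisfy \<open>u < a + real CARD('m)\<close> and
    \<open>v < c + 1\<close>. The choice of \<open>u\<close> is the midpoint of the admissible
    interval, which is nonempty by the condition on \<open>a + b + c\<close>.\<close>
  define u where "u = (if b \<ge> 0 then 0 else (max 0 (- b - c - 1) + min (- b) (a + real CARD('m))) / 2)"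
  define v where "v = (if b \<ge> 0 then 0 else - b - u)"
  have uv: "0 \<le> u" "0 \<le> v" "- real CARD('m) < a - u" "- 1 < c - v"
    and uvb: "b < 0 \<Longrightarrow> u + v = - b"
    unfolding u_def v_def using a c abc by (auto simp: max_def min_def field_simps)
  obtain C1 where C1: "0 \<le> C1"
    "\<And>y t R. 0 < R \<Longrightarrow> (\<integral>\<^sup>+x\<in>ball (y :: real ^ 'm, t :: real) R. ennreal (norm (fst x) powr a * \<bar>snd x\<bar> powr c) \<partial>lborel)
       \<le> ennreal (C1 * R ^ (CARD('m) + 1) * (norm y + R) powr a * (\<bar>t\<bar> + R) powr c)"
    using nn_integral_product_powr_ball[OF a c] by blast
  obtain C2 where C2: "0 \<le> C2"
    "\<And>y t R. 0 < R \<Longrightarrow> (\<integral>\<^sup>+x\<in>ball (y :: real ^ 'm, t :: real) R. ennreal (norm (fst x) powr (a - u) * \<bar>snd x\<bar> powr (c - v)) \<partial>lborel)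
       \<le> ennreal (C2 * R ^ (CARD('m) + 1) * (norm y + R) powr (a - u) * (\<bar>t\<bar> + R) powr (c - v))"
    using nn_integral_product_powr_ball[OF uv(3,4)] by blast
  let ?C = "3 powr \<bar>b\<bar> * C1 + 3 powr \<bar>b\<bar> * 3 powr \<bar>b\<bar> * C1 + 3 powr \<bar>b\<bar> * C2"
  have "(\<integral>\<^sup>+x\<in>ball (y, t) R. ennreal (weight (a, b, c) x) \<partial>lborel)
       \<le> ennreal (?C * R ^ (CARD('m) + 1) * (norm y + R) powr a * (norm (y, t) + R) powr b * (\<bar>t\<bar> + R) powr c)"
    if R: "0 < R" for y :: "real ^ 'm" and t R
  proof -
    have [measurable]: "fst \<in> borel_measurable (borel :: ((real ^ 'm) \<times> real) measure)"
      "snd \<in> borel_measurable (borel :: ((real ^ 'm) \<times> real) measure)" "ball (y, t) R \<in> sets borel"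
      by (auto intro!: borel_measurable_continuous_onI continuous_intros)
    let ?X = "norm (y, t) + R"
    have X: "0 < ?X" using R by (simp add: add_nonneg_pos)
    have w: "weight (a, b, c) x = norm x powr b * (norm (fst x) powr a * \<bar>snd x\<bar> powr c)" for x :: "(real ^ 'm) \<times> real"
      by (simp add: weight_def mult_ac)
    have tri: "norm (y, t) - R < norm x" "norm x < norm (y, t) + R" if "x \<in> ball (y, t) R" for x
    proof -
      have d: "norm ((y, t) - x) < R" using that by (simp add: dist_norm)
      show "norm (y, t) - R < norm x" using d norm_triangle_sub[of "(y, t)" x] by simp
      show "norm x < norm (y, t) + R" using d norm_triangle_sub[of x "(y, t)"] by (simp add: norm_minus_commute)
    qed
    have bound: "(\<integral>\<^sup>+x\<in>ball (y, t) R. ennreal (weight (a, b, c) x) \<partial>lborel)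
       \<le> ennreal (k * C1 * R ^ (CARD('m) + 1) * (norm y + R) powr a * (?X powr b) * (\<bar>t\<bar> + R) powr c)"
      if k: "0 \<le> k" "\<And>x. x \<in> ball (y, t) R \<Longrightarrow> norm x powr b \<le> k * ?X powr b" for k
    proof -
      have "(\<integral>\<^sup>+x\<in>ball (y, t) R. ennreal (weight (a, b, c) x) \<partial>lborel)
        \<le> (\<integral>\<^sup>+x. ennreal (k * ?X powr b) * (ennreal (norm (fst x) powr a * \<bar>snd x\<bar> powr c) * indicator (ball (y, t) R) x) \<partial>lborel)"
      proof (intro nn_integral_mono)
        fix x
        have "weight (a, b, c) x \<le> (k * ?X powr b) * (norm (fst x) powr a * \<bar>snd x\<bar> powr c)" if "x \<in> ball (y, t) R"
          unfolding w using k(2)[OF that] by (intro mult_right_mono) auto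
        then show "ennreal (weight (a, b, c) x) * indicator (ball (y, t) R) x
          \<le> ennreal (k * ?X powr b) * (ennreal (norm (fst x) powr a * \<bar>snd x\<bar> powr c) * indicator (ball (y, t) R) x)"
          using k(1) by (auto simp: indicator_def ennreal_mult[symmetric] intro!: ennreal_leI)
      qed
      also have "\<dots> = ennreal (k * ?X powr b) * (\<integral>\<^sup>+x\<in>ball (y, t) R. ennreal (norm (fst x) powr a * \<bar>snd x\<bar> powr c) \<partial>lborel)"
        by (rule nn_integral_cmult) auto
      also have "\<dots> \<le> ennreal (k * ?X powr b) * ennreal (C1 * R ^ (CARD('m) + 1) * (norm y + R) powr a * (\<bar>t\<bar> + R) powr c)"
        by (intro mult_left_mono C1 R) auto
      also have "\<dots> = ennreal (k * C1 * R ^ (CARD('m) + 1) * (norm y + R) powr a * (?X powr b) * (\<bar>t\<bar> + R) powr c)"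
        using k(1) C1 R by (subst ennreal_mult[symmetric]) (auto simp: mult_ac)
      finally show ?thesis .
    qed
    let ?E = "R ^ (CARD('m) + 1) * (norm y + R) powr a * ?X powr b * (\<bar>t\<bar> + R) powr c"
    have E: "0 \<le> ?E" using R by auto
    consider "R \<le> norm (y, t) / 2" | "norm (y, t) / 2 < R" "0 \<le> b" | "norm (y, t) / 2 < R" "b < 0"
      by linarith
    then obtain k where k: "0 \<le> k" "k \<le> ?C"
      "(\<integral>\<^sup>+x\<in>ball (y, t) R. ennreal (weight (a, b, c) x) \<partial>lborel) \<le> ennreal (k * ?E)"
    proof cases
      case 1
      have "norm x powr b \<le> 3 powr \<bar>b\<bar> * ?X powr b" if "x \<in> ball (y, t) R" for x
        using tri[OF that] 1 R X by (intro powr_le_of_comparable) auto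
      from bound[OF _ this] show ?thesis
        using C1 C2 by (intro that[of "3 powr \<bar>b\<bar> * C1"]) (auto simp: mult_ac)
    next
      case 2
      have "norm x powr b \<le> 3 powr \<bar>b\<bar> * ?X powr b" if "x \<in> ball (y, t) R" for x
      proof -
        have "norm x powr b \<le> ?X powr b" using tri[OF that] 2 by (intro powr_mono2) auto
        also have "\<dots> \<le> 3 powr \<bar>b\<bar> * ?X powr b"
          using ge_one_powr_ge_zero[of 3 "\<bar>b\<bar>"] mult_right_mono[of 1 "3 powr \<bar>b\<bar>" "?X powr b"] by simp
        finally show ?thesis .
      qed
      from bound[OF _ this] show ?thesis
        using C1 C2 by (intro that[of "3 powr \<bar>b\<bar> * C1"]) (auto simp: mult_ac)
    next
      case 3
      have pt: "weight (a, b, c) x \<le> norm (fst x) powr (a - u) * \<bar>snd x\<bar> powr (c - v)" for x :: "(real ^ 'm) \<times> real"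
      proof (cases "fst x = 0 \<or> snd x = 0")
        case False
        have n: "norm (fst x) \<le> norm x" "\<bar>snd x\<bar> \<le> norm x"
          using norm_fst_le[of "fst x" "snd x"] norm_snd_le[of "snd x" "fst x"] by auto
        have "norm x powr b = norm x powr (- u) * norm x powr (- v)"
        proof -
          have "b = - u + - v" using uvb[OF 3(2)] by simp
          then show ?thesis by (simp only: powr_add)
        qed
        also have "\<dots> \<le> norm (fst x) powr (- u) * \<bar>snd x\<bar> powr (- v)"
          using False n uv by (intro mult_mono powr_mono2') auto
        finally have "norm x powr b * (norm (fst x) powr a * \<bar>snd x\<bar> powr c)
          \<le> norm (fst x) powr (- u) * \<bar>snd x\<bar> powr (- v) * (norm (fst x) powr a * \<bar>snd x\<bar> powr c)"
          by (rule mult_right_mono) auto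
        then show ?thesis unfolding w by (simp add: powr_diff powr_minus field_simps)
      qed (auto simp: w)
      have "(\<integral>\<^sup>+x\<in>ball (y, t) R. ennreal (weight (a, b, c) x) \<partial>lborel)
        \<le> (\<integral>\<^sup>+x\<in>ball (y, t) R. ennreal (norm (fst x) powr (a - u) * \<bar>snd x\<bar> powr (c - v)) \<partial>lborel)"
        by (intro nn_integral_mono mult_right_mono ennreal_leI pt) auto
      also have "\<dots> \<le> ennreal (C2 * R ^ (CARD('m) + 1) * (norm y + R) powr (a - u) * (\<bar>t\<bar> + R) powr (c - v))"
        by (intro C2 R)
      also have "\<dots> \<le> ennreal (3 powr \<bar>b\<bar> * C2 * ?E)"
      proof (intro ennreal_leI)
        \<comment> \<open>The two factors moved by the splitting are recombined into
          \<open>?X powr b\<close>; this works because \<open>?X < 3 * R\<close> when the ball is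
          near the origin.\<close>
        have "(norm y + R) powr (- u) * (\<bar>t\<bar> + R) powr (- v) \<le> R powr (- u) * R powr (- v)"
          using R uv by (intro mult_mono powr_mono2') auto
        also have "\<dots> = R powr b"
        proof -
          have "b = - u + - v" using uvb[OF 3(2)] by simp
          then show ?thesis by (simp only: powr_add)
        qed
        also have "\<dots> \<le> 3 powr \<bar>b\<bar> * ?X powr b"
          using 3 R X by (intro powr_le_of_comparable) auto
        finally have "(norm y + R) powr (- u) * (\<bar>t\<bar> + R) powr (- v) \<le> 3 powr \<bar>b\<bar> * ?X powr b" .
        then have "(C2 * R ^ (CARD('m) + 1) * (norm y + R) powr a * (\<bar>t\<bar> + R) powr c) * ((norm y + R) powr (- u) * (\<bar>t\<bar> + R) powr (- v))
          \<le> (C2 * R ^ (CARD('m) + 1) * (norm y + R) powr a * (\<bar>t\<bar> + R) powr c) * (3 powr \<bar>b\<bar> * ?X powr b)"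
          using C2 R by (intro mult_left_mono) auto
        then show "C2 * R ^ (CARD('m) + 1) * (norm y + R) powr (a - u) * (\<bar>t\<bar> + R) powr (c - v) \<le> 3 powr \<bar>b\<bar> * C2 * ?E"
          by (simp add: powr_diff powr_minus divide_inverse mult_ac)
      qed
      finally show ?thesis
        using C1 C2 by (intro that[of "3 powr \<bar>b\<bar> * C2"]) auto
    qed
    have "k * ?E \<le> ?C * ?E" using k(2) E by (intro mult_right_mono) auto
    then have "ennreal (k * ?E) \<le> ennreal (?C * ?E)" by (rule ennreal_leI)
    with k(3) show ?thesis by (simp only: mult.assoc)
  qed
  then show ?thesis
    by (intro that[of ?C]) (use C1 C2 in auto)
qed

text \<open>On the excluded null set \<open>weight\<close> is 0 whatever the exponents, so a weight
  and its dual are reciprocal in the required sense only off it.\<close>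

lemma AE_weight_coordinates:
  "AE x in (lborel :: ((real ^ 'm) \<times> real) measure). fst x \<noteq> 0 \<and> snd x \<noteq> 0"
proof -
  have "emeasure (lborel \<Otimes>\<^sub>M lborel) ({0 :: real ^ 'm} \<times> (UNIV :: real set)) = 0"
    by (subst lborel.emeasure_pair_measure_Times) auto
  moreover have "emeasure (lborel \<Otimes>\<^sub>M lborel) ((UNIV :: (real ^ 'm) set) \<times> {0 :: real}) = 0"
    by (subst lborel.emeasure_pair_measure_Times) auto
  ultimately have "{0 :: real ^ 'm} \<times> (UNIV :: real set) \<in> null_sets lborel"
    "(UNIV :: (real ^ 'm) set) \<times> {0 :: real} \<in> null_sets lborel"
    unfolding lborel_prod null_sets_def by (auto intro!: borel_closed closed_Times)
  then have "{0 :: real ^ 'm} \<times> (UNIV :: real set) \<union> (UNIV :: (real ^ 'm) set) \<times> {0 :: real} \<in> null_sets lborel"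
    by (rule null_sets.Un)
  then show ?thesis by (rule AE_I') (auto simp: mem_Times_iff)
qed

lemma weight_nonneg: "0 \<le> weight w x"
  by (cases w) (simp add: weight_def)

lemma borel_measurable_weight [measurable]:
  "weight w \<in> borel_measurable (borel :: ((real ^ 'm) \<times> real) measure)"
proof -
  have [measurable]: "fst \<in> borel_measurable (borel :: ((real ^ 'm) \<times> real) measure)"
    "snd \<in> borel_measurable (borel :: ((real ^ 'm) \<times> real) measure)"
    by (intro borel_measurable_continuous_onI continuous_intros)+
  obtain a b c where "w = (a, b, c)" by (cases w)
  then show ?thesis unfolding weight_def by simp
qed

text \<open>For a nonnegative middle exponent the condition on the sum follows from the other two,
  so the distinction by its sign disappears. For the other pair of regions the same happens when the
  middle exponent is nonpositive.\<close>

lemma region_AB_iff: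
  "(a, b, c) \<in> region_A n \<union> region_B n \<longleftrightarrow> - (real n - 1) < a \<and> -1 < c \<and> - real n < a + b + c"
  by (auto simp: region_A_def region_B_def)

lemma region_CD_iff:
  assumes "1 < p"
  shows "(a, b, c) \<in> region_C n p \<union> region_D n p \<longleftrightarrow>
    a < (real n - 1) * (p - 1) \<and> c < p - 1 \<and> a + b + c < real n * (p - 1)"
  using assms by (auto simp: region_C_def region_D_def left_diff_distrib)

text \<open>The dual of a power weight is again a power weight. The first pair of regions makes the
  weight locally integrable, the second its dual, and the two ball estimates multiply to the
  Muckenhoupt condition because all distance factors cancel.\<close>

lemma maximal_power_weight_bound:
  fixes a b c p :: real
  assumes p: "1 < p"
    and reg: "p *\<^sub>R (a, b, c) \<in> (region_A (CARD('m::finite) + 1) \<union> region_B (CARD('m) + 1)) \<inter>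
      (region_C (CARD('m) + 1) p \<union> region_D (CARD('m) + 1) p)"
  obtains C where "0 \<le> C"
    "\<And>F. F \<in> borel_measurable (borel :: ((real ^ 'm) \<times> real) measure) \<Longrightarrow>
      (\<integral>\<^sup>+x. ennreal_powr (ennreal (weight (a, b, c) x) * maximal lborel F x) p \<partial>lborel)
      \<le> ennreal C * (\<integral>\<^sup>+x. ennreal_powr (ennreal (weight (a, b, c) x) * F x) p \<partial>lborel)"
proof -
  define w where "w = (\<lambda>x :: (real ^ 'm) \<times> real. ennreal (weight (p * a, p * b, p * c) x))"
  \<comment> \<open>Multiplying the exponents by \<open>e\<close> gives the dual weight. Dividing
    the upper bounds of the regions \<open>C\<close> and \<open>D\<close> by \<open>p - 1\<close>
    and changing signs yields the lower bounds needed to integrate it.\<close>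
  define e where "e = - p / (p - 1)"
  define \<sigma> where "\<sigma> = (\<lambda>x :: (real ^ 'm) \<times> real. ennreal (weight (e * a, e * b, e * c) x))"
  have AB: "- real CARD('m) < p * a" "-1 < p * c" "- (real CARD('m) + 1) < p * a + p * b + p * c"
    using reg region_AB_iff[of "p * a" "p * b" "p * c" "CARD('m) + 1"] by auto
  have CD: "p * a < real CARD('m) * (p - 1)" "p * c < p - 1" "p * a + p * b + p * c < (real CARD('m) + 1) * (p - 1)"
    using reg region_CD_iff[OF p, of "p * a" "p * b" "p * c" "CARD('m) + 1"] by (auto simp: add.commute)
  have CD': "- real CARD('m) < e * a" "-1 < e * c" "- (real CARD('m) + 1) < e * a + e * b + e * c"
  proof -
    have e: "e * d = - (p * d / (p - 1))" for d by (simp add: e_def)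
    have e3: "e * a + e * b + e * c = - ((p * a + p * b + p * c) / (p - 1))"
      unfolding e by (simp add: add_divide_distrib)
    have "(p * a + p * b + p * c) / (p - 1) < real CARD('m) + 1"
      using CD p by (simp only: pos_divide_less_eq)
    then show "- (real CARD('m) + 1) < e * a + e * b + e * c"
      unfolding e3 by linarith
    show "- real CARD('m) < e * a" "-1 < e * c"
      unfolding e using CD p by (simp_all add: pos_divide_less_eq)
  qed
  obtain C1 where C1: "0 \<le> C1"
    "\<And>y t R. 0 < R \<Longrightarrow> (\<integral>\<^sup>+x\<in>ball (y :: real ^ 'm, t :: real) R. w x \<partial>lborel)
       \<le> ennreal (C1 * R ^ (CARD('m) + 1) * (norm y + R) powr (p * a) * (norm (y, t) + R) powr (p * b) * (\<bar>t\<bar> + R) powr (p * c))"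
    using nn_integral_weight_ball[OF AB] unfolding w_def by blast
  obtain C2 where C2: "0 \<le> C2"
    "\<And>y t R. 0 < R \<Longrightarrow> (\<integral>\<^sup>+x\<in>ball (y :: real ^ 'm, t :: real) R. \<sigma> x \<partial>lborel)
       \<le> ennreal (C2 * R ^ (CARD('m) + 1) * (norm y + R) powr (e * a) * (norm (y, t) + R) powr (e * b) * (\<bar>t\<bar> + R) powr (e * c))"
    using nn_integral_weight_ball[OF CD'] unfolding \<sigma>_def by blast
  define v where "v = unit_ball_vol (real (CARD('m) + 1))"
  have v: "0 < v" by (simp add: v_def)
  define K where "K = C1 powr (1 / p) * C2 powr (1 - 1 / p) / v"
  \<comment> \<open>The exponents are \<open>d\<close> and \<open>- d\<close>. Used for the distance
    factors in the ball estimates as well as for the pointwise duality.\<close>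
  have cancel: "z powr (p * d * (1 / p)) * z powr (e * d * (1 - 1 / p)) = 1" if "0 < z" for z d :: real
    using that p by (simp add: powr_add[symmetric] e_def field_simps)
  have Ap: "ennreal_powr (\<integral>\<^sup>+x\<in>ball z R. w x \<partial>lborel) (1 / p)
        * ennreal_powr (\<integral>\<^sup>+x\<in>ball z R. \<sigma> x \<partial>lborel) (1 - 1 / p) \<le> ennreal K * emeasure lborel (ball z R)"
    if R: "0 < R" for z R
  proof -
    obtain y t where z: "z = (y, t)" by (cases z)
    let ?X = "norm y + R" and ?Y = "norm (y, t) + R" and ?T = "\<bar>t\<bar> + R"
    have pos: "0 < ?X" "0 < ?Y" "0 < ?T" using R by (simp_all add: add_nonneg_pos)
    let ?n = "CARD('m) + 1"
    have "ennreal_powr (\<integral>\<^sup>+x\<in>ball z R. w x \<partial>lborel) (1 / p) * ennreal_powr (\<integral>\<^sup>+x\<in>ball z R. \<sigma> x \<partial>lborel) (1 - 1 / p)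
      \<le> ennreal_powr (ennreal (C1 * R ^ ?n * ?X powr (p * a) * ?Y powr (p * b) * ?T powr (p * c))) (1 / p)
        * ennreal_powr (ennreal (C2 * R ^ ?n * ?X powr (e * a) * ?Y powr (e * b) * ?T powr (e * c))) (1 - 1 / p)"
      unfolding z using p by (intro mult_mono ennreal_powr_mono C1 C2 R) auto
    also have "\<dots> = ennreal ((C1 * R ^ ?n * ?X powr (p * a) * ?Y powr (p * b) * ?T powr (p * c)) powr (1 / p)
        * (C2 * R ^ ?n * ?X powr (e * a) * ?Y powr (e * b) * ?T powr (e * c)) powr (1 - 1 / p))"
      using C1(1) C2(1) R by (subst (1 2) ennreal_powr_ennreal) (auto simp: ennreal_mult)
    also have "(C1 * R ^ ?n * ?X powr (p * a) * ?Y powr (p * b) * ?T powr (p * c)) powr (1 / p)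
        * (C2 * R ^ ?n * ?X powr (e * a) * ?Y powr (e * b) * ?T powr (e * c)) powr (1 - 1 / p)
      = (C1 powr (1 / p) * C2 powr (1 - 1 / p)) * ((R ^ ?n) powr (1 / p) * (R ^ ?n) powr (1 - 1 / p))
       * (?X powr (p * a * (1 / p)) * ?X powr (e * a * (1 - 1 / p)))
       * (?Y powr (p * b * (1 / p)) * ?Y powr (e * b * (1 - 1 / p)))
       * (?T powr (p * c * (1 / p)) * ?T powr (e * c * (1 - 1 / p)))"
      using C1(1) C2(1) R pos by (simp only: powr_mult powr_powr mult_ac)
    also have "\<dots> = K * (v * R ^ ?n)"
    proof -
      have "(R ^ ?n) powr (1 / p) * (R ^ ?n) powr (1 - 1 / p) = R ^ ?n"
        using R by (simp flip: powr_add)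
      then show ?thesis
        unfolding cancel[OF pos(1)] cancel[OF pos(2)] cancel[OF pos(3)] K_def using v by simp
    qed
    also have "ennreal \<dots> = ennreal K * emeasure lborel (ball z R)"
      using R v C1(1) C2(1) by (subst ennreal_mult) (auto simp: emeasure_ball v_def K_def add.commute)
    finally show ?thesis .
  qed
  have "(\<integral>\<^sup>+x\<in>ball z R. w x \<partial>lborel) \<noteq> top \<and> (\<integral>\<^sup>+x\<in>ball z R. \<sigma> x \<partial>lborel) \<noteq> top" for z R
  proof (cases "0 < R")
    case True
    obtain y t where "z = (y, t)" by (cases z)
    then show ?thesis
      using C1(2)[OF True, of y t] C2(2)[OF True, of y t] by (auto simp: top_unique)
  next
    case False
    then have empty: "ball z R = {}" by simp
    show ?thesis unfolding empty by simp
  qed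
  note fin = this
  have dual: "AE x in lborel. ennreal_powr (w x) (1 / p) * ennreal_powr (\<sigma> x) (1 - 1 / p) = 1"
    using AE_weight_coordinates
  proof eventually_elim
    case (elim x)
    then have pos: "0 < norm (fst x)" "0 < norm x" "0 < \<bar>snd x\<bar>" by auto
    have "weight (p * a, p * b, p * c) x powr (1 / p) * weight (e * a, e * b, e * c) x powr (1 - 1 / p)
      = (norm (fst x) powr (p * a * (1 / p)) * norm (fst x) powr (e * a * (1 - 1 / p)))
       * (norm x powr (p * b * (1 / p)) * norm x powr (e * b * (1 - 1 / p)))
       * (\<bar>snd x\<bar> powr (p * c * (1 / p)) * \<bar>snd x\<bar> powr (e * c * (1 - 1 / p)))"
      unfolding weight_def case_prod_conv by (simp only: powr_mult powr_powr mult_ac)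
    also have "\<dots> = 1"
      unfolding cancel[OF pos(1)] cancel[OF pos(2)] cancel[OF pos(3)] by simp
    finally show ?case
      unfolding w_def \<sigma>_def by (simp add: ennreal_powr_ennreal weight_nonneg ennreal_mult[symmetric])
  qed
  obtain C where C: "0 \<le> C"
    "\<And>F. F \<in> borel_measurable borel \<Longrightarrow> (\<integral>\<^sup>+x. w x * ennreal_powr (maximal lborel F x) p \<partial>lborel)
      \<le> ennreal C * (\<integral>\<^sup>+x. w x * ennreal_powr (F x) p \<partial>lborel)"
  proof (rule maximal_weighted_bound[OF p _ _ _ _ dual _ _ Ap])
    show "w \<in> borel_measurable borel" "\<sigma> \<in> borel_measurable borel"
      unfolding w_def \<sigma>_def by measurable
    show "0 \<le> K" using v C1(1) C2(1) by (simp add: K_def)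
  qed (use fin in \<open>auto simp: w_def \<sigma>_def\<close>)
  have "ennreal_powr (ennreal (weight (a, b, c) x) * u) p = w x * ennreal_powr u p" for x u
    unfolding w_def ennreal_powr_mult
    by (simp add: ennreal_powr_ennreal weight_nonneg) (simp add: weight_def powr_mult powr_powr mult_ac)
  then show ?thesis
    by (intro that[OF C(1)]) (simp add: C(2))
qed

lemma iterated_maximal_measurable [measurable]:
  "F \<in> borel_measurable borel \<Longrightarrow> (maximal \<mu> ^^ k) F \<in> borel_measurable borel"
  by (cases k) auto

lemma iterated_maximal_power_weight_bound:
  fixes a b c p :: real
  assumes p: "1 < p"
    and reg: "p *\<^sub>R (a, b, c) \<in> (region_A (CARD('m::finite) + 1) \<union> region_B (CARD('m) + 1)) \<inter>
      (region_C (CARD('m) + 1) p \<union> region_D (CARD('m) + 1) p)"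
  obtains C where "0 \<le> C"
    "\<And>F. F \<in> borel_measurable (borel :: ((real ^ 'm) \<times> real) measure) \<Longrightarrow>
      (\<integral>\<^sup>+x. ennreal_powr (ennreal (weight (a, b, c) x) * (maximal lborel ^^ k) F x) p \<partial>lborel)
      \<le> ennreal C * (\<integral>\<^sup>+x. ennreal_powr (ennreal (weight (a, b, c) x) * F x) p \<partial>lborel)"
proof -
  obtain C where C: "0 \<le> C"
    "\<And>F. F \<in> borel_measurable (borel :: ((real ^ 'm) \<times> real) measure) \<Longrightarrow>
      (\<integral>\<^sup>+x. ennreal_powr (ennreal (weight (a, b, c) x) * maximal lborel F x) p \<partial>lborel)
      \<le> ennreal C * (\<integral>\<^sup>+x. ennreal_powr (ennreal (weight (a, b, c) x) * F x) p \<partial>lborel)"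
    using maximal_power_weight_bound[OF p reg] by blast
  have "(\<integral>\<^sup>+x. ennreal_powr (ennreal (weight (a, b, c) x) * (maximal lborel ^^ k) F x) p \<partial>lborel)
      \<le> ennreal (C ^ k) * (\<integral>\<^sup>+x. ennreal_powr (ennreal (weight (a, b, c) x) * F x) p \<partial>lborel)"
    if F: "F \<in> borel_measurable (borel :: ((real ^ 'm) \<times> real) measure)" for F
  proof (induction k)
    case (Suc k)
    have "(\<integral>\<^sup>+x. ennreal_powr (ennreal (weight (a, b, c) x) * (maximal lborel ^^ Suc k) F x) p \<partial>lborel)
      \<le> ennreal C * (\<integral>\<^sup>+x. ennreal_powr (ennreal (weight (a, b, c) x) * (maximal lborel ^^ k) F x) p \<partial>lborel)"
      using C(2)[OF iterated_maximal_measurable[OF F, where \<mu> = lborel and k = k]] by simp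
    also have "\<dots> \<le> ennreal C * (ennreal (C ^ k) * (\<integral>\<^sup>+x. ennreal_powr (ennreal (weight (a, b, c) x) * F x) p \<partial>lborel))"
      by (intro mult_left_mono Suc) auto
    finally show ?case using C(1) by (simp add: ennreal_mult mult.assoc)
  qed simp
  then show ?thesis by (intro that[of "C ^ k"]) (use C in auto)
qed

subsection \<open>Gaussian kernels\<close>

lemma borel_measurable_cis [measurable (raw)]:
  assumes "f \<in> borel_measurable M" shows "(\<lambda>x. cis (f x)) \<in> borel_measurable M"
  using assms by (rule measurable_compose)
    (auto intro!: borel_measurable_continuous_onI continuous_intros simp: cis_conv_exp)

text \<open>The dilates of the profile \<open>(1 + |z|^2) ^ - (n + 1)\<close>, scaled to have an
  integral independent of \<rho>. They are the radial majorants of Gaussian differences and, for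
  radius 1, of rapidly decreasing functions.\<close>

definition bump :: "real \<Rightarrow> 'a::euclidean_space \<Rightarrow> real" where
  "bump \<rho> z = 1 / (\<rho> ^ DIM('a) * (1 + (norm z / \<rho>)\<^sup>2) ^ (DIM('a) + 1))"

lemma bump_nonneg: "0 < \<rho> \<Longrightarrow> 0 \<le> bump \<rho> z"
  by (simp add: bump_def)

lemma borel_measurable_bump [measurable]: "bump \<rho> \<in> borel_measurable borel"
  unfolding bump_def by measurable

text \<open>The radially decreasing profile is dominated by a geometrically weighted sum of normalised
  indicators of the balls of radius \<open>2 ^ k * \<rho>\<close>.\<close>

lemma bump_maximal_bound:
  obtains C where "0 \<le> C"
    "\<And>\<rho> x F. 0 < \<rho> \<Longrightarrow> F \<in> borel_measurable borel \<Longrightarrow>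
      (\<integral>\<^sup>+y. ennreal (bump \<rho> (x - y :: 'a::euclidean_space)) * F y \<partial>lborel) \<le> ennreal C * maximal lborel F x"
proof -
  define n where "n = DIM('a)"
  define v where "v = unit_ball_vol (real DIM('a))"
  have v: "0 < v" by (simp add: v_def)
  define c where "c = 4 ^ (n + 1) * v"
  have c: "0 < c" using v by (simp add: c_def)
  have term_le: "g k \<le> (\<Sum>k. g k)" for g :: "nat \<Rightarrow> ennreal" and k
    using sum_le_suminf[of g "{k}"] by simp
  have main: "(\<integral>\<^sup>+y. ennreal (bump \<rho> (x - y)) * F y \<partial>lborel) \<le> ennreal (2 * c) * maximal lborel F x"
    if \<rho>: "0 < \<rho>" and [measurable]: "F \<in> borel_measurable borel" for \<rho> x and F :: "'a \<Rightarrow> ennreal"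
  proof -
    define B where "B k = ball x (2 ^ k * \<rho>)" for k
    have [measurable]: "B k \<in> sets borel" for k by (simp add: B_def)
    have vol: "emeasure lborel (B k) = ennreal (v * (2 ^ k * \<rho>) ^ n)" for k
      using \<rho> by (simp add: B_def emeasure_ball v_def n_def)
    \<comment> \<open>On the \<open>k\<close>-th shell the profile is at most
      \<open>4 ^ (n + 1) / (2 ^ k) ^ (n + 1)\<close>. Of the \<open>n + 1\<close> factors
      \<open>2 ^ k\<close>, \<open>n\<close> go into the volume of \<open>B k\<close> and one
      remains to make the weights \<open>d k\<close> summable.\<close>
    define d where "d k = c * (1 / 2) ^ k" for k :: nat
    have d: "0 \<le> d k" for k using c by (simp add: d_def)
    have pt: "ennreal (bump \<rho> (x - y)) \<le> (\<Sum>k. ennreal (d k) / emeasure lborel (B k) * indicator (B k) y)" for y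
    proof -
      define z where "z = norm (x - y) / \<rho>"
      have z: "0 \<le> z" using \<rho> by (simp add: z_def)
      obtain N :: nat where "z < 2 ^ N" using real_arch_pow[of 2 z] by auto
      define k where "k = (LEAST k. z < 2 ^ k)"
      have k: "z < 2 ^ k" unfolding k_def by (rule LeastI) fact
      have "(2 ^ k)\<^sup>2 \<le> 4 * (1 + z\<^sup>2)"
      proof (cases k)
        case (Suc j)
        then have "\<not> z < 2 ^ j" unfolding k_def by (metis lessI not_less_Least)
        then have "(2 ^ j)\<^sup>2 \<le> z\<^sup>2" by (intro power_mono) auto
        then show ?thesis unfolding Suc by (simp add: power_mult_distrib)
      qed (simp add: z)
      then have "((2 ^ k)\<^sup>2) ^ (n + 1) \<le> (4 * (1 + z\<^sup>2)) ^ (n + 1)"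
        by (intro power_mono) auto
      moreover have "(2 ^ k) ^ (n + 1) \<le> ((2 ^ k)\<^sup>2 :: real) ^ (n + 1)"
        by (intro power_mono) (auto simp: power2_eq_square)
      ultimately have "(2 ^ k) ^ (n + 1) \<le> 4 ^ (n + 1) * (1 + z\<^sup>2) ^ (n + 1)"
        by (simp only: power_mult_distrib)
      moreover have pos: "0 < (1 + z\<^sup>2) ^ (n + 1)" by (simp add: add_pos_nonneg)
      ultimately have "1 / (1 + z\<^sup>2) ^ (n + 1) \<le> 4 ^ (n + 1) / (2 ^ k) ^ (n + 1)"
        by (simp add: field_simps)
      then have "1 / (1 + z\<^sup>2) ^ (n + 1) / \<rho> ^ n \<le> 4 ^ (n + 1) / (2 ^ k) ^ (n + 1) / \<rho> ^ n"
        using \<rho> by (intro divide_right_mono) auto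
      also have "\<dots> = d k / (v * (2 ^ k * \<rho>) ^ n)"
        using v \<rho> by (simp add: d_def c_def power_mult_distrib power_one_over power_add field_simps)
      finally have "bump \<rho> (x - y) \<le> d k / (v * (2 ^ k * \<rho>) ^ n)"
        by (simp add: bump_def n_def z_def mult.commute)
      then have "ennreal (bump \<rho> (x - y)) \<le> ennreal (d k / (v * (2 ^ k * \<rho>) ^ n))" by (rule ennreal_leI)
      also have "\<dots> = ennreal (d k) / emeasure lborel (B k)"
        unfolding vol using d v \<rho> by (simp add: divide_ennreal)
      also have "\<dots> = ennreal (d k) / emeasure lborel (B k) * indicator (B k) y"
        using k \<rho> by (simp add: B_def z_def dist_norm field_simps)
      also have "\<dots> \<le> (\<Sum>k. ennreal (d k) / emeasure lborel (B k) * indicator (B k) y)"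
        by (rule term_le[of "\<lambda>k. ennreal (d k) / emeasure lborel (B k) * indicator (B k) y"])
      finally show ?thesis .
    qed
    have "(\<integral>\<^sup>+y. ennreal (bump \<rho> (x - y)) * F y \<partial>lborel)
      \<le> (\<integral>\<^sup>+y. (\<Sum>k. ennreal (d k) / emeasure lborel (B k) * (F y * indicator (B k) y)) \<partial>lborel)"
    proof (intro nn_integral_mono)
      fix y
      have "ennreal (bump \<rho> (x - y)) * F y \<le> (\<Sum>k. ennreal (d k) / emeasure lborel (B k) * indicator (B k) y) * F y"
        by (intro mult_right_mono pt) auto
      then show "ennreal (bump \<rho> (x - y)) * F y
        \<le> (\<Sum>k. ennreal (d k) / emeasure lborel (B k) * (F y * indicator (B k) y))"
        by (simp add: ennreal_suminf_multc[symmetric] mult_ac)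
    qed
    also have "\<dots> = (\<Sum>k. \<integral>\<^sup>+y. ennreal (d k) / emeasure lborel (B k) * (F y * indicator (B k) y) \<partial>lborel)"
      by (intro nn_integral_suminf) simp
    also have "\<dots> \<le> (\<Sum>k. ennreal (d k) * maximal lborel F x)"
    proof (intro suminf_le summableI)
      fix k
      have "(\<integral>\<^sup>+y. ennreal (d k) / emeasure lborel (B k) * (F y * indicator (B k) y) \<partial>lborel)
        = ennreal (d k) * ((\<integral>\<^sup>+y\<in>B k. F y \<partial>lborel) / emeasure lborel (B k))"
        by (subst nn_integral_cmult) (simp_all add: divide_ennreal_def mult_ac)
      also have "\<dots> \<le> ennreal (d k) * maximal lborel F x"
        unfolding B_def using \<rho> by (intro mult_left_mono maximal_upper) auto
      finally show "(\<integral>\<^sup>+y. ennreal (d k) / emeasure lborel (B k) * (F y * indicator (B k) y) \<partial>lborel)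
        \<le> ennreal (d k) * maximal lborel F x" .
    qed
    also have "\<dots> = (\<Sum>k. ennreal (d k)) * maximal lborel F x" by simp
    also have "(\<Sum>k. ennreal (d k)) = ennreal (\<Sum>k. d k)"
      using d unfolding d_def by (intro suminf_ennreal2 summable_mult summable_geometric) auto
    also have "(\<Sum>k. d k) = 2 * c"
      unfolding d_def by (subst suminf_mult) (auto simp: suminf_geometric intro!: summable_geometric)
    finally show ?thesis .
  qed
  show ?thesis by (rule that[OF _ main]) (use c in auto)
qed

text \<open>The maximal function of the constant 1 is at most 1, so the maximal bound applied to
  that constant already gives a finite integral.\<close>

lemma integrable_bump:
  assumes \<rho>: "0 < \<rho>"
  shows "integrable lborel (bump \<rho> :: 'a::euclidean_space \<Rightarrow> real)"
proof -
  obtain C where C: "(\<integral>\<^sup>+y. ennreal (bump \<rho> (0 - y :: 'a)) * 1 \<partial>lborel) \<le> ennreal C * maximal lborel (\<lambda>_. 1) (0::'a)"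
  proof (rule bump_maximal_bound[where 'a = 'a])
    fix C assume "\<And>\<rho> (x :: 'a) F. 0 < \<rho> \<Longrightarrow> F \<in> borel_measurable borel \<Longrightarrow>
      (\<integral>\<^sup>+y. ennreal (bump \<rho> (x - y)) * F y \<partial>lborel) \<le> ennreal C * maximal lborel F x"
    from this[OF \<rho>, of "\<lambda>_. 1" 0] show ?thesis by (intro that[of C]) simp
  qed
  have "maximal lborel (\<lambda>_. 1) (0::'a) \<le> 1"
    unfolding maximal_def
  proof (intro SUP_least, clarify)
    fix c :: 'a and r :: real assume "0 < r"
    then have "emeasure lborel (ball c r) \<noteq> 0" "emeasure lborel (ball c r) < top"
      by (simp_all add: emeasure_ball ennreal_eq_0_iff not_le)
    then show "(\<integral>\<^sup>+y\<in>ball c r. 1 \<partial>lborel) / emeasure lborel (ball c r) \<le> 1"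
      by (simp add: ennreal_divide_self)
  qed
  then have "ennreal C * maximal lborel (\<lambda>_. 1) (0::'a) \<le> ennreal C * 1"
    by (intro mult_left_mono) auto
  also have "\<dots> < top" by simp
  finally have "(\<integral>\<^sup>+y. ennreal (bump \<rho> (y :: 'a)) \<partial>lborel) < top"
    using C by (simp add: bump_def)
  then show ?thesis
    using bump_nonneg[OF \<rho>] by (intro integrableI_nonneg) auto
qed

section \<open>Gaussians: Fourier transform and differences in the variance\<close>

definition gauss :: "real \<Rightarrow> 'a::euclidean_space \<Rightarrow> real" where
  "gauss v y = (1 / sqrt (2 * pi * v)) ^ DIM('a) * exp (- (norm y)\<^sup>2 / (2 * v))"

lemma borel_measurable_gauss [measurable]: "gauss v \<in> borel_measurable borel"
  unfolding gauss_def by measurable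

lemma gauss_nonneg: "0 < v \<Longrightarrow> 0 \<le> gauss v y"
  by (simp add: gauss_def)

lemma gauss_eq_prod:
  fixes y :: "'a::euclidean_space"
  assumes "0 < v"
  shows "gauss v y = (\<Prod>b\<in>Basis. normal_density 0 (sqrt v) (y \<bullet> b))"
proof -
  have "(norm y)\<^sup>2 = (\<Sum>b\<in>Basis. (y \<bullet> b)\<^sup>2)"
    by (simp add: norm_eq_sqrt_inner euclidean_inner[of y y] power2_eq_square sum_nonneg)
  then have "exp (- (norm y)\<^sup>2 / (2 * v)) = (\<Prod>b\<in>Basis. exp (- (y \<bullet> b)\<^sup>2 / (2 * v)))"
    by (simp add: exp_sum[symmetric] sum_negf sum_divide_distrib)
  then show ?thesis
    using assms by (simp add: gauss_def normal_density_def prod_dividef power_one_over)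
qed

text \<open>Rescaling by \<sigma> reduces the integral to the characteristic function of the
  standard normal distribution.\<close>

lemma fourier_normal_density:
  assumes \<sigma>: "0 < \<sigma>"
  shows "(LINT x|lborel. of_real (normal_density 0 \<sigma> x) * cis (c * x)) = exp (- (\<sigma> * c)\<^sup>2 / 2)"
    (is "?L = _")
proof -
  have "?L = \<bar>\<sigma>\<bar> *\<^sub>R (LINT x|lborel. of_real (normal_density 0 \<sigma> (0 + \<sigma> * x)) * cis (c * (0 + \<sigma> * x)))"
    using \<sigma> by (intro lborel_integral_real_affine) auto
  also have "\<dots> = (LINT x|lborel. of_real (std_normal_density x) * cis (c * \<sigma> * x))"
  proof -
    have "of_real \<sigma> * (of_real (normal_density 0 \<sigma> (0 + \<sigma> * x)) * cis (c * (0 + \<sigma> * x)))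
      = of_real (std_normal_density x) * cis (c * \<sigma> * x)" for x
    proof -
      have "\<sigma> * normal_density 0 \<sigma> (\<sigma> * x) = std_normal_density x"
        using \<sigma> by (simp add: normal_density_def power_mult_distrib real_sqrt_mult field_simps)
      then show ?thesis by (simp add: mult.assoc[symmetric] of_real_mult[symmetric] del: of_real_mult)
    qed
    then show ?thesis
      using \<sigma> by (simp add: scaleR_conv_of_real flip: integral_mult_right_zero)
  qed
  also have "\<dots> = (LINT x|std_normal_distribution. iexp (c * \<sigma> * x))"
    by (subst integral_density) (auto simp: cis_conv_exp scaleR_conv_of_real)
  also have "\<dots> = char std_normal_distribution (c * \<sigma>)" by (simp add: char_def)
  also have "\<dots> = exp (- (\<sigma> * c)\<^sup>2 / 2)"
    by (simp add: char_std_normal_distribution mult.commute exp_of_real flip: of_real_power of_real_mult)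
  finally show ?thesis .
qed

lemma integrable_gauss:
  assumes v: "0 < v" shows "integrable lborel (gauss v :: 'a::euclidean_space \<Rightarrow> real)"
proof -
  have "(\<integral>\<^sup>+y. ennreal (gauss v (y::'a)) \<partial>lborel) = (\<integral>\<^sup>+y. (\<Prod>b\<in>Basis. ennreal (normal_density 0 (sqrt v) (y \<bullet> b))) \<partial>(lborel :: 'a measure))"
    by (simp add: gauss_eq_prod[OF v] prod_ennreal)
  also have "\<dots> = (\<Prod>b\<in>(Basis::'a set). \<integral>\<^sup>+x. ennreal (normal_density 0 (sqrt v) x) \<partial>lborel)"
    by (rule nn_integral_lborel_prod) auto
  also have "\<dots> < top"
    using v by (simp add: nn_integral_eq_integral integral_normal_density integrable_normal_density)
  finally show ?thesis using gauss_nonneg[OF v] by (intro integrableI_nonneg) auto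
qed

definition symb :: "'a::euclidean_space \<Rightarrow> real" where
  "symb \<xi> = 2 * pi\<^sup>2 * (norm \<xi>)\<^sup>2"

lemma symb_nonneg [simp]: "0 \<le> symb \<xi>" by (simp add: symb_def)

lemma symb_pos: "\<xi> \<noteq> 0 \<Longrightarrow> 0 < symb \<xi>" by (simp add: symb_def)

lemma borel_measurable_symb [measurable]: "symb \<in> borel_measurable borel"
  unfolding symb_def by measurable

text \<open>Both the density and the character are products over the coordinates, so the integral is
  a product of one-dimensional ones.\<close>

lemma fourier_gauss:
  fixes \<xi> :: "'a::euclidean_space"
  assumes v: "0 < v"
  shows "(LINT y|lborel. of_real (gauss v y) * cis (2 * pi * (y \<bullet> \<xi>))) = exp (- v * symb \<xi>)"
proof -
  let ?f = "\<lambda>b x. complex_of_real (normal_density 0 (sqrt v) x) * cis (2 * pi * (\<xi> \<bullet> b) * x)"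
  have int: "integrable lborel (?f b)" for b :: 'a
  proof (rule Bochner_Integration.integrable_bound)
    show "integrable lborel (normal_density 0 (sqrt v))" using v by (simp add: integrable_normal_density)
  qed (auto simp: norm_mult)
  have cis_sum: "cis (\<Sum>b\<in>A. g b) = (\<Prod>b\<in>A. cis (g b))" if "finite A" for A :: "'a set" and g
    using that by (induction A) (auto simp: cis_mult[symmetric])
  have split: "of_real (gauss v y) * cis (2 * pi * (y \<bullet> \<xi>)) = (\<Prod>b\<in>Basis. ?f b (y \<bullet> b))" for y :: 'a
  proof -
    have "2 * pi * (y \<bullet> \<xi>) = (\<Sum>b\<in>Basis. 2 * pi * (\<xi> \<bullet> b) * (y \<bullet> b))"
      by (simp add: euclidean_inner[of y \<xi>] sum_distrib_left mult_ac)
    then show ?thesis by (simp add: gauss_eq_prod[OF v] cis_sum prod.distrib)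
  qed
  interpret product_sigma_finite "\<lambda>_::'a. lborel :: real measure" ..
  have "(LINT y|lborel. of_real (gauss v y) * cis (2 * pi * (y \<bullet> \<xi>)))
    = (LINT y|lborel. (\<Prod>b\<in>Basis. ?f b ((y::'a) \<bullet> b)))" by (simp only: split)
  also have "\<dots> = (LINT g|(\<Pi>\<^sub>M b\<in>(Basis::'a set). lborel). (\<Prod>b\<in>Basis. ?f b (g b)))"
    by (subst lborel_eq, subst integral_distr) (auto intro!: Bochner_Integration.integral_cong prod.cong)
  also have "\<dots> = (\<Prod>b\<in>(Basis::'a set). integral\<^sup>L lborel (?f b))"
    by (intro product_integral_prod int) auto
  also have "\<dots> = (\<Prod>b\<in>(Basis::'a set). complex_of_real (exp (- (sqrt v * (2 * pi * (\<xi> \<bullet> b)))\<^sup>2 / 2)))"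
    using v by (intro prod.cong refl) (simp add: fourier_normal_density)
  also have "\<dots> = complex_of_real (exp (\<Sum>b\<in>(Basis::'a set). - (sqrt v * (2 * pi * (\<xi> \<bullet> b)))\<^sup>2 / 2))"
    by (simp add: exp_sum)
  also have "(\<Sum>b\<in>(Basis::'a set). - (sqrt v * (2 * pi * (\<xi> \<bullet> b)))\<^sup>2 / 2) = - v * symb \<xi>"
  proof -
    have "(norm \<xi>)\<^sup>2 = (\<Sum>b\<in>Basis. (\<xi> \<bullet> b)\<^sup>2)"
      by (simp add: norm_eq_sqrt_inner euclidean_inner[of \<xi> \<xi>] power2_eq_square sum_nonneg)
    then show ?thesis
      using v by (simp add: symb_def power_mult_distrib sum_distrib_left sum_negf field_simps)
  qed
  finally show ?thesis by simp
qed

text \<open>As a single exponential the density can be differentiated in the variance by the chain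
  rule.\<close>

lemma gauss_powr:
  assumes "0 < v"
  shows "gauss v (y :: 'a::euclidean_space) = exp (- (real DIM('a) / 2) * ln (2 * pi * v) - (norm y)\<^sup>2 / (2 * v))"
proof -
  have "(1 / sqrt (2 * pi * v)) ^ DIM('a) = exp (- (real DIM('a) / 2) * ln (2 * pi * v))"
  proof -
    have "1 / sqrt (2 * pi * v) = exp (- (ln (2 * pi * v) / 2))"
      using assms by (simp add: ln_sqrt[symmetric] exp_minus inverse_eq_divide)
    then show ?thesis by (simp add: exp_of_nat_mult[symmetric] mult.commute)
  qed
  then show ?thesis unfolding gauss_def by (simp only: mult_exp_exp) simp
qed

text \<open>The \<open>n\<close>-th power of \<open>1 + z \<le> 2 n exp (z / (2 n))\<close>. It lets
  half of a Gaussian exponent absorb polynomial factors.\<close>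

lemma power_exp_bound:
  assumes "0 \<le> (z::real)" "0 < n"
  shows "(1 + z) ^ n * exp (- z / 2) \<le> (2 * real n) ^ n"
proof -
  have n1: "1 \<le> real n" using assms(2) by simp
  have "1 + z \<le> 2 * real n * (1 + z / (2 * real n))"
    using assms n1 by (simp add: field_simps)
  also have "\<dots> \<le> 2 * real n * exp (z / (2 * real n))"
    by (intro mult_left_mono exp_ge_add_one_self) auto
  finally have "(1 + z) ^ n \<le> (2 * real n * exp (z / (2 * real n))) ^ n"
    using assms by (intro power_mono) auto
  also have "\<dots> = (2 * real n) ^ n * exp (z / 2)"
    using assms by (simp add: power_mult_distrib exp_of_nat_mult[symmetric])
  finally have "(1 + z) ^ n * exp (- z / 2) \<le> (2 * real n) ^ n * exp (z / 2) * exp (- z / 2)"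
    by (intro mult_right_mono) auto
  also have "\<dots> = (2 * real n) ^ n" by (simp add: mult.assoc exp_add[symmetric])
  finally show ?thesis .
qed

text \<open>Mean value theorem in the variance: the derivative at \<open>w\<close> costs a factor
  \<open>(n + z) / (2 * w)\<close> with \<open>z = (norm y)^2 / w\<close>, which the exponential
  absorbs. The condition \<delta> \<le> \<open>v\<close> keeps the intermediate variance comparable
  to \<open>v\<close>.\<close>

lemma gauss_diff_bound:
  obtains C where "0 \<le> C"
    "\<And>v \<delta> (y :: 'a::euclidean_space). 0 < v \<Longrightarrow> 0 < \<delta> \<Longrightarrow> \<delta> \<le> v \<Longrightarrow>
      \<bar>gauss v y - gauss (v + \<delta>) y\<bar> \<le> \<delta> / v * C * bump (sqrt v) y"
proof -
  define n where "n = DIM('a)"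
  have n: "1 \<le> real n" by (simp add: n_def Suc_leI)
  \<comment> \<open>Of the \<open>n + 2\<close> powers, \<open>n + 1\<close> are the decay of
    \<open>bump\<close> and one absorbs the factor \<open>1 + z\<close> from the derivative.\<close>
  define K where "K = (2 * real (n + 2)) ^ (n + 2)"
  have K: "0 \<le> K" by (simp add: K_def)
  have main: "\<bar>gauss v y - gauss (v + \<delta>) y\<bar> \<le> \<delta> / v * (n * K * 2 ^ (n + 1)) * bump (sqrt v) y"
    if v: "0 < v" and \<delta>: "0 < \<delta>" "\<delta> \<le> v" for v \<delta> and y :: 'a
  proof -
    define N where "N = (norm y)\<^sup>2"
    have N: "0 \<le> N" by (simp add: N_def)
    define g where "g w = exp (- (real n / 2) * ln (2 * pi * w) - N / (2 * w))" for w
    define g' where "g' w = g w * (- (real n / (2 * w)) + N / (2 * w\<^sup>2))" for w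
    have g: "gauss w y = g w" if "0 < w" for w
      using gauss_powr[OF that, of y] by (simp add: g_def n_def N_def)
    have der: "(g has_real_derivative g' w) (at w)" if "0 < w" for w
    proof -
      have "((\<lambda>w. - (real n / 2) * ln (2 * pi * w) - N / (2 * w)) has_real_derivative
          - (real n / (2 * w)) + N / (2 * w\<^sup>2)) (at w)"
        using that by (auto intro!: derivative_eq_intros simp: field_simps power2_eq_square)
      then show ?thesis unfolding g_def[abs_def] g'_def by (rule DERIV_fun_exp)
    qed
    obtain w where w: "v < w" "w < v + \<delta>" and "g (v + \<delta>) - g v = (v + \<delta> - v) * g' w"
      using MVT2[of v "v + \<delta>" g g'] der v \<delta> by auto
    then have eq: "\<bar>gauss v y - gauss (v + \<delta>) y\<bar> = \<delta> * \<bar>g' w\<bar>"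
      using v \<delta> abs_minus_commute[of "g v" "g (v + \<delta>)"] by (simp add: g abs_mult)
    define z where "z = N / w"
    have w0: "0 < w" using w v by simp
    have z: "0 \<le> z" using N w0 by (simp add: z_def)
    have "\<bar>g' w\<bar> \<le> g w * (real n / (2 * w) + N / (2 * w\<^sup>2))"
    proof -
      have "\<bar>- (real n / (2 * w)) + N / (2 * w\<^sup>2)\<bar> \<le> real n / (2 * w) + N / (2 * w\<^sup>2)"
        using w0 N by (intro abs_leI) (auto intro: order.trans[of _ 0])
      then show ?thesis by (simp add: g'_def abs_mult g_def mult_left_mono)
    qed
    also have "real n / (2 * w) + N / (2 * w\<^sup>2) = (real n + z) / (2 * w)"
      using w0 by (simp add: z_def field_simps power2_eq_square)
    also have "g w * ((real n + z) / (2 * w)) \<le> ((1 / sqrt v) ^ n * exp (- z / 2)) * (real n * (1 + z) / v)"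
    proof (intro mult_mono)
      have "v \<le> 2 * pi * w"
        using w v pi_gt3 mult_mono[of 1 "2 * pi" v w] by simp
      then have "(1 / sqrt (2 * pi * w)) ^ n \<le> (1 / sqrt v) ^ n"
        using v w0 by (intro power_mono frac_le) auto
      moreover have "g w = (1 / sqrt (2 * pi * w)) ^ n * exp (- z / 2)"
        using g[OF w0] by (simp add: gauss_def n_def N_def z_def mult.commute)
      ultimately show "g w \<le> (1 / sqrt v) ^ n * exp (- z / 2)"
        by (simp add: mult_right_mono)
      have "real n + z \<le> real n * (1 + z)"
        using n z mult_right_mono[of 1 "real n" z] by (simp add: distrib_left)
      then show "(real n + z) / (2 * w) \<le> real n * (1 + z) / v"
        using w v z n by (intro frac_le) auto
    qed (use v w0 z n in auto)
    also have "\<dots> = (1 / sqrt v) ^ n * (real n / v) * ((1 + z) * exp (- z / 2))"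
      by (simp add: field_simps)
    also have "\<dots> \<le> (1 / sqrt v) ^ n * (real n / v) * (K * 2 ^ (n + 1) / (1 + N / v) ^ (n + 1))"
    proof (intro mult_left_mono)
      have "(1 + z) ^ (n + 2) * exp (- z / 2) \<le> K"
        unfolding K_def by (rule power_exp_bound) (use z in auto)
      then have "(1 + z) * exp (- z / 2) \<le> K / (1 + z) ^ (n + 1)"
        using z by (simp add: field_simps add_pos_nonneg)
      \<comment> \<open>Return from the intermediate variance \<open>w\<close> to \<open>v\<close>:
        since \<open>w \<le> 2 * v\<close>, each of the \<open>n + 1\<close> factors loses at most
        2.\<close>
      also have "\<dots> \<le> K / ((1 + N / v) / 2) ^ (n + 1)"
      proof (intro divide_left_mono power_mono K)
        have "N / v \<le> 2 * N / w"
          using w w0 v \<delta> N mult_right_mono[of w "2 * v" N] by (simp add: field_simps)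
        then have "N / v \<le> 2 * z" by (simp add: z_def)
        then have "(1 + N / v) / 2 \<le> (1 + 2 * z) / 2"
          by (intro divide_right_mono add_left_mono) auto
        also have "\<dots> \<le> 1 + z" by simp
        finally show "(1 + N / v) / 2 \<le> 1 + z" .
      qed (use N v z in \<open>auto intro!: mult_pos_pos zero_less_power simp: add_pos_nonneg\<close>)
      also have "\<dots> = K * 2 ^ (n + 1) / (1 + N / v) ^ (n + 1)"
        by (simp add: power_divide)
      finally show "(1 + z) * exp (- z / 2) \<le> K * 2 ^ (n + 1) / (1 + N / v) ^ (n + 1)" .
    qed (use v in auto)
    also have "\<dots> = (real n * K * 2 ^ (n + 1)) / v * bump (sqrt v) y"
      using v by (simp add: bump_def n_def[symmetric] N_def power_divide mult_ac)
    finally have "\<delta> * \<bar>g' w\<bar> \<le> \<delta> * ((real n * K * 2 ^ (n + 1)) / v * bump (sqrt v) y)"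
      using \<delta> by (intro mult_left_mono) auto
    then show ?thesis unfolding eq by (simp add: mult_ac)
  qed
  show ?thesis by (rule that[OF _ main]) (use K in auto)
qed

lemma lborel_integral_reflect:
  fixes f :: "'a::euclidean_space \<Rightarrow> 'b::{banach, second_countable_topology}"
  assumes [measurable]: "f \<in> borel_measurable borel"
  shows "(LINT y|lborel. f (x - y)) = (LINT y|lborel. f y)"
proof -
  have "lborel = distr lborel borel (\<lambda>y::'a. x + (-1) *\<^sub>R y)"
    using lborel_affine[of "-1" x] by (simp add: density_1)
  then have "(LINT y|lborel. f y) = (LINT y|distr lborel borel (\<lambda>y. x + (-1) *\<^sub>R y). f y)"
    by (rule arg_cong)
  also have "\<dots> = (LINT y|lborel. f (x - y))"
    by (subst integral_distr) auto
  finally show ?thesis ..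
qed

lemma lborel_integrable_reflect:
  fixes f :: "'a::euclidean_space \<Rightarrow> real"
  assumes f: "integrable lborel f"
  shows "integrable lborel (\<lambda>y. f (x - y))"
proof -
  have [measurable]: "f \<in> borel_measurable borel" using borel_measurable_integrable[OF f] by simp
  have "lborel = distr lborel borel (\<lambda>y::'a. x + (-1) *\<^sub>R y)"
    using lborel_affine[of "-1" x] by (simp add: density_1)
  then have "integrable (distr lborel borel (\<lambda>y::'a. x + (-1) *\<^sub>R y)) f" using f by metis
  then show ?thesis by (subst (asm) integrable_distr_eq) auto
qed

lemma norm_cis_mult [simp]: "norm (cis a * z) = norm z"
  by (simp add: norm_mult)

lemma integrable_cis_mult:
  assumes "integrable M h" and [measurable]: "f \<in> borel_measurable M"
  shows "integrable M (\<lambda>\<xi>. cis (f \<xi>) * h \<xi>)"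
proof -
  have [measurable]: "h \<in> borel_measurable M" using assms by auto
  show ?thesis by (rule Bochner_Integration.integrable_bound[OF assms(1)]) auto
qed

subsection \<open>The heat semigroup and the maximal operator\<close>

lemma borel_measurable_inv_fourier [measurable]:
  assumes "h \<in> borel_measurable borel"
  shows "inv_fourier h \<in> borel_measurable (borel :: 'a::euclidean_space measure)"
proof -
  have [measurable]: "h \<in> borel_measurable lborel" using assms by simp
  have "(\<lambda>x. LINT \<xi>|lborel. cis (2 * pi * (x \<bullet> \<xi>)) * h \<xi>) \<in> borel_measurable (lborel :: 'a measure)"
    by (rule lborel.borel_measurable_lebesgue_integral) simp
  then show ?thesis by (simp add: inv_fourier_def[abs_def])
qed

lemma norm_inv_fourier_le: "norm (inv_fourier h x) \<le> (LINT \<xi>|lborel. norm (h \<xi>))"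
  unfolding inv_fourier_def
  by (rule order.trans[OF integral_norm_bound]) simp

text \<open>Convolving an inverse transform with a Gaussian is Fubini's theorem and
  \<open>fourier_gauss\<close>; integrability of \<open>h\<close> is all the regularity
  involved.\<close>

lemma gauss_convolution:
  fixes h :: "'a::euclidean_space \<Rightarrow> complex"
  assumes h: "integrable lborel h" and v: "0 < v"
  shows "(LINT y|lborel. of_real (gauss v (x - y)) * inv_fourier h y)
    = inv_fourier (\<lambda>\<xi>. of_real (exp (- v * symb \<xi>)) * h \<xi>) x"
proof -
  have [measurable]: "h \<in> borel_measurable borel" using borel_measurable_integrable[OF h] by simp
  let ?F = "\<lambda>y \<xi>. of_real (gauss v (x - y)) * (cis (2 * pi * (y \<bullet> \<xi>)) * h \<xi>)"
  have int: "integrable (lborel \<Otimes>\<^sub>M lborel) (case_prod ?F)"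
  proof (rule lborel_pair.Fubini_integrable)
    show "integrable lborel (\<lambda>y. LINT \<xi>|lborel. norm (case (y, \<xi>) of (y, \<xi>) \<Rightarrow> ?F y \<xi>))"
      using gauss_nonneg[OF v] lborel_integrable_reflect[OF integrable_gauss[OF v], of x]
      by (simp add: norm_mult)
    show "AE y in lborel. integrable lborel (\<lambda>\<xi>. case (y, \<xi>) of (y, \<xi>) \<Rightarrow> ?F y \<xi>)"
      using h by (auto intro!: integrable_mult_right integrable_cis_mult)
  qed simp
  have inner: "(LINT y|lborel. ?F y \<xi>) = cis (2 * pi * (x \<bullet> \<xi>)) * (of_real (exp (- v * symb \<xi>)) * h \<xi>)" for \<xi>
  proof -
    have "(LINT y|lborel. ?F y \<xi>) = (LINT y|lborel. of_real (gauss v (x - y)) * cis (2 * pi * (y \<bullet> \<xi>))) * h \<xi>"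
      by (subst integral_mult_left_zero[symmetric]) (simp add: mult.assoc)
    also have "(LINT y|lborel. of_real (gauss v (x - y)) * cis (2 * pi * (y \<bullet> \<xi>)))
      = (LINT y|lborel. of_real (gauss v (x - (x - y))) * cis (2 * pi * ((x - y) \<bullet> \<xi>)))"
      by (rule lborel_integral_reflect[symmetric]) simp
    also have "\<dots> = (LINT y|lborel. cis (2 * pi * (x \<bullet> \<xi>)) * (of_real (gauss v y) * cis (2 * pi * (y \<bullet> (- \<xi>)))))"
      by (simp add: inner_diff_left right_diff_distrib mult_ac cis_divide[symmetric] cis_inverse[symmetric] divide_inverse flip: cis_inverse)
    also have "\<dots> = cis (2 * pi * (x \<bullet> \<xi>)) * of_real (exp (- v * symb \<xi>))"
      by (subst integral_mult_right_zero, subst fourier_gauss[OF v]) (simp add: symb_def)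
    finally show ?thesis by (simp add: mult.assoc)
  qed
  have "(LINT y|lborel. of_real (gauss v (x - y)) * inv_fourier h y) = (LINT y|lborel. (LINT \<xi>|lborel. ?F y \<xi>))"
    unfolding inv_fourier_def by (simp only: integral_mult_right_zero)
  also have "\<dots> = (LINT \<xi>|lborel. (LINT y|lborel. ?F y \<xi>))"
    by (rule lborel_pair.Fubini_integral[OF int, symmetric])
  also have "\<dots> = inv_fourier (\<lambda>\<xi>. of_real (exp (- v * symb \<xi>)) * h \<xi>) x"
    unfolding inner inv_fourier_def ..
  finally show ?thesis .
qed

lemma integrable_bounded_mult:
  fixes h :: "'a::euclidean_space \<Rightarrow> complex" and m :: "'a \<Rightarrow> real"
  assumes h: "integrable lborel h" and [measurable]: "m \<in> borel_measurable borel"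
    and b: "\<And>\<xi>. \<bar>m \<xi>\<bar> \<le> B"
  shows "integrable lborel (\<lambda>\<xi>. of_real (m \<xi>) * h \<xi>)"
proof (rule Bochner_Integration.integrable_bound)
  show "integrable lborel (\<lambda>\<xi>. B * norm (h \<xi>))" using h by simp
  have [measurable]: "h \<in> borel_measurable borel" using borel_measurable_integrable[OF h] by simp
  show "(\<lambda>\<xi>. of_real (m \<xi>) * h \<xi>) \<in> borel_measurable lborel" by simp
  have "0 \<le> B" using b[of 0] by (meson abs_ge_zero order_trans)
  then show "AE \<xi> in lborel. norm (of_real (m \<xi>) * h \<xi>) \<le> norm (B * norm (h \<xi>))"
    using b by (auto simp: norm_mult abs_mult intro!: mult_right_mono)
qed

lemma inv_fourier_diff:
  assumes "integrable lborel f" "integrable lborel g"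
  shows "inv_fourier (\<lambda>\<xi>. f \<xi> - g \<xi>) x = inv_fourier f x - inv_fourier g x"
  unfolding inv_fourier_def
  by (subst Bochner_Integration.integral_diff[symmetric])
    (auto intro!: integrable_cis_mult assms simp: right_diff_distrib)

text \<open>The multiplier acts as convolution with the difference of two Gaussians, which is
  dominated by \<delta> / \<open>v\<close> times \<open>bump (sqrt v)\<close>. The factor \<delta>
  survives division by \<delta> in the next limit.\<close>

lemma heat_difference_maximal_bound:
  obtains C where "0 \<le> C"
    "\<And>v \<delta> h (x :: 'a::euclidean_space). 0 < v \<Longrightarrow> 0 < \<delta> \<Longrightarrow> \<delta> \<le> v \<Longrightarrow> integrable lborel h \<Longrightarrow>
      ennreal (norm (inv_fourier (\<lambda>\<xi>. of_real (exp (- v * symb \<xi>) - exp (- (v + \<delta>) * symb \<xi>)) * h \<xi>) x))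
      \<le> ennreal (\<delta> / v * C) * maximal lborel (\<lambda>y. ennreal (norm (inv_fourier h y))) x"
proof -
  obtain C1 where C1: "0 \<le> C1"
    "\<And>v \<delta> (y :: 'a). 0 < v \<Longrightarrow> 0 < \<delta> \<Longrightarrow> \<delta> \<le> v \<Longrightarrow>
      \<bar>gauss v y - gauss (v + \<delta>) y\<bar> \<le> \<delta> / v * C1 * bump (sqrt v) y"
    using gauss_diff_bound by blast
  obtain C2 where C2: "0 \<le> C2"
    "\<And>\<rho> x F. 0 < \<rho> \<Longrightarrow> F \<in> borel_measurable borel \<Longrightarrow>
      (\<integral>\<^sup>+y. ennreal (bump \<rho> (x - y :: 'a)) * F y \<partial>lborel) \<le> ennreal C2 * maximal lborel F x"
    using bump_maximal_bound by blast
  have main: "ennreal (norm (inv_fourier (\<lambda>\<xi>. of_real (exp (- v * symb \<xi>) - exp (- (v + \<delta>) * symb \<xi>)) * h \<xi>) x))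
      \<le> ennreal (\<delta> / v * (C1 * C2)) * maximal lborel (\<lambda>y. ennreal (norm (inv_fourier h y))) x"
    if v: "0 < v" and \<delta>: "0 < \<delta>" "\<delta> \<le> v" and h: "integrable lborel h" for v \<delta> h and x :: 'a
  proof -
    have [measurable]: "h \<in> borel_measurable borel" using borel_measurable_integrable[OF h] by simp
    have int: "integrable lborel (\<lambda>\<xi>. of_real (exp (- w * symb \<xi>)) * h \<xi>)" if "0 < w" for w
      using that by (intro integrable_bounded_mult[OF h, of _ 1]) auto
    have gint: "integrable lborel (\<lambda>y. of_real (gauss w (x - y)) * inv_fourier h y)" if "0 < w" for w
    proof (rule Bochner_Integration.integrable_bound)
      show "integrable lborel (\<lambda>y. gauss w (x - y) * (LINT \<xi>|lborel. norm (h \<xi>)))"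
        by (intro integrable_mult_left lborel_integrable_reflect integrable_gauss that)
      show "AE y in lborel. norm (of_real (gauss w (x - y)) * inv_fourier h y)
         \<le> norm (gauss w (x - y) * (LINT \<xi>|lborel. norm (h \<xi>)))"
        using norm_inv_fourier_le[of h] gauss_nonneg[OF that]
        by (auto simp: norm_mult abs_mult intro!: mult_left_mono order.trans[OF _ abs_ge_self])
    qed simp
    let ?D = "\<lambda>y. gauss v (x - y) - gauss (v + \<delta>) (x - y)"
    have "inv_fourier (\<lambda>\<xi>. of_real (exp (- v * symb \<xi>) - exp (- (v + \<delta>) * symb \<xi>)) * h \<xi>) x
      = inv_fourier (\<lambda>\<xi>. of_real (exp (- v * symb \<xi>)) * h \<xi>) x - inv_fourier (\<lambda>\<xi>. of_real (exp (- (v + \<delta>) * symb \<xi>)) * h \<xi>) x"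
    proof -
      have "(\<lambda>\<xi>. of_real (exp (- v * symb \<xi>) - exp (- (v + \<delta>) * symb \<xi>)) * h \<xi>)
        = (\<lambda>\<xi>. of_real (exp (- v * symb \<xi>)) * h \<xi> - of_real (exp (- (v + \<delta>) * symb \<xi>)) * h \<xi>)"
        by (simp only: left_diff_distrib of_real_diff)
      then show ?thesis
        using v \<delta> inv_fourier_diff[OF int[of v] int[of "v + \<delta>"], of x] by (simp only: add_pos_pos)
    qed
    also have "\<dots> = (LINT y|lborel. of_real (?D y) * inv_fourier h y)"
    proof -
      have v\<delta>: "0 < v + \<delta>" using v \<delta> by simp
      show ?thesis
        unfolding gauss_convolution[OF h v, symmetric] gauss_convolution[OF h v\<delta>, symmetric]
        by (subst Bochner_Integration.integral_diff[OF gint[OF v] gint[OF v\<delta>], symmetric])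
          (simp only: left_diff_distrib of_real_diff)
    qed
    finally have "ennreal (norm (inv_fourier (\<lambda>\<xi>. of_real (exp (- v * symb \<xi>) - exp (- (v + \<delta>) * symb \<xi>)) * h \<xi>) x))
      = ennreal (norm (LINT y|lborel. of_real (?D y) * inv_fourier h y))" by simp
    also have "\<dots> \<le> (\<integral>\<^sup>+y. ennreal (norm (of_real (?D y) * inv_fourier h y)) \<partial>lborel)"
    proof (rule integral_norm_bound_ennreal)
      show "integrable lborel (\<lambda>y. of_real (?D y) * inv_fourier h y)"
        using Bochner_Integration.integrable_diff[OF gint[OF v] gint[of "v + \<delta>"]] v \<delta>
        by (simp add: left_diff_distrib)
    qed
    also have "\<dots> \<le> (\<integral>\<^sup>+y. ennreal (\<delta> / v * C1) * (ennreal (bump (sqrt v) (x - y)) * ennreal (norm (inv_fourier h y))) \<partial>lborel)"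
    proof (intro nn_integral_mono)
      fix y
      have "norm (of_real (?D y) * inv_fourier h y) \<le> (\<delta> / v * C1 * bump (sqrt v) (x - y)) * norm (inv_fourier h y)"
        unfolding norm_mult norm_of_real by (intro mult_right_mono C1 v \<delta>) auto
      then show "ennreal (norm (of_real (?D y) * inv_fourier h y))
        \<le> ennreal (\<delta> / v * C1) * (ennreal (bump (sqrt v) (x - y)) * ennreal (norm (inv_fourier h y)))"
        using v \<delta> C1(1) bump_nonneg[of "sqrt v" "x - y"]
        by (subst ennreal_mult[symmetric], simp, simp, subst ennreal_mult[symmetric])
          (auto intro!: ennreal_leI simp: mult.assoc)
    qed
    also have "\<dots> = ennreal (\<delta> / v * C1) * (\<integral>\<^sup>+y. ennreal (bump (sqrt v) (x - y)) * ennreal (norm (inv_fourier h y)) \<partial>lborel)"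
      by (rule nn_integral_cmult) simp
    also have "\<dots> \<le> ennreal (\<delta> / v * C1) * (ennreal C2 * maximal lborel (\<lambda>y. ennreal (norm (inv_fourier h y))) x)"
      using v by (intro mult_left_mono C2) auto
    also have "\<dots> = ennreal (\<delta> / v * (C1 * C2)) * maximal lborel (\<lambda>y. ennreal (norm (inv_fourier h y))) x"
    proof -
      have "ennreal (\<delta> / v * C1 * C2) = ennreal (\<delta> / v * C1) * ennreal C2"
        by (rule ennreal_mult) (use v \<delta> C1(1) C2(1) in auto)
      then show ?thesis by (simp only: mult.assoc)
    qed
    finally show ?thesis .
  qed
  show ?thesis by (rule that[OF _ main]) (use C1 C2 in auto)
qed

lemma symb_exp_le: "0 < v \<Longrightarrow> symb \<xi> * exp (- v * symb \<xi>) \<le> 1 / v"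
proof -
  assume v: "0 < v"
  have "v * symb \<xi> \<le> exp (v * symb \<xi>)" using exp_ge_add_one_self[of "v * symb \<xi>"] by linarith
  then show ?thesis using v by (simp add: exp_minus field_simps)
qed

text \<open>The limit of the difference quotients is taken on the frequency side: they are all
  bounded by \<open>1 / v\<close>, so dominated convergence with majorant
  \<open>norm (h \<xi>) / v\<close> applies, and the maximal bound \<open>C / v\<close> is uniform
  along the sequence.\<close>

lemma heat_derivative_maximal_bound:
  obtains C where "0 \<le> C"
    "\<And>v h (x :: 'a::euclidean_space). 0 < v \<Longrightarrow> integrable lborel h \<Longrightarrow>
      ennreal (norm (inv_fourier (\<lambda>\<xi>. of_real (symb \<xi> * exp (- v * symb \<xi>)) * h \<xi>) x))
      \<le> ennreal (C / v) * maximal lborel (\<lambda>y. ennreal (norm (inv_fourier h y))) x"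
proof -
  obtain C where C: "0 \<le> C"
    "\<And>v \<delta> h (x :: 'a). 0 < v \<Longrightarrow> 0 < \<delta> \<Longrightarrow> \<delta> \<le> v \<Longrightarrow> integrable lborel h \<Longrightarrow>
      ennreal (norm (inv_fourier (\<lambda>\<xi>. of_real (exp (- v * symb \<xi>) - exp (- (v + \<delta>) * symb \<xi>)) * h \<xi>) x))
      \<le> ennreal (\<delta> / v * C) * maximal lborel (\<lambda>y. ennreal (norm (inv_fourier h y))) x"
    using heat_difference_maximal_bound by blast
  have main: "ennreal (norm (inv_fourier (\<lambda>\<xi>. of_real (symb \<xi> * exp (- v * symb \<xi>)) * h \<xi>) x))
      \<le> ennreal (C / v) * maximal lborel (\<lambda>y. ennreal (norm (inv_fourier h y))) x"
    if v: "0 < v" and h: "integrable lborel h" for v h and x :: 'a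
  proof -
    have [measurable]: "h \<in> borel_measurable borel" using borel_measurable_integrable[OF h] by simp
    define d where "d j = v / real (Suc j)" for j
    have d: "0 < d j" "d j \<le> v" for j using v by (auto simp: d_def field_simps)
    have d_nz: "d j \<noteq> 0" for j using d(1)[of j] by simp
    have d0: "d \<longlonglongrightarrow> 0"
      unfolding d_def using LIMSEQ_inverse_real_of_nat[THEN tendsto_mult_left, of v]
      by (simp add: divide_inverse)
    define m where "m j \<xi> = (exp (- v * symb \<xi>) - exp (- (v + d j) * symb \<xi>)) / d j" for j and \<xi> :: 'a
    have m_eq: "m j \<xi> = exp (- v * symb \<xi>) * ((1 - exp (- d j * symb \<xi>)) / d j)" for j \<xi>
      by (simp add: m_def exp_add[symmetric] algebra_simps diff_divide_distrib)
    have bound: "\<bar>m j \<xi>\<bar> \<le> 1 / v" for j \<xi>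
    proof -
      have "(1 - exp (- d j * symb \<xi>)) / d j \<le> symb \<xi>"
        using d[of j] exp_ge_add_one_self[of "- d j * symb \<xi>"] by (simp add: field_simps)
      then have "m j \<xi> \<le> exp (- v * symb \<xi>) * symb \<xi>"
        unfolding m_eq by (intro mult_left_mono) auto
      moreover have "0 \<le> m j \<xi>" unfolding m_eq using d[of j] by simp
      ultimately show ?thesis using symb_exp_le[OF v, of \<xi>] by (simp add: mult.commute)
    qed
    have lim: "(\<lambda>j. m j \<xi>) \<longlonglongrightarrow> symb \<xi> * exp (- v * symb \<xi>)" for \<xi>
    proof -
      have "((\<lambda>t. exp (- t * symb \<xi>)) has_real_derivative - symb \<xi>) (at 0)"
        by (auto intro!: derivative_eq_intros)
      then have "((\<lambda>t. (exp (- t * symb \<xi>) - 1) / t) \<longlongrightarrow> - symb \<xi>) (at 0)"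
        by (simp add: DERIV_def)
      then have "(\<lambda>j. (exp (- d j * symb \<xi>) - 1) / d j) \<longlonglongrightarrow> - symb \<xi>"
        by (rule tendsto_compose_filtermap[unfolded comp_def, THEN iffD2, OF _] | rule filterlim_compose)
          (use d d_nz d0 in \<open>auto simp: filterlim_at intro: always_eventually\<close>)
      then have "(\<lambda>j. - exp (- v * symb \<xi>) * ((exp (- d j * symb \<xi>) - 1) / d j)) \<longlonglongrightarrow> - exp (- v * symb \<xi>) * (- symb \<xi>)"
        by (rule tendsto_mult_left)
      moreover have "(\<lambda>j. m j \<xi>) = (\<lambda>j. - exp (- v * symb \<xi>) * ((exp (- d j * symb \<xi>) - 1) / d j))"
        by (simp add: m_eq fun_eq_iff diff_divide_distrib right_diff_distrib)
      ultimately show ?thesis by (simp add: mult.commute)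
    qed
    have le: "ennreal (norm (inv_fourier (\<lambda>\<xi>. of_real (m j \<xi>) * h \<xi>) x))
      \<le> ennreal (C / v) * maximal lborel (\<lambda>y. ennreal (norm (inv_fourier h y))) x" for j
    proof -
      have "inv_fourier (\<lambda>\<xi>. of_real (m j \<xi>) * h \<xi>) x
        = of_real (1 / d j) * inv_fourier (\<lambda>\<xi>. of_real (exp (- v * symb \<xi>) - exp (- (v + d j) * symb \<xi>)) * h \<xi>) x"
        unfolding inv_fourier_def m_def
        by (subst integral_mult_right_zero[symmetric]) (simp add: mult_ac divide_inverse)
      then have "ennreal (norm (inv_fourier (\<lambda>\<xi>. of_real (m j \<xi>) * h \<xi>) x))
        = ennreal (1 / d j) * ennreal (norm (inv_fourier (\<lambda>\<xi>. of_real (exp (- v * symb \<xi>) - exp (- (v + d j) * symb \<xi>)) * h \<xi>) x))"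
        using d[of j] by (simp add: norm_mult norm_divide ennreal_mult[symmetric] del: of_real_diff)
      also have "\<dots> \<le> ennreal (1 / d j) * (ennreal (d j / v * C) * maximal lborel (\<lambda>y. ennreal (norm (inv_fourier h y))) x)"
        by (intro mult_left_mono C v d h) auto
      also have "\<dots> = ennreal (C / v) * maximal lborel (\<lambda>y. ennreal (norm (inv_fourier h y))) x"
        using d[of j] v C(1) by (simp add: mult.assoc[symmetric] ennreal_mult[symmetric])
      finally show ?thesis .
    qed
    have "(\<lambda>j. inv_fourier (\<lambda>\<xi>. of_real (m j \<xi>) * h \<xi>) x) \<longlonglongrightarrow> inv_fourier (\<lambda>\<xi>. of_real (symb \<xi> * exp (- v * symb \<xi>)) * h \<xi>) x"
      unfolding inv_fourier_def
    proof (rule integral_dominated_convergence)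
      show "integrable lborel (\<lambda>\<xi>. 1 / v * norm (h \<xi>))" using h by simp
      show "AE \<xi> in lborel. norm (cis (2 * pi * (x \<bullet> \<xi>)) * (of_real (m j \<xi>) * h \<xi>)) \<le> 1 / v * norm (h \<xi>)" for j
        using mult_right_mono[OF bound norm_ge_zero, of j _ "h _"] by (auto simp: norm_mult)
      show "AE \<xi> in lborel. (\<lambda>j. cis (2 * pi * (x \<bullet> \<xi>)) * (of_real (m j \<xi>) * h \<xi>))
         \<longlonglongrightarrow> cis (2 * pi * (x \<bullet> \<xi>)) * (of_real (symb \<xi> * exp (- v * symb \<xi>)) * h \<xi>)"
        by (intro always_eventually allI tendsto_intros lim)
    qed (simp_all add: m_def)
    then have "(\<lambda>j. ennreal (norm (inv_fourier (\<lambda>\<xi>. of_real (m j \<xi>) * h \<xi>) x)))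
      \<longlonglongrightarrow> ennreal (norm (inv_fourier (\<lambda>\<xi>. of_real (symb \<xi> * exp (- v * symb \<xi>)) * h \<xi>) x))"
      by (intro tendsto_ennrealI tendsto_norm)
    then show ?thesis
      by (rule LIMSEQ_le_const2) (use le in blast)
  qed
  show ?thesis by (rule that[OF C(1) main])
qed

text \<open>The multiplier is bounded, so its powers times \<open>h\<close> are again integrable and
  the first-order bound applies to them in turn.\<close>

lemma heat_iterated_maximal_bound:
  obtains C where "0 \<le> C"
    "\<And>v h (x :: 'a::euclidean_space) k. 0 < v \<Longrightarrow> integrable lborel h \<Longrightarrow>
      ennreal (norm (inv_fourier (\<lambda>\<xi>. of_real ((symb \<xi> * exp (- v * symb \<xi>)) ^ k) * h \<xi>) x))
      \<le> ennreal ((C / v) ^ k) * (maximal lborel ^^ k) (\<lambda>y. ennreal (norm (inv_fourier h y))) x"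
proof -
  obtain C where C: "0 \<le> C"
    "\<And>v h (x :: 'a). 0 < v \<Longrightarrow> integrable lborel h \<Longrightarrow>
      ennreal (norm (inv_fourier (\<lambda>\<xi>. of_real (symb \<xi> * exp (- v * symb \<xi>)) * h \<xi>) x))
      \<le> ennreal (C / v) * maximal lborel (\<lambda>y. ennreal (norm (inv_fourier h y))) x"
    using heat_derivative_maximal_bound by blast
  have "ennreal (norm (inv_fourier (\<lambda>\<xi>. of_real ((symb \<xi> * exp (- v * symb \<xi>)) ^ k) * h \<xi>) x))
      \<le> ennreal ((C / v) ^ k) * (maximal lborel ^^ k) (\<lambda>y. ennreal (norm (inv_fourier h y))) x"
    if v: "0 < v" and h: "integrable lborel h" for v h and x :: 'a and k
  proof (induction k arbitrary: x)
    case (Suc k)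
    have [measurable]: "h \<in> borel_measurable borel" using borel_measurable_integrable[OF h] by simp
    let ?e = "\<lambda>\<xi>. symb \<xi> * exp (- v * symb \<xi>)"
    let ?I = "\<lambda>y. ennreal (norm (inv_fourier h y))"
    have int: "integrable lborel (\<lambda>\<xi>. of_real (?e \<xi> ^ k) * h \<xi>)"
    proof (rule integrable_bounded_mult[OF h])
      show "\<bar>?e \<xi> ^ k\<bar> \<le> (1 / v) ^ k" for \<xi> :: 'a
        using symb_exp_le[OF v, of \<xi>] by (auto simp: power_abs abs_mult intro!: power_mono)
    qed simp
    have "ennreal (norm (inv_fourier (\<lambda>\<xi>. of_real (?e \<xi> ^ Suc k) * h \<xi>) x))
      = ennreal (norm (inv_fourier (\<lambda>\<xi>. of_real (?e \<xi>) * (of_real (?e \<xi> ^ k) * h \<xi>)) x))"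
      by (simp add: mult.assoc)
    also have "\<dots> \<le> ennreal (C / v) * maximal lborel (\<lambda>y. ennreal (norm (inv_fourier (\<lambda>\<xi>. of_real (?e \<xi> ^ k) * h \<xi>) y))) x"
      by (rule C(2)[OF v int])
    also have "\<dots> \<le> ennreal (C / v) * maximal lborel (\<lambda>y. ennreal ((C / v) ^ k) * (maximal lborel ^^ k) ?I y) x"
      by (intro mult_left_mono maximal_mono Suc) auto
    also have "\<dots> = ennreal (C / v) * (ennreal ((C / v) ^ k) * maximal lborel ((maximal lborel ^^ k) ?I) x)"
      by (subst maximal_cmult) auto
    also have "\<dots> = ennreal ((C / v) ^ Suc k) * (maximal lborel ^^ Suc k) ?I x"
    proof -
      have "ennreal ((C / v) ^ Suc k) = ennreal (C / v) * ennreal ((C / v) ^ k)"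
        unfolding power_Suc by (rule ennreal_mult) (use C(1) v in auto)
      then show ?thesis by (simp add: mult.assoc)
    qed
    finally show ?case .
  qed simp
  then show ?thesis by (rule that[OF C(1)])
qed

subsection \<open>Subordination and the pointwise inequality\<close>

lemma nn_integral_exp_Gamma:
  fixes a z :: real
  assumes a: "0 < a" and z: "0 < z"
  shows "(\<integral>\<^sup>+v. ennreal (indicator {0<..} v * v powr (a - 1) * exp (- v * z)) \<partial>lborel)
    = ennreal (Gamma a * z powr (- a))"
proof -
  let ?f = "\<lambda>t::real. ennreal (indicator {0..} t * t powr (a - 1) / exp t)"
  let ?J = "\<integral>\<^sup>+v. ennreal (indicator {0<..} v * v powr (a - 1) * exp (- v * z)) \<partial>lborel"
  have "ennreal (Gamma a) = (\<integral>\<^sup>+t. ?f t \<partial>lborel)"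
    by (rule Gamma_conv_nn_integral_real[OF a])
  also have "\<dots> = ennreal \<bar>z\<bar> * (\<integral>\<^sup>+v. ?f (0 + z * v) \<partial>lborel)"
    using z by (intro nn_integral_real_affine) auto
  also have "(\<integral>\<^sup>+v. ?f (0 + z * v) \<partial>lborel)
    = (\<integral>\<^sup>+v. ennreal (z powr (a - 1)) * ennreal (indicator {0<..} v * v powr (a - 1) * exp (- v * z)) \<partial>lborel)"
  proof (intro nn_integral_cong_AE)
    show "AE v in lborel. ?f (0 + z * v)
      = ennreal (z powr (a - 1)) * ennreal (indicator {0<..} v * v powr (a - 1) * exp (- v * z))"
      using AE_lborel_singleton[of 0]
    proof eventually_elim
      case (elim v)
      then show ?case
        using z by (auto simp: indicator_def zero_le_mult_iff powr_mult exp_minus divide_inverse mult_ac ennreal_mult[symmetric])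
    qed
  qed
  also have "\<dots> = ennreal (z powr (a - 1)) * ?J"
    by (rule nn_integral_cmult) simp
  finally have "ennreal (z powr (- a)) * ennreal (Gamma a) = (ennreal (z powr (- a)) * (ennreal \<bar>z\<bar> * ennreal (z powr (a - 1)))) * ?J"
    by (simp add: mult.assoc)
  also have "ennreal (z powr (- a)) * (ennreal \<bar>z\<bar> * ennreal (z powr (a - 1))) = 1"
  proof -
    have "z powr (- a) * (z * z powr (a - 1)) = 1"
      using z by (simp add: powr_diff powr_minus)
    then show ?thesis using z by (simp add: ennreal_mult[symmetric])
  qed
  finally show ?thesis using a by (simp add: ennreal_mult[symmetric] Gamma_real_pos mult.commute less_imp_le)
qed

text \<open>The negative power is replaced by its Gamma integral, the order of integration is
  exchanged, and the norm is moved inside. The integrability hypothesis is what Fubini's theorem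
  asks for, because the absolute double integral equals \<open>Gamma a\<close> times the norm of the
  left multiplier.\<close>

lemma Gamma_subordination:
  fixes H :: "'a::euclidean_space \<Rightarrow> complex"
  assumes a: "0 < a" and [measurable]: "H \<in> borel_measurable borel"
    and int: "integrable lborel (\<lambda>\<xi>. of_real (symb \<xi> powr (- a)) * H \<xi>)"
  shows "ennreal (Gamma a * norm (inv_fourier (\<lambda>\<xi>. of_real (symb \<xi> powr (- a)) * H \<xi>) x))
    \<le> (\<integral>\<^sup>+v. ennreal (indicator {0<..} v * v powr (a - 1)) *
          ennreal (norm (inv_fourier (\<lambda>\<xi>. of_real (exp (- v * symb \<xi>)) * H \<xi>) x)) \<partial>lborel)"
proof -
  let ?w = "\<lambda>v::real. indicator {0<..} v * v powr (a - 1)"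
  have Gp: "0 < Gamma a" using a by (rule Gamma_real_pos)
  define f where "f \<xi> v = of_real (?w v * exp (- v * symb \<xi>)) * (cis (2 * pi * (x \<bullet> \<xi>)) * H \<xi>)" for \<xi> v
  have [measurable]: "case_prod f \<in> borel_measurable (lborel \<Otimes>\<^sub>M lborel)"
    unfolding f_def by simp
  \<comment> \<open>At the origin the exponential does not decay in \<open>v\<close> and the Gamma
    integral diverges.\<close>
  have nz: "AE \<xi> in lborel. (\<xi> :: 'a) \<noteq> 0" by (rule AE_lborel_singleton)
  have wnn: "0 \<le> ?w v * exp (- v * z)" for v z by (simp add: indicator_def)
  have fint: "integrable (lborel \<Otimes>\<^sub>M lborel) (case_prod f)"
  proof (rule integrableI_bounded)
    have "(\<integral>\<^sup>+p. ennreal (norm (case_prod f p)) \<partial>(lborel \<Otimes>\<^sub>M lborel))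
      = (\<integral>\<^sup>+\<xi>. (\<integral>\<^sup>+v. ennreal (norm (f \<xi> v)) \<partial>lborel) \<partial>lborel)"
      by (subst lborel.nn_integral_fst[symmetric]) auto
    also have "\<dots> = (\<integral>\<^sup>+\<xi>. ennreal (Gamma a) * ennreal (norm (of_real (symb \<xi> powr (- a)) * H \<xi>)) \<partial>lborel)"
      using nz
    proof (intro nn_integral_cong_AE, eventually_elim)
      fix \<xi> :: 'a assume "\<xi> \<noteq> 0"
      then have sp: "0 < symb \<xi>" by (rule symb_pos)
      have "(\<integral>\<^sup>+v. ennreal (norm (f \<xi> v)) \<partial>lborel)
        = (\<integral>\<^sup>+v. ennreal (?w v * exp (- v * symb \<xi>)) * ennreal (norm (H \<xi>)) \<partial>lborel)"
        unfolding f_def using wnn by (intro nn_integral_cong) (simp add: norm_mult ennreal_mult del: of_real_mult)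
      also have "\<dots> = ennreal (Gamma a * symb \<xi> powr (- a)) * ennreal (norm (H \<xi>))"
        by (subst nn_integral_multc) (simp_all add: nn_integral_exp_Gamma[OF a sp, simplified])
      also have "\<dots> = ennreal (Gamma a) * ennreal (norm (of_real (symb \<xi> powr (- a)) * H \<xi>))"
        using Gp by (simp add: norm_mult ennreal_mult mult.assoc)
      finally show "(\<integral>\<^sup>+v. ennreal (norm (f \<xi> v)) \<partial>lborel)
         = ennreal (Gamma a) * ennreal (norm (of_real (symb \<xi> powr (- a)) * H \<xi>))" .
    qed
    also have "\<dots> = ennreal (Gamma a) * (\<integral>\<^sup>+\<xi>. ennreal (norm (of_real (symb \<xi> powr (- a)) * H \<xi>)) \<partial>lborel)"
      by (rule nn_integral_cmult) simp
    also have "\<dots> < \<infinity>"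
      using int unfolding integrable_iff_bounded by (simp add: ennreal_mult_less_top)
    finally show "(\<integral>\<^sup>+p. ennreal (norm (case_prod f p)) \<partial>(lborel \<Otimes>\<^sub>M lborel)) < \<infinity>" .
  qed simp
  have inner_v: "AE \<xi> in lborel. (LINT v|lborel. f \<xi> v) = of_real (Gamma a) * (cis (2 * pi * (x \<bullet> \<xi>)) * (of_real (symb \<xi> powr (- a)) * H \<xi>))"
    using nz
  proof eventually_elim
    case (elim \<xi>)
    then have sp: "0 < symb \<xi>" by (rule symb_pos)
    have "(LINT v|lborel. ?w v * exp (- v * symb \<xi>)) = Gamma a * symb \<xi> powr (- a)"
      using Gp by (intro integral_eq_nn_integral[THEN trans])
        (auto simp: nn_integral_exp_Gamma[OF a sp, simplified] wnn)
    moreover have "(LINT v|lborel. f \<xi> v) = of_real (LINT v|lborel. ?w v * exp (- v * symb \<xi>)) * (cis (2 * pi * (x \<bullet> \<xi>)) * H \<xi>)"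
      unfolding f_def by (subst integral_mult_left_zero) (simp only: integral_complex_of_real)
    ultimately show ?case by (simp add: mult_ac)
  qed
  have inner_\<xi>: "(LINT \<xi>|lborel. f \<xi> v) = of_real (?w v) * inv_fourier (\<lambda>\<xi>. of_real (exp (- v * symb \<xi>)) * H \<xi>) x" for v
    unfolding f_def inv_fourier_def by (subst integral_mult_right_zero[symmetric]) (simp add: mult_ac)
  have "of_real (Gamma a) * inv_fourier (\<lambda>\<xi>. of_real (symb \<xi> powr (- a)) * H \<xi>) x
    = (LINT \<xi>|lborel. of_real (Gamma a) * (cis (2 * pi * (x \<bullet> \<xi>)) * (of_real (symb \<xi> powr (- a)) * H \<xi>)))"
    unfolding inv_fourier_def by simp
  also have "\<dots> = (LINT \<xi>|lborel. (LINT v|lborel. f \<xi> v))"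
    using inner_v by (intro integral_cong_AE) (auto elim: eventually_mono)
  also have "\<dots> = (LINT v|lborel. (LINT \<xi>|lborel. f \<xi> v))"
    by (rule lborel_pair.Fubini_integral[OF fint, symmetric])
  finally have "of_real (Gamma a) * inv_fourier (\<lambda>\<xi>. of_real (symb \<xi> powr (- a)) * H \<xi>) x
     = (LINT v|lborel. (LINT \<xi>|lborel. f \<xi> v))" .
  then have "Gamma a * norm (inv_fourier (\<lambda>\<xi>. of_real (symb \<xi> powr (- a)) * H \<xi>) x)
     = norm (LINT v|lborel. (LINT \<xi>|lborel. f \<xi> v))"
    using Gp by (metis abs_of_pos norm_mult norm_of_real)
  also have "ennreal \<dots> \<le> (\<integral>\<^sup>+v. ennreal (norm (LINT \<xi>|lborel. f \<xi> v)) \<partial>lborel)"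
    by (rule integral_norm_bound_ennreal) (rule lborel_pair.integrable_snd[OF fint])
  also have "\<dots> = (\<integral>\<^sup>+v. ennreal (?w v) * ennreal (norm (inv_fourier (\<lambda>\<xi>. of_real (exp (- v * symb \<xi>)) * H \<xi>) x)) \<partial>lborel)"
    unfolding inner_\<xi> by (intro nn_integral_cong) (simp add: norm_mult ennreal_mult[symmetric] indicator_def)
  finally show ?thesis .
qed

lemma nn_integral_powr_near_0:
  fixes \<alpha> U :: real
  assumes "0 < \<alpha>" "0 < U"
  shows "(\<integral>\<^sup>+v\<in>{0<..U}. ennreal (v powr (\<alpha> - 1)) \<partial>lborel) = ennreal (U powr \<alpha> / \<alpha>)"
proof -
  have "((\<lambda>x. x powr (\<alpha> - 1)) has_integral (U powr (\<alpha> - 1 + 1) / (\<alpha> - 1 + 1))) {0..U}"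
    using assms by (intro has_integral_powr_from_0) auto
  then have "((\<lambda>x. x powr (\<alpha> - 1) * indicator {0..U} x) has_integral U powr \<alpha> / \<alpha>) UNIV"
    by (subst (asm) has_integral_restrict_UNIV[symmetric]) (simp add: indicator_def of_bool_def if_distrib cong: if_cong)
  then have "(\<integral>\<^sup>+x. ennreal (x powr (\<alpha> - 1) * indicator {0..U} x) \<partial>lborel) = ennreal (U powr \<alpha> / \<alpha>)"
    by (intro nn_integral_has_integral_lborel) auto
  moreover have "(\<integral>\<^sup>+v\<in>{0<..U}. ennreal (v powr (\<alpha> - 1)) \<partial>lborel) = (\<integral>\<^sup>+x. ennreal (x powr (\<alpha> - 1) * indicator {0..U} x) \<partial>lborel)"
    by (intro nn_integral_cong) (auto simp: indicator_def)
  ultimately show ?thesis by simp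
qed

lemma nn_integral_powr_tail:
  fixes \<beta> U :: real
  assumes "0 < \<beta>" "0 < U"
  shows "(\<integral>\<^sup>+v\<in>{U<..}. ennreal (v powr (- \<beta> - 1)) \<partial>lborel) = ennreal (U powr (- \<beta>) / \<beta>)"
proof -
  have "((\<lambda>x. x powr (- \<beta> - 1)) has_integral (- (U powr (- \<beta> - 1 + 1)) / (- \<beta> - 1 + 1))) {U..}"
    using assms by (intro has_integral_powr_to_inf) auto
  then have "((\<lambda>x. x powr (- \<beta> - 1) * indicator {U..} x) has_integral U powr (- \<beta>) / \<beta>) UNIV"
    by (subst (asm) has_integral_restrict_UNIV[symmetric]) (simp add: indicator_def of_bool_def if_distrib cong: if_cong)
  then have "(\<integral>\<^sup>+x. ennreal (x powr (- \<beta> - 1) * indicator {U..} x) \<partial>lborel) = ennreal (U powr (- \<beta>) / \<beta>)"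
    by (intro nn_integral_has_integral_lborel) auto
  moreover have "(\<integral>\<^sup>+v\<in>{U<..}. ennreal (v powr (- \<beta> - 1)) \<partial>lborel) = (\<integral>\<^sup>+x. ennreal (x powr (- \<beta> - 1) * indicator {U..} x) \<partial>lborel)"
    using AE_lborel_singleton[of U] by (intro nn_integral_cong_AE) (auto elim!: eventually_mono simp: indicator_def)
  ultimately show ?thesis by simp
qed

text \<open>Splitting at \<open>U\<close> gives \<open>B * U powr \<alpha> / \<alpha> + A * U powr (- \<beta>) / \<beta>\<close>, and \<open>U = (A / B) powr (1 / (\<alpha> + \<beta>))\<close> balances the two terms.\<close>

lemma nn_integral_interpolate:
  fixes J :: "real \<Rightarrow> ennreal" and A B :: ennreal and \<alpha> \<beta> K :: real
  assumes "0 < \<alpha>" "0 < \<beta>" "0 < K"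
    and small: "\<And>u. 0 < u \<Longrightarrow> J u \<le> ennreal (K * u powr (\<alpha> - 1)) * B"
    and large: "\<And>u. 0 < u \<Longrightarrow> J u \<le> ennreal (K * u powr (- \<beta> - 1)) * A"
  shows "(\<integral>\<^sup>+u\<in>{0<..}. J u \<partial>lborel)
    \<le> ennreal (K * (1 / \<alpha> + 1 / \<beta>)) * (ennreal_powr A (\<alpha> / (\<alpha> + \<beta>)) * ennreal_powr B (\<beta> / (\<alpha> + \<beta>)))"
proof -
  have Kpos: "0 < K * (1 / \<alpha> + 1 / \<beta>)" using assms by (simp add: add_pos_pos)
  \<comment> \<open>\<open>A\<close> and \<open>B\<close> will be values of maximal functions. The
    balancing point exists only if both are positive and finite; if one vanishes so does
    \<open>J\<close>, and otherwise an infinite one makes the right side infinite.\<close>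
  consider "A = 0 \<or> B = 0" | "A \<noteq> 0" "B \<noteq> 0" "A = top \<or> B = top" | "A \<noteq> 0" "B \<noteq> 0" "A \<noteq> top" "B \<noteq> top"
    by blast
  then show ?thesis
  proof cases
    case 1
    have "(\<integral>\<^sup>+u\<in>{0<..}. J u \<partial>lborel) = (\<integral>\<^sup>+u. 0 \<partial>(lborel :: real measure))"
    proof (intro nn_integral_cong)
      show "J u * indicator {0<..} u = 0" for u
        using 1 small[of u] large[of u] by (auto simp: indicator_def)
    qed
    then show ?thesis by simp
  next
    case 2
    then have "ennreal (K * (1 / \<alpha> + 1 / \<beta>)) * (ennreal_powr A (\<alpha> / (\<alpha> + \<beta>)) * ennreal_powr B (\<beta> / (\<alpha> + \<beta>))) = top"
      using Kpos by (simp add: ennreal_mult_eq_top_iff ennreal_eq_0_iff not_le)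
    then show ?thesis by simp
  next
    case 3
    then obtain a b where ab: "A = ennreal a" "0 < a" "B = ennreal b" "0 < b"
      by (cases A; cases B) (auto simp: order.order_iff_strict)
    define U where "U = (a / b) powr (1 / (\<alpha> + \<beta>))"
    have U: "0 < U" using ab by (simp add: U_def)
    have "(\<integral>\<^sup>+u\<in>{0<..}. J u \<partial>lborel)
      \<le> (\<integral>\<^sup>+u. ennreal (K * b) * (ennreal (u powr (\<alpha> - 1)) * indicator {0<..U} u)
           + ennreal (K * a) * (ennreal (u powr (- \<beta> - 1)) * indicator {U<..} u) \<partial>lborel)"
    proof (intro nn_integral_mono)
      fix u
      have "J u \<le> ennreal (K * b) * ennreal (u powr (\<alpha> - 1))" "J u \<le> ennreal (K * a) * ennreal (u powr (- \<beta> - 1))" if "0 < u"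
        using small[OF that] large[OF that] ab assms by (simp_all add: ennreal_mult[symmetric] mult_ac)
      then show "J u * indicator {0<..} u \<le> ennreal (K * b) * (ennreal (u powr (\<alpha> - 1)) * indicator {0<..U} u)
           + ennreal (K * a) * (ennreal (u powr (- \<beta> - 1)) * indicator {U<..} u)"
        using U by (auto simp: indicator_def)
    qed
    also have "\<dots> = ennreal (K * b) * ennreal (U powr \<alpha> / \<alpha>) + ennreal (K * a) * ennreal (U powr (- \<beta>) / \<beta>)"
      using nn_integral_powr_near_0[OF assms(1) U] nn_integral_powr_tail[OF assms(2) U]
      by (subst nn_integral_add) (auto simp: nn_integral_cmult)
    also have "\<dots> = ennreal (K * (b * U powr \<alpha>) / \<alpha> + K * (a * U powr (- \<beta>)) / \<beta>)"
      using assms(1-3) ab U by (simp add: ennreal_mult[symmetric] ennreal_plus[symmetric] mult_ac del: ennreal_plus)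
    also have "b * U powr \<alpha> = a powr (\<alpha> / (\<alpha> + \<beta>)) * b powr (\<beta> / (\<alpha> + \<beta>))"
    proof -
      have e: "\<beta> / (\<alpha> + \<beta>) = 1 - \<alpha> / (\<alpha> + \<beta>)" using assms by (simp add: field_simps)
      show ?thesis
        unfolding U_def e using ab by (simp add: powr_powr powr_divide powr_diff)
    qed
    also have "a * U powr (- \<beta>) = a powr (\<alpha> / (\<alpha> + \<beta>)) * b powr (\<beta> / (\<alpha> + \<beta>))"
    proof -
      have e: "\<alpha> / (\<alpha> + \<beta>) = 1 - \<beta> / (\<alpha> + \<beta>)" using assms by (simp add: field_simps)
      show ?thesis
        unfolding U_def e using ab by (simp add: powr_powr powr_divide powr_diff powr_minus)
    qed
    also have "ennreal (K * (a powr (\<alpha> / (\<alpha> + \<beta>)) * b powr (\<beta> / (\<alpha> + \<beta>))) / \<alpha> + K * (a powr (\<alpha> / (\<alpha> + \<beta>)) * b powr (\<beta> / (\<alpha> + \<beta>))) / \<beta>)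
      = ennreal (K * (1 / \<alpha> + 1 / \<beta>) * (a powr (\<alpha> / (\<alpha> + \<beta>)) * b powr (\<beta> / (\<alpha> + \<beta>))))"
      by (simp add: distrib_left distrib_right)
    also have "\<dots> = ennreal (K * (1 / \<alpha> + 1 / \<beta>)) * (ennreal_powr A (\<alpha> / (\<alpha> + \<beta>)) * ennreal_powr B (\<beta> / (\<alpha> + \<beta>)))"
      using ab Kpos by (simp add: ennreal_powr_ennreal ennreal_mult less_imp_le)
    finally show ?thesis .
  qed
qed

lemma fractional_maximal_interpolation:
  fixes s t :: real
  assumes t: "0 < t" "t < s"
  obtains C k where "0 < C"
    "\<And>h (x :: 'a::euclidean_space). integrable lborel h \<Longrightarrow>
      integrable lborel (\<lambda>\<xi>. of_real (symb \<xi> powr (s / 2)) * h \<xi>) \<Longrightarrow>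
      ennreal (norm (inv_fourier (\<lambda>\<xi>. of_real (symb \<xi> powr (t / 2)) * h \<xi>) x))
      \<le> ennreal C * (ennreal_powr ((maximal lborel ^^ k) (\<lambda>y. ennreal (norm (inv_fourier h y))) x) (1 - t / s)
         * ennreal_powr ((maximal lborel ^^ k)
              (\<lambda>y. ennreal (norm (inv_fourier (\<lambda>\<xi>. of_real (symb \<xi> powr (s / 2)) * h \<xi>) y))) x) (t / s))"
proof -
  have s: "0 < s" using t by simp
  \<comment> \<open>The number of iterations makes \<open>v powr (s / 2 - 1 - k)\<close> integrable
    at infinity and also gives \<open>real k - t / 2 > 0\<close>.\<close>
  obtain k :: nat where k: "s / 2 < real k" using reals_Archimedean2 by blast
  have k0: "0 < k" using k s by (cases k) auto
  obtain C0 where C0: "0 \<le> C0"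
    "\<And>v h (x :: 'a) k. 0 < v \<Longrightarrow> integrable lborel h \<Longrightarrow>
      ennreal (norm (inv_fourier (\<lambda>\<xi>. of_real ((symb \<xi> * exp (- v * symb \<xi>)) ^ k) * h \<xi>) x))
      \<le> ennreal ((C0 / v) ^ k) * (maximal lborel ^^ k) (\<lambda>y. ennreal (norm (inv_fourier h y))) x"
    using heat_iterated_maximal_bound by blast
  \<comment> \<open>The exponential with time \<open>u\<close> is shared equally among
    \<open>k\<close> first-order factors of time \<open>u / k\<close>.\<close>
  define K1 where "K1 = (C0 * real k) ^ k"
  have K1: "0 \<le> K1" using C0(1) by (simp add: K1_def)
  let ?P = "\<lambda>u h (x :: 'a). inv_fourier (\<lambda>\<xi>. of_real (symb \<xi> ^ k * exp (- u * symb \<xi>)) * h \<xi>) x"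
  let ?M = "\<lambda>h. (maximal lborel ^^ k) (\<lambda>y. ennreal (norm (inv_fourier h y)))"
  have heat: "ennreal (norm (?P u h x)) \<le> ennreal (K1 * u powr - real k) * ?M h x"
    if u: "0 < u" and h: "integrable lborel h" for u h and x :: 'a
  proof -
    have "(symb \<xi> * exp (- (u / real k) * symb \<xi>)) ^ k = symb \<xi> ^ k * exp (- u * symb \<xi>)" for \<xi> :: 'a
      using k0 by (simp add: power_mult_distrib exp_of_nat_mult[symmetric])
    moreover have "(C0 / (u / real k)) ^ k = K1 * u powr - real k"
      using u by (simp add: K1_def power_divide powr_minus powr_realpow divide_inverse power_mult_distrib power_inverse)
    ultimately show ?thesis
      using C0(2)[of "u / real k" h k x] u h k0 by simp
  qed
  have G: "0 < Gamma (s / 2)" "0 < Gamma (real k - t / 2)"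
    using s k t by (auto intro!: Gamma_real_pos)
  \<comment> \<open>\<open>2 / s\<close> comes from the integral over \<open>v \<le> u\<close>,
    \<open>1 / (real k - s / 2)\<close> from the tail, and the Gamma factor from
    subordination.\<close>
  define K2 where "K2 = K1 * (2 / s + 1 / (real k - s / 2)) / Gamma (s / 2)"
  have K2: "0 \<le> K2" unfolding K2_def using K1 k s G by simp
  define K where "K = K1 + K2 + 1"
  have K: "0 < K" "K1 \<le> K" "K2 \<le> K" using K1 K2 by (auto simp: K_def)
  define C where "C = K * (1 / ((s - t) / 2) + 1 / (t / 2)) / Gamma (real k - t / 2)"
  have C: "0 < C" unfolding C_def using K(1) t G by (simp add: add_pos_pos)
  have main: "ennreal (norm (inv_fourier (\<lambda>\<xi>. of_real (symb \<xi> powr (t / 2)) * h \<xi>) x))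
      \<le> ennreal C * (ennreal_powr (?M h x) (1 - t / s)
         * ennreal_powr (?M (\<lambda>\<xi>. of_real (symb \<xi> powr (s / 2)) * h \<xi>) x) (t / s))"
    if h: "integrable lborel h" and hs: "integrable lborel (\<lambda>\<xi>. of_real (symb \<xi> powr (s / 2)) * h \<xi>)"
    for h and x :: 'a
  proof -
    have [measurable]: "h \<in> borel_measurable borel" using borel_measurable_integrable[OF h] by simp
    define g where "g = (\<lambda>\<xi>. of_real (symb \<xi> powr (s / 2)) * h \<xi>)"
    have g: "integrable lborel g" using hs by (simp add: g_def)
    have [measurable]: "g \<in> borel_measurable borel" by (simp add: g_def)
    define A where "A = ?M h x"
    define B where "B = ?M g x"
    have bounded_symb: "symb \<xi> ^ k * exp (- u * symb \<xi>) \<le> (real k / u) ^ k" if "0 < u" for u and \<xi> :: 'a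
    proof -
      have "symb \<xi> ^ k * exp (- u * symb \<xi>) = (symb \<xi> * exp (- (u / real k) * symb \<xi>)) ^ k"
        using k0 by (simp add: power_mult_distrib exp_of_nat_mult[symmetric])
      also have "\<dots> \<le> (1 / (u / real k)) ^ k"
        using that k0 by (intro power_mono symb_exp_le) auto
      finally show ?thesis using k0 by simp
    qed
    have Pint: "integrable lborel (\<lambda>\<xi>. of_real (symb \<xi> ^ k * exp (- u * symb \<xi>)) * h \<xi>)" if "0 < u" for u
      by (rule integrable_bounded_mult[OF h, of _ "(real k / u) ^ k"])
        (use bounded_symb[OF that] in \<open>auto simp: abs_mult\<close>)
    \<comment> \<open>Small times are controlled through \<open>g\<close>: multiplying
      \<open>H\<close> by the power \<open>- (s / 2)\<close> of the symbol undoes the passage from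
      \<open>h\<close> to \<open>g\<close>, and subordination expresses this by heat multipliers at
      the later times \<open>u + v\<close>.\<close>
    have second: "ennreal (norm (?P u h x)) \<le> ennreal (K2 * u powr (s / 2 - real k)) * B" if u: "0 < u" for u
    proof -
      define H where "H = (\<lambda>\<xi>. of_real (symb \<xi> ^ k * exp (- u * symb \<xi>)) * g \<xi>)"
      have [measurable]: "H \<in> borel_measurable borel" by (simp add: H_def)
      \<comment> \<open>The time \<open>u + v\<close> is replaced by \<open>u\<close> for
        \<open>v \<le> u\<close> and by \<open>v\<close> for \<open>v > u\<close>, so that only pure
        powers of \<open>v\<close> remain to be integrated.\<close>
      have heat_mono: "ennreal (norm (?P w g x)) \<le> ennreal (K1 * z powr - real k) * B" if z: "0 < z" "z \<le> w" for w z
      proof -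
        have "ennreal (norm (?P w g x)) \<le> ennreal (K1 * w powr - real k) * B"
          unfolding B_def using z by (intro heat g) auto
        also have "\<dots> \<le> ennreal (K1 * z powr - real k) * B"
          using z K1 by (intro mult_right_mono ennreal_leI mult_left_mono powr_mono2') auto
        finally show ?thesis .
      qed
      have e1: "(\<lambda>\<xi>. of_real (symb \<xi> powr (- (s / 2))) * H \<xi>) = (\<lambda>\<xi>. of_real (symb \<xi> ^ k * exp (- u * symb \<xi>)) * h \<xi>)"
      proof
        fix \<xi> :: 'a
        show "of_real (symb \<xi> powr (- (s / 2))) * H \<xi> = of_real (symb \<xi> ^ k * exp (- u * symb \<xi>)) * h \<xi>"
        \<comment> \<open>At the origin the powers of the symbol do not cancel, but both sides
          vanish because \<open>0 < k\<close>.\<close>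
        proof (cases "symb \<xi> = 0")
          case False
          then have "symb \<xi> powr (- (s / 2)) * symb \<xi> powr (s / 2) = 1"
            by (simp add: powr_minus)
          then have "complex_of_real (symb \<xi> powr (- (s / 2))) * of_real (symb \<xi> powr (s / 2)) = 1"
            by (metis of_real_1 of_real_mult)
          then show ?thesis unfolding H_def g_def by (simp add: mult_ac)
        qed (use k0 in \<open>simp add: H_def\<close>)
      qed
      have e2: "inv_fourier (\<lambda>\<xi>. of_real (exp (- v * symb \<xi>)) * H \<xi>) x = ?P (u + v) g x" for v
      proof -
        have "symb \<xi> ^ k * exp (- (u + v) * symb \<xi>) = exp (- v * symb \<xi>) * (symb \<xi> ^ k * exp (- u * symb \<xi>))" for \<xi> :: 'a
          by (simp add: mult.left_commute mult_exp_exp algebra_simps)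
        then show ?thesis unfolding H_def by (simp only: of_real_mult mult.assoc)
      qed
      have "ennreal (Gamma (s / 2) * norm (?P u h x)) \<le> (\<integral>\<^sup>+v. ennreal (indicator {0<..} v * v powr (s / 2 - 1)) *
          ennreal (norm (?P (u + v) g x)) \<partial>lborel)"
        using Gamma_subordination[of "s / 2" H x] s Pint[OF u] unfolding e1 e2 by simp
      also have "\<dots> \<le> (\<integral>\<^sup>+v. (ennreal (K1 * u powr - real k) * B) * (ennreal (v powr (s / 2 - 1)) * indicator {0<..u} v)
          + (ennreal K1 * B) * (ennreal (v powr (- (real k - s / 2) - 1)) * indicator {u<..} v) \<partial>lborel)"
      proof (intro nn_integral_mono)
        fix v :: real
        consider "v \<le> 0" | "0 < v" "v \<le> u" | "u < v" by linarith
        then show "ennreal (indicator {0<..} v * v powr (s / 2 - 1)) * ennreal (norm (?P (u + v) g x))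
          \<le> (ennreal (K1 * u powr - real k) * B) * (ennreal (v powr (s / 2 - 1)) * indicator {0<..u} v)
          + (ennreal K1 * B) * (ennreal (v powr (- (real k - s / 2) - 1)) * indicator {u<..} v)"
        proof cases
          case 2
          have "ennreal (norm (?P (u + v) g x)) \<le> ennreal (K1 * u powr - real k) * B"
            using 2 u by (intro heat_mono) auto
          then have "ennreal (v powr (s / 2 - 1)) * ennreal (norm (?P (u + v) g x))
            \<le> ennreal (v powr (s / 2 - 1)) * (ennreal (K1 * u powr - real k) * B)"
            by (intro mult_left_mono) auto
          then show ?thesis using 2 by (simp add: mult_ac)
        next
          case 3
          have "ennreal (norm (?P (u + v) g x)) \<le> ennreal (K1 * v powr - real k) * B"
            using 3 u by (intro heat_mono) auto
          then have "ennreal (v powr (s / 2 - 1)) * ennreal (norm (?P (u + v) g x))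
            \<le> ennreal (v powr (s / 2 - 1)) * (ennreal (K1 * v powr - real k) * B)"
            by (intro mult_left_mono) auto
          also have "\<dots> = (ennreal K1 * B) * ennreal (v powr (- (real k - s / 2) - 1))"
          proof -
            have "v powr (- (real k - s / 2) - 1) = v powr (s / 2 - 1) * v powr - real k"
              by (simp add: powr_add[symmetric] algebra_simps)
            then show ?thesis using K1 by (simp add: ennreal_mult mult_ac)
          qed
          finally show ?thesis using 3 u by simp
        qed simp
      qed
      also have "\<dots> = (ennreal (K1 * u powr - real k) * B) * ennreal (u powr (s / 2) / (s / 2))
          + (ennreal K1 * B) * ennreal (u powr (- (real k - s / 2)) / (real k - s / 2))"
        using nn_integral_powr_near_0[of "s / 2" u] nn_integral_powr_tail[of "real k - s / 2" u] s k u
        by (subst nn_integral_add) (auto simp: nn_integral_cmult simp del: minus_diff_eq)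
      also have "\<dots> = (ennreal (K1 * u powr - real k * (u powr (s / 2) / (s / 2)))
          + ennreal (K1 * (u powr (- (real k - s / 2)) / (real k - s / 2)))) * B"
        using K1 s k u by (subst (2 3) ennreal_mult) (auto simp: ring_distribs mult_ac)
      also have "\<dots> = ennreal (K1 * u powr - real k * (u powr (s / 2) / (s / 2))
          + K1 * (u powr (- (real k - s / 2)) / (real k - s / 2))) * B"
        using K1 s k u by (subst ennreal_plus) auto
      also have "K1 * u powr - real k * (u powr (s / 2) / (s / 2)) + K1 * (u powr (- (real k - s / 2)) / (real k - s / 2))
        = Gamma (s / 2) * (K2 * u powr (s / 2 - real k))"
      proof -
        have "u powr - real k * u powr (s / 2) = u powr (s / 2 - real k)"
          by (simp add: powr_add[symmetric])
        then have "K1 * u powr - real k * (u powr (s / 2) / (s / 2)) = K1 * u powr (s / 2 - real k) * (2 / s)"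
          by (metis (no_types, opaque_lifting) divide_divide_eq_right mult.assoc times_divide_eq_right)
        moreover have "K1 * (u powr (- (real k - s / 2)) / (real k - s / 2)) = K1 * u powr (s / 2 - real k) * (1 / (real k - s / 2))"
          by simp
        moreover have "Gamma (s / 2) * (K2 * u powr (s / 2 - real k)) = K1 * u powr (s / 2 - real k) * (2 / s + 1 / (real k - s / 2))"
          using G(1) by (simp add: K2_def)
        ultimately show ?thesis by (simp only: distrib_left)
      qed
      also have "ennreal (Gamma (s / 2) * (K2 * u powr (s / 2 - real k))) * B
        = ennreal (Gamma (s / 2)) * (ennreal (K2 * u powr (s / 2 - real k)) * B)"
        using G(1) K2 by (subst ennreal_mult) (auto simp: mult.assoc)
      finally have "ennreal (Gamma (s / 2)) * ennreal (norm (?P u h x))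
        \<le> ennreal (Gamma (s / 2)) * (ennreal (K2 * u powr (s / 2 - real k)) * B)"
        using G(1) by (simp add: ennreal_mult)
      then show ?thesis using G(1) by (subst (asm) ennreal_mult_le_mult_iff) (auto simp: ennreal_eq_0_iff)
    qed
    \<comment> \<open>Subordination yields only negative powers, so the positive power
      \<open>t / 2\<close> is written as \<open>k\<close> minus \<open>a\<close>.\<close>
    define a where "a = real k - t / 2"
    have a: "0 < a" using k t by (simp add: a_def)
    define H where "H = (\<lambda>\<xi>. of_real (symb \<xi> ^ k) * h \<xi>)"
    have [measurable]: "H \<in> borel_measurable borel" by (simp add: H_def)
    have e1: "(\<lambda>\<xi>. of_real (symb \<xi> powr (- a)) * H \<xi>) = (\<lambda>\<xi>. of_real (symb \<xi> powr (t / 2)) * h \<xi>)"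
    proof
      fix \<xi> :: 'a
      have "symb \<xi> powr (- a) * symb \<xi> ^ k = symb \<xi> powr (t / 2)"
      proof (cases "symb \<xi> = 0")
        case False
        then have "0 < symb \<xi>" using symb_nonneg[of \<xi>] by linarith
        then show ?thesis by (simp add: powr_realpow[symmetric] powr_add[symmetric] a_def)
      qed simp
      then show "of_real (symb \<xi> powr (- a)) * H \<xi> = of_real (symb \<xi> powr (t / 2)) * h \<xi>"
        unfolding H_def by (simp only: mult.assoc[symmetric] of_real_mult[symmetric])
    qed
    have e2: "inv_fourier (\<lambda>\<xi>. of_real (exp (- u * symb \<xi>)) * H \<xi>) x = ?P u h x" for u
      unfolding H_def by (simp add: mult_ac)
    have tint: "integrable lborel (\<lambda>\<xi>. of_real (symb \<xi> powr (t / 2)) * h \<xi>)"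
    proof (rule Bochner_Integration.integrable_bound)
      show "integrable lborel (\<lambda>\<xi>. norm (h \<xi>) + norm (g \<xi>))" using h g by simp
      have "symb \<xi> powr (t / 2) \<le> 1 + symb \<xi> powr (s / 2)" for \<xi> :: 'a
      proof (cases "symb \<xi> \<le> 1")
        case True
        then have "symb \<xi> powr (t / 2) \<le> 1" using t by (intro powr_le1) auto
        then show ?thesis by (simp add: add_increasing2)
      next
        case False
        then have "symb \<xi> powr (t / 2) \<le> symb \<xi> powr (s / 2)" using t by (intro powr_mono) auto
        then show ?thesis by simp
      qed
      then have "symb \<xi> powr (t / 2) * norm (h \<xi>) \<le> norm (h \<xi>) + norm (g \<xi>)" for \<xi> :: 'a
        using mult_right_mono[of "symb \<xi> powr (t / 2)" "1 + symb \<xi> powr (s / 2)" "norm (h \<xi>)"]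
        by (simp add: g_def norm_mult distrib_right)
      then show "AE \<xi> in lborel. norm (of_real (symb \<xi> powr (t / 2)) * h \<xi>) \<le> norm (norm (h \<xi>) + norm (g \<xi>))"
        by (auto simp: norm_mult)
    qed simp
    define J where "J u = ennreal (u powr (a - 1)) * ennreal (norm (?P u h x))" for u
    have "ennreal (Gamma a * norm (inv_fourier (\<lambda>\<xi>. of_real (symb \<xi> powr (t / 2)) * h \<xi>) x))
      \<le> (\<integral>\<^sup>+u. ennreal (indicator {0<..} u * u powr (a - 1)) * ennreal (norm (?P u h x)) \<partial>lborel)"
      using Gamma_subordination[of a H x] a tint unfolding e1 e2 by simp
    also have "\<dots> = (\<integral>\<^sup>+u\<in>{0<..}. J u \<partial>lborel)"
      by (intro nn_integral_cong) (auto simp: J_def indicator_def)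
    \<comment> \<open>The weight \<open>u powr (a - 1)\<close> times the bounds
      \<open>u powr (s / 2 - k)\<close> and \<open>u powr (- k)\<close> gives the exponents
      \<open>(s - t) / 2 - 1\<close> and \<open>- (t / 2) - 1\<close>. Their distance
      \<open>s / 2\<close> produces the fractions \<open>1 - t / s\<close> and
      \<open>t / s\<close>.\<close>
    also have "\<dots> \<le> ennreal (K * (1 / ((s - t) / 2) + 1 / (t / 2))) *
       (ennreal_powr A (((s - t) / 2) / ((s - t) / 2 + t / 2)) * ennreal_powr B ((t / 2) / ((s - t) / 2 + t / 2)))"
    proof (rule nn_integral_interpolate)
      show "J u \<le> ennreal (K * u powr ((s - t) / 2 - 1)) * B" if u: "0 < u" for u
      proof -
        have "J u \<le> ennreal (u powr (a - 1)) * (ennreal (K2 * u powr (s / 2 - real k)) * B)"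
          unfolding J_def by (intro mult_left_mono second u) auto
        also have "\<dots> = ennreal (u powr (a - 1) * (K2 * u powr (s / 2 - real k))) * B"
          using K2 by (subst (2) ennreal_mult) (auto simp: mult.assoc)
        also have "u powr (a - 1) * (K2 * u powr (s / 2 - real k)) = K2 * u powr ((s - t) / 2 - 1)"
        proof -
          have e: "(s - t) / 2 - 1 = (a - 1) + (s / 2 - real k)" by (simp add: a_def diff_divide_distrib)
          show ?thesis unfolding e powr_add by (simp add: mult_ac)
        qed
        also have "ennreal (K2 * u powr ((s - t) / 2 - 1)) * B \<le> ennreal (K * u powr ((s - t) / 2 - 1)) * B"
          using K by (intro mult_right_mono ennreal_leI) auto
        finally show ?thesis .
      qed
      show "J u \<le> ennreal (K * u powr (- (t / 2) - 1)) * A" if u: "0 < u" for u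
      proof -
        have "J u \<le> ennreal (u powr (a - 1)) * (ennreal (K1 * u powr - real k) * A)"
          unfolding J_def A_def by (intro mult_left_mono heat u h) auto
        also have "\<dots> = ennreal (u powr (a - 1) * (K1 * u powr - real k)) * A"
          using K1 by (subst (2) ennreal_mult) (auto simp: mult.assoc)
        also have "u powr (a - 1) * (K1 * u powr - real k) = K1 * u powr (- (t / 2) - 1)"
        proof -
          have e: "- (t / 2) - 1 = (a - 1) + - real k" by (simp add: a_def)
          show ?thesis unfolding e powr_add by (simp add: mult_ac)
        qed
        also have "ennreal (K1 * u powr (- (t / 2) - 1)) * A \<le> ennreal (K * u powr (- (t / 2) - 1)) * A"
          using K by (intro mult_right_mono ennreal_leI) auto
        finally show ?thesis .
      qed
    qed (use t K in auto)
    also have "((s - t) / 2) / ((s - t) / 2 + t / 2) = 1 - t / s" using s by (simp add: field_simps)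
    also have "(t / 2) / ((s - t) / 2 + t / 2) = t / s" using s by (simp add: field_simps)
    also have "K * (1 / ((s - t) / 2) + 1 / (t / 2)) = Gamma a * C"
      using G(2) by (simp add: C_def a_def)
    finally have "ennreal (Gamma a) * ennreal (norm (inv_fourier (\<lambda>\<xi>. of_real (symb \<xi> powr (t / 2)) * h \<xi>) x))
      \<le> ennreal (Gamma a) * (ennreal C * (ennreal_powr A (1 - t / s) * ennreal_powr B (t / s)))"
      using G(2) C by (simp add: ennreal_mult a_def mult.assoc less_imp_le)
    then show ?thesis
      using G(2) unfolding A_def B_def g_def
      by (subst (asm) ennreal_mult_le_mult_iff) (auto simp: ennreal_eq_0_iff a_def)
  qed
  show ?thesis by (rule that[OF C main])
qed

subsection \<open>Fourier transforms of Schwartz functions\<close>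

text \<open>Only size is recorded, no derivatives, so that the class is stable under multiplication
  by \<open>norm \<xi> powr s\<close>, which need not be smooth at the origin.\<close>

definition rapidly_decreasing :: "('a::euclidean_space \<Rightarrow> complex) \<Rightarrow> bool" where
  "rapidly_decreasing g \<longleftrightarrow> g \<in> borel_measurable borel \<and> (\<forall>k. \<exists>M. \<forall>x. norm x ^ k * norm (g x) \<le> M)"

lemma rapidly_decreasing_bump:
  assumes "rapidly_decreasing (g :: 'a::euclidean_space \<Rightarrow> complex)"
  obtains C where "0 \<le> C" "\<And>x. norm (g x) \<le> C * bump 1 x"
proof -
  let ?N = "DIM('a) + 1"
  obtain M0 where M0: "\<And>x. norm x ^ 0 * norm (g x) \<le> M0"
    using assms unfolding rapidly_decreasing_def by blast
  obtain M1 where M1: "\<And>x. norm x ^ (2 * ?N) * norm (g x) \<le> M1"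
    using assms unfolding rapidly_decreasing_def by blast
  have bound: "norm (g x) \<le> (2 ^ ?N * (M0 + M1)) * bump 1 x" for x
  proof -
    have "(1 + (norm x)\<^sup>2) ^ ?N \<le> 2 ^ ?N * (1 + norm x ^ (2 * ?N))"
    proof (cases "norm x \<le> 1")
      case True
      then have "(norm x)\<^sup>2 \<le> 1" by (simp add: power_le_one)
      then have "(1 + (norm x)\<^sup>2) ^ ?N \<le> 2 ^ ?N" by (intro power_mono) auto
      also have "\<dots> \<le> 2 ^ ?N * (1 + norm x ^ (2 * ?N))" by simp
      finally show ?thesis .
    next
      case False
      then have "1 \<le> (norm x)\<^sup>2" by simp
      then have "(1 + (norm x)\<^sup>2) ^ ?N \<le> (2 * (norm x)\<^sup>2) ^ ?N" by (intro power_mono) auto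
      also have "\<dots> = 2 ^ ?N * norm x ^ (2 * ?N)" by (simp only: power_mult_distrib power_mult)
      also have "\<dots> \<le> 2 ^ ?N * (1 + norm x ^ (2 * ?N))" by simp
      finally show ?thesis .
    qed
    then have "(1 + (norm x)\<^sup>2) ^ ?N * norm (g x) \<le> 2 ^ ?N * (1 + norm x ^ (2 * ?N)) * norm (g x)"
      by (rule mult_right_mono) simp
    also have "\<dots> = 2 ^ ?N * (norm x ^ 0 * norm (g x) + norm x ^ (2 * ?N) * norm (g x))"
      by (simp add: algebra_simps)
    also have "\<dots> \<le> 2 ^ ?N * (M0 + M1)"
      by (intro mult_left_mono add_mono M0 M1) auto
    finally have "(1 + (norm x)\<^sup>2) ^ ?N * norm (g x) \<le> 2 ^ ?N * (M0 + M1)" .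
    moreover have "0 < (1 + (norm x)\<^sup>2) ^ ?N" by (simp add: add_pos_nonneg)
    ultimately show ?thesis
      by (simp add: bump_def pos_le_divide_eq mult.commute del: power_Suc)
  qed
  have "0 \<le> M0" "0 \<le> M1"
    using M0[of 0] M1[of 0] norm_ge_zero[of "g 0"] by (auto intro: order.trans[OF _ M0[of 0]])
  then show ?thesis by (intro that[OF _ bound]) auto
qed

lemma rapidly_decreasing_integrable:
  assumes g: "rapidly_decreasing (g :: 'a::euclidean_space \<Rightarrow> complex)"
  shows "integrable lborel g"
proof -
  obtain C where C: "0 \<le> C" "\<And>x. norm (g x) \<le> C * bump 1 x"
    using rapidly_decreasing_bump[OF g] by blast
  show ?thesis
  proof (rule Bochner_Integration.integrable_bound)
    show "integrable lborel (\<lambda>x. C * bump 1 (x :: 'a))"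
      by (intro integrable_mult_right integrable_bump) simp
    show "g \<in> borel_measurable lborel" using g by (simp add: rapidly_decreasing_def)
    show "AE x in lborel. norm (g x) \<le> norm (C * bump 1 x)"
      using C(2) by (intro always_eventually allI order.trans[OF C(2)]) simp
  qed
qed

lemma rapidly_decreasing_powr:
  fixes g :: "'a::euclidean_space \<Rightarrow> complex"
  assumes g: "rapidly_decreasing g" and s: "0 < s"
  shows "rapidly_decreasing (\<lambda>\<xi>. of_real (norm \<xi> powr s) * g \<xi>)"
  unfolding rapidly_decreasing_def
proof (intro conjI allI)
  have [measurable]: "g \<in> borel_measurable borel" using g by (simp add: rapidly_decreasing_def)
  show "(\<lambda>\<xi>. of_real (norm \<xi> powr s) * g \<xi>) \<in> borel_measurable borel" by simp
  fix k
  obtain m :: nat where m: "s < real m" using reals_Archimedean2 by blast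
  obtain M0 where M0: "\<And>x. norm x ^ k * norm (g x) \<le> M0"
    using g unfolding rapidly_decreasing_def by blast
  obtain M1 where M1: "\<And>x. norm x ^ (k + m) * norm (g x) \<le> M1"
    using g unfolding rapidly_decreasing_def by blast
  show "\<exists>M. \<forall>x. norm x ^ k * norm (of_real (norm x powr s) * g x) \<le> M"
  proof (intro exI allI)
    fix x :: 'a
    have "norm x powr s \<le> 1 + norm x ^ m"
    proof (cases "norm x \<le> 1")
      case True
      then show ?thesis using powr_le1[of s "norm x"] s by (simp add: add_increasing2)
    next
      case False
      then have "norm x powr s \<le> norm x powr real m" using m by (intro powr_mono) auto
      moreover have "0 < norm x" using False by linarith
      ultimately have "norm x powr s \<le> norm x ^ m" by (simp add: powr_realpow)
      then show ?thesis by simp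
    qed
    then have "norm x ^ k * norm (g x) * norm x powr s \<le> norm x ^ k * norm (g x) * (1 + norm x ^ m)"
      by (intro mult_left_mono) auto
    also have "\<dots> = norm x ^ k * norm (g x) + norm x ^ (k + m) * norm (g x)"
      by (simp add: algebra_simps power_add)
    also have "\<dots> \<le> M0 + M1" by (intro add_mono M0 M1)
    finally show "norm x ^ k * norm (of_real (norm x powr s) * g x) \<le> M0 + M1"
      by (simp add: norm_mult mult_ac)
  qed
qed

section \<open>Translations, derivatives and decay on the Fourier side\<close>

lemma fourier_eq_inv_fourier: "fourier f \<xi> = inv_fourier f (- \<xi>)"
  by (simp add: fourier_def inv_fourier_def inner_commute)

lemma borel_measurable_fourier [measurable]:
  assumes "f \<in> borel_measurable borel"
  shows "fourier f \<in> borel_measurable (borel :: 'a::euclidean_space measure)"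
proof -
  have [measurable]: "inv_fourier f \<in> borel_measurable (borel :: 'a measure)"
    using assms by (rule borel_measurable_inv_fourier)
  have "fourier f = (\<lambda>\<xi>. inv_fourier f (- \<xi>))"
    by (simp add: fun_eq_iff fourier_eq_inv_fourier)
  then show ?thesis by simp
qed

lemma norm_fourier_le: "norm (fourier f \<xi>) \<le> (LINT x|lborel. norm (f x))"
  by (simp add: fourier_eq_inv_fourier norm_inv_fourier_le)

lemma lborel_integral_translate:
  fixes f :: "'a::euclidean_space \<Rightarrow> 'b::{banach, second_countable_topology}"
  assumes [measurable]: "f \<in> borel_measurable borel"
  shows "(LINT y|lborel. f (a + y)) = (LINT y|lborel. f y)"
proof -
  have "(LINT y|lborel. f y) = (LINT y|distr lborel borel ((+) a). f y)"
    by (simp add: lborel_distr_plus)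
  also have "\<dots> = (LINT y|lborel. f (a + y))" by (rule integral_distr) auto
  finally show ?thesis ..
qed

lemma fourier_translate:
  fixes f :: "'a::euclidean_space \<Rightarrow> complex"
  assumes [measurable]: "f \<in> borel_measurable borel"
  shows "fourier (\<lambda>x. f (a + x)) \<xi> = cis (2 * pi * (a \<bullet> \<xi>)) * fourier f \<xi>"
proof -
  have "fourier (\<lambda>x. f (a + x)) \<xi> = (LINT x|lborel. cis (2 * pi * (a \<bullet> \<xi>)) * (cis (- (2 * pi * ((a + x) \<bullet> \<xi>))) * f (a + x)))"
    unfolding fourier_def
  proof (intro Bochner_Integration.integral_cong refl)
    fix x
    have "cis (- (2 * pi * (x \<bullet> \<xi>))) = cis (2 * pi * (a \<bullet> \<xi>)) * cis (- (2 * pi * ((a + x) \<bullet> \<xi>)))"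
      by (simp add: cis_mult inner_add_left distrib_left)
    then show "cis (- (2 * pi * (x \<bullet> \<xi>))) * f (a + x)
      = cis (2 * pi * (a \<bullet> \<xi>)) * (cis (- (2 * pi * ((a + x) \<bullet> \<xi>))) * f (a + x))"
      by (metis mult.assoc)
  qed
  also have "\<dots> = cis (2 * pi * (a \<bullet> \<xi>)) * (LINT x|lborel. cis (- (2 * pi * ((a + x) \<bullet> \<xi>))) * f (a + x))"
    by (rule integral_mult_right_zero)
  also have "(LINT x|lborel. cis (- (2 * pi * ((a + x) \<bullet> \<xi>))) * f (a + x)) = fourier f \<xi>"
    unfolding fourier_def by (rule lborel_integral_translate) simp
  finally show ?thesis .
qed

text \<open>Difference quotients of step at most 1 see the derivative along a segment of length at
  most 1; this comparison gives one majorant for the whole segment.\<close>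

lemma bump_comparable:
  assumes "norm (x - y) \<le> 1"
  shows "bump 1 (y :: 'a::euclidean_space) \<le> 3 ^ (DIM('a) + 1) * bump 1 x"
proof -
  have "norm x \<le> norm y + 1" using assms norm_triangle_sub[of x y] by simp
  then have "(norm x)\<^sup>2 \<le> (norm y + 1)\<^sup>2" by (intro power_mono) auto
  also have "\<dots> \<le> 2 * (norm y)\<^sup>2 + 2"
    using zero_le_power2[of "norm y - 1"] by (simp add: power2_eq_square algebra_simps)
  finally have "1 + (norm x)\<^sup>2 \<le> 3 * (1 + (norm y)\<^sup>2)"
    using zero_le_power2[of "norm y"] by argo
  then have "(1 + (norm x)\<^sup>2) ^ (DIM('a) + 1) \<le> 3 ^ (DIM('a) + 1) * (1 + (norm y)\<^sup>2) ^ (DIM('a) + 1)"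
    unfolding power_mult_distrib[symmetric] by (intro power_mono) auto
  moreover have "0 < (1 + (norm x)\<^sup>2) ^ (DIM('a) + 1)" "0 < (1 + (norm y)\<^sup>2) ^ (DIM('a) + 1)"
    by (simp_all add: add_pos_nonneg)
  ultimately show ?thesis
    by (simp add: bump_def divide_simps del: power_Suc)
qed

lemma has_vector_derivative_quotient:
  fixes \<phi> :: "real \<Rightarrow> 'b::real_normed_vector"
  assumes "(\<phi> has_vector_derivative D) (at 0)"
  shows "((\<lambda>s. (\<phi> s - \<phi> 0) /\<^sub>R s) \<longlongrightarrow> D) (at 0)"
proof -
  have "((\<lambda>h. norm (\<phi> (0 + h) - \<phi> 0 - h *\<^sub>R D) / norm h) \<longlongrightarrow> 0) (at 0)"
    using assms unfolding has_vector_derivative_def has_derivative_at by blast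
  moreover have "\<forall>\<^sub>F h in at 0. norm (\<phi> (0 + h) - \<phi> 0 - h *\<^sub>R D) / norm h = norm ((\<phi> h - \<phi> 0) /\<^sub>R h - D)"
    unfolding eventually_at_filter
  proof (intro always_eventually allI impI)
    fix h :: real assume "h \<noteq> 0"
    then have "(\<phi> h - \<phi> 0) /\<^sub>R h - D = (\<phi> (0 + h) - \<phi> 0 - h *\<^sub>R D) /\<^sub>R h"
      by (simp add: scaleR_diff_right)
    then show "norm (\<phi> (0 + h) - \<phi> 0 - h *\<^sub>R D) / norm h = norm ((\<phi> h - \<phi> 0) /\<^sub>R h - D)"
      by (simp add: divide_inverse mult.commute)
  qed
  ultimately have "((\<lambda>h. norm ((\<phi> h - \<phi> 0) /\<^sub>R h - D)) \<longlongrightarrow> 0) (at 0)"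
    by (rule Lim_transform_eventually)
  then have "((\<lambda>h. (\<phi> h - \<phi> 0) /\<^sub>R h - D) \<longlongrightarrow> 0) (at 0)"
    by (rule tendsto_norm_zero_cancel)
  then show ?thesis by (rule LIM_zero_cancel)
qed

text \<open>The difference quotients of \<open>g\<close> in direction \<open>b\<close> are dominated by a multiple of \<open>bump 1\<close>, so the
  transform of the derivative is the limit of their transforms; no integration by parts is needed.\<close>

lemma fourier_pderiv:
  fixes g g' :: "'a::euclidean_space \<Rightarrow> complex"
  assumes g: "rapidly_decreasing g" and g': "rapidly_decreasing g'" and b: "norm b = 1"
    and der: "\<And>x. ((\<lambda>s::real. g (x + s *\<^sub>R b)) has_vector_derivative g' x) (at 0)"
  shows "fourier g' \<xi> = 2 * pi * \<i> * (\<xi> \<bullet> b) * fourier g \<xi>"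
proof -
  have [measurable]: "g \<in> borel_measurable borel" "g' \<in> borel_measurable borel"
    using g g' by (simp_all add: rapidly_decreasing_def)
  obtain C where C: "0 \<le> C" "\<And>x. norm (g' x) \<le> C * bump 1 x"
    using rapidly_decreasing_bump[OF g'] by blast
  define d where "d j = inverse (real (Suc j))" for j
  have d: "0 < d j" "d j \<le> 1" for j by (auto simp: d_def field_simps)
  have d_nz: "d j \<noteq> 0" for j using d(1)[of j] by simp
  have d0: "d \<longlonglongrightarrow> 0" unfolding d_def by (rule LIMSEQ_inverse_real_of_nat)
  have d_at: "filterlim d (at 0) sequentially"
    using d_nz d0 by (auto simp: filterlim_at)
  \<comment> \<open>Moving the base point along the line turns the hypothesis at parameter 0 into
    differentiability at every parameter, as the mean value inequality requires.\<close>
  have der': "((\<lambda>s::real. g (x + s *\<^sub>R b)) has_vector_derivative g' (x + s *\<^sub>R b)) (at s)" for x s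
  proof -
    have "((\<lambda>u. g (x + s *\<^sub>R b + (u - s) *\<^sub>R b)) has_vector_derivative (1 *\<^sub>R g' (x + s *\<^sub>R b))) (at s)"
      by (rule vector_diff_chain_at[unfolded comp_def, where f = "\<lambda>u. u - s" and g = "\<lambda>u. g (x + s *\<^sub>R b + u *\<^sub>R b)"])
        (auto intro!: derivative_eq_intros der)
    then show ?thesis by (simp add: algebra_simps)
  qed
  define q where "q j x = (g (d j *\<^sub>R b + x) - g x) / d j" for j x
  have [measurable]: "q j \<in> borel_measurable borel" for j unfolding q_def by measurable
  have q_bound: "norm (q j x) \<le> C * 3 ^ (DIM('a) + 1) * bump 1 x" for j x
  proof -
    let ?B = "C * 3 ^ (DIM('a) + 1) * bump 1 x"
    have "norm (g (x + d j *\<^sub>R b) - g (x + 0 *\<^sub>R b)) \<le> ?B * norm (d j - 0)"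
    proof (rule differentiable_bound[where S = "{0..1}" and f' = "\<lambda>s h. h *\<^sub>R g' (x + s *\<^sub>R b)"])
      show "((\<lambda>s. g (x + s *\<^sub>R b)) has_derivative (\<lambda>h. h *\<^sub>R g' (x + s *\<^sub>R b))) (at s within {0..1})" for s
        using der'[of x s] unfolding has_vector_derivative_def by (rule has_derivative_at_withinI)
      show "onorm (\<lambda>h. h *\<^sub>R g' (x + s *\<^sub>R b)) \<le> ?B" if "s \<in> {0..1}" for s
      proof (rule onorm_bound)
        show "0 \<le> ?B" using C(1) bump_nonneg[of 1 x] by simp
        have "norm (g' (x + s *\<^sub>R b)) \<le> C * bump 1 (x + s *\<^sub>R b)" by (rule C)
        also have "\<dots> \<le> C * (3 ^ (DIM('a) + 1) * bump 1 x)"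
          using that b C(1) by (intro mult_left_mono bump_comparable) auto
        finally have *: "norm (g' (x + s *\<^sub>R b)) \<le> ?B" by (simp add: mult.assoc)
        show "norm (h *\<^sub>R g' (x + s *\<^sub>R b)) \<le> ?B * norm h" for h :: real
          using mult_left_mono[OF *, of "\<bar>h\<bar>"] by (simp add: mult.commute)
      qed
    qed (use d[of j] in auto)
    then show ?thesis
      using d[of j] by (simp add: q_def norm_divide pos_divide_le_eq add.commute)
  qed
  have q_lim: "(\<lambda>j. q j x) \<longlonglongrightarrow> g' x" for x
  proof -
    have "(\<lambda>j. (g (x + d j *\<^sub>R b) - g (x + 0 *\<^sub>R b)) /\<^sub>R d j) \<longlonglongrightarrow> g' x"
      by (rule filterlim_compose[OF has_vector_derivative_quotient[OF der[of x]] d_at])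
    then show ?thesis by (simp add: q_def scaleR_conv_of_real divide_inverse add.commute mult.commute)
  qed
  have "(\<lambda>j. fourier (q j) \<xi>) \<longlonglongrightarrow> fourier g' \<xi>"
    unfolding fourier_def
  proof (rule integral_dominated_convergence)
    show "integrable lborel (\<lambda>x. C * 3 ^ (DIM('a) + 1) * bump 1 (x :: 'a))"
      by (intro integrable_mult_right integrable_bump) simp
    show "AE x in lborel. norm (cis (- (2 * pi * (x \<bullet> \<xi>))) * q j x) \<le> C * 3 ^ (DIM('a) + 1) * bump 1 x" for j
      using q_bound by simp
    show "AE x in lborel. (\<lambda>j. cis (- (2 * pi * (x \<bullet> \<xi>))) * q j x) \<longlonglongrightarrow> cis (- (2 * pi * (x \<bullet> \<xi>))) * g' x"
      by (intro always_eventually allI tendsto_mult_left q_lim)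
  qed simp_all
  \<comment> \<open>Translation becomes multiplication by a character, so the quotient of
    \<open>g\<close> passes to the quotient of that character at 0.\<close>
  moreover have "fourier (q j) \<xi> = (cis (2 * pi * (d j * (b \<bullet> \<xi>))) - 1) / d j * fourier g \<xi>" for j
  proof -
    have gi: "integrable lborel g" by (rule rapidly_decreasing_integrable[OF g])
    have "integrable (distr lborel borel ((+) (d j *\<^sub>R b))) g" using gi by (simp add: lborel_distr_plus)
    then have gi': "integrable lborel (\<lambda>x. g (d j *\<^sub>R b + x))" by (subst (asm) integrable_distr_eq) auto
    have "fourier (q j) \<xi> = (LINT x|lborel. (cis (- (2 * pi * (x \<bullet> \<xi>))) * g (d j *\<^sub>R b + x) - cis (- (2 * pi * (x \<bullet> \<xi>))) * g x) / d j)"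
      unfolding fourier_def q_def by (simp add: right_diff_distrib)
    also have "\<dots> = (LINT x|lborel. cis (- (2 * pi * (x \<bullet> \<xi>))) * g (d j *\<^sub>R b + x) - cis (- (2 * pi * (x \<bullet> \<xi>))) * g x) / d j"
      by (rule integral_divide_zero)
    also have "(LINT x|lborel. cis (- (2 * pi * (x \<bullet> \<xi>))) * g (d j *\<^sub>R b + x) - cis (- (2 * pi * (x \<bullet> \<xi>))) * g x)
      = fourier (\<lambda>x. g (d j *\<^sub>R b + x)) \<xi> - fourier g \<xi>"
      unfolding fourier_def by (intro Bochner_Integration.integral_diff integrable_cis_mult gi gi') simp_all
    also have "\<dots> = (cis (2 * pi * (d j * (b \<bullet> \<xi>))) - 1) * fourier g \<xi>"
      by (subst fourier_translate) (simp_all add: left_diff_distrib)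
    finally show ?thesis by simp
  qed
  moreover have "(\<lambda>j. (cis (2 * pi * (d j * (b \<bullet> \<xi>))) - 1) / d j * fourier g \<xi>)
     \<longlonglongrightarrow> 2 * pi * \<i> * (\<xi> \<bullet> b) * fourier g \<xi>"
  proof -
    have "((\<lambda>s. cis (2 * pi * (s * (b \<bullet> \<xi>)))) has_vector_derivative 2 * pi * \<i> * (\<xi> \<bullet> b)) (at 0)"
      unfolding cis_conv_exp
      by (auto intro!: derivative_eq_intros has_vector_derivative_real_field simp: inner_commute)
    from filterlim_compose[OF has_vector_derivative_quotient[OF this] d_at]
    have "(\<lambda>j. (cis (2 * pi * (d j * (b \<bullet> \<xi>))) - cis (2 * pi * (0 * (b \<bullet> \<xi>)))) /\<^sub>R d j) \<longlonglongrightarrow> 2 * pi * \<i> * (\<xi> \<bullet> b)" .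
    then have "(\<lambda>j. (cis (2 * pi * (d j * (b \<bullet> \<xi>))) - 1) / d j) \<longlonglongrightarrow> 2 * pi * \<i> * (\<xi> \<bullet> b)"
      by (simp add: scaleR_conv_of_real divide_inverse mult.commute)
    then show ?thesis by (rule tendsto_mult_right)
  qed
  ultimately show ?thesis by (simp add: LIMSEQ_unique)
qed

lemma schwartz_rapidly_decreasing:
  assumes f: "f \<in> schwartz" and bs: "set bs \<subseteq> Basis"
  shows "rapidly_decreasing (iter_pderiv bs f)"
proof -
  have "continuous_on UNIV (iter_pderiv bs f)"
    using f bs unfolding schwartz_def smooth_def
    by (auto intro!: continuous_at_imp_continuous_on differentiable_imp_continuous_within)
  then have "iter_pderiv bs f \<in> borel_measurable borel"
    by (rule borel_measurable_continuous_onI)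
  then show ?thesis
    using f bs unfolding schwartz_def rapidly_decreasing_def by blast
qed

lemma schwartz_iter_pderiv_vector_derivative:
  assumes f: "f \<in> schwartz" and bs: "set bs \<subseteq> Basis"
  shows "((\<lambda>s::real. iter_pderiv bs f (x + s *\<^sub>R b)) has_vector_derivative iter_pderiv (b # bs) f x) (at 0)"
proof -
  let ?g = "iter_pderiv bs f"
  let ?D = "frechet_derivative ?g (at x)"
  have D: "(?g has_derivative ?D) (at (x + 0 *\<^sub>R b))"
    using f bs unfolding schwartz_def smooth_def by (simp add: frechet_derivative_works[symmetric])
  have "((\<lambda>s::real. x + s *\<^sub>R b) has_derivative (\<lambda>s. s *\<^sub>R b)) (at 0)"
    by (auto intro!: derivative_eq_intros)
  from has_derivative_compose[OF this D]
  have "((\<lambda>s::real. ?g (x + s *\<^sub>R b)) has_derivative (\<lambda>s. ?D (s *\<^sub>R b))) (at 0)" .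
  moreover have "linear ?D" using has_derivative_bounded_linear[OF D] by (rule bounded_linear.linear)
  ultimately show ?thesis
    unfolding has_vector_derivative_def by (simp add: linear_cmul)
qed

lemma fourier_iter_pderiv:
  assumes f: "f \<in> schwartz" and b: "b \<in> Basis"
  shows "fourier (iter_pderiv (replicate k b) f) \<xi> = (2 * pi * \<i> * (\<xi> \<bullet> b)) ^ k * fourier f \<xi>"
proof (induction k)
  case (Suc k)
  have set_k: "set (replicate j b) \<subseteq> Basis" for j using b by auto
  have "fourier (iter_pderiv (b # replicate k b) f) \<xi> = 2 * pi * \<i> * (\<xi> \<bullet> b) * fourier (iter_pderiv (replicate k b) f) \<xi>"
  proof (rule fourier_pderiv)
    show "rapidly_decreasing (iter_pderiv (b # replicate k b) f)"
      using schwartz_rapidly_decreasing[OF f set_k[of "Suc k"]] by simp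
    show "((\<lambda>s::real. iter_pderiv (replicate k b) f (x + s *\<^sub>R b)) has_vector_derivative
        iter_pderiv (b # replicate k b) f x) (at 0)" for x
      by (rule schwartz_iter_pderiv_vector_derivative[OF f set_k])
  qed (use b in \<open>auto intro: schwartz_rapidly_decreasing[OF f set_k]\<close>)
  then show ?case by (simp add: Suc.IH mult.assoc)
qed simp

text \<open>The norm of \<xi> is at most \<open>sqrt DIM('a)\<close> times its largest coordinate,
  so bounding powers of single coordinates is enough; these come from repeated derivatives in one
  direction.\<close>

lemma rapidly_decreasing_fourier:
  fixes f :: "'a::euclidean_space \<Rightarrow> complex"
  assumes f: "f \<in> schwartz"
  shows "rapidly_decreasing (fourier f)"
  unfolding rapidly_decreasing_def
proof (intro conjI allI)
  have "rapidly_decreasing f" using schwartz_rapidly_decreasing[OF f, of "[]"] by simp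
  then have [measurable]: "f \<in> borel_measurable borel" by (simp add: rapidly_decreasing_def)
  show "fourier f \<in> borel_measurable borel" by simp
  fix k
  define I where "I b = (LINT x|lborel. norm (iter_pderiv (replicate k b) f x))" for b
  have I: "0 \<le> I b" for b by (simp add: I_def)
  have coord: "\<bar>\<xi> \<bullet> b\<bar> ^ k * norm (fourier f \<xi>) \<le> I b" if b: "b \<in> Basis" for b \<xi>
  proof -
    have "\<bar>\<xi> \<bullet> b\<bar> ^ k \<le> (2 * pi * \<bar>\<xi> \<bullet> b\<bar>) ^ k"
      using pi_gt3 mult_right_mono[of 1 "2 * pi" "\<bar>\<xi> \<bullet> b\<bar>"] by (intro power_mono) auto
    then have "\<bar>\<xi> \<bullet> b\<bar> ^ k * norm (fourier f \<xi>) \<le> (2 * pi * \<bar>\<xi> \<bullet> b\<bar>) ^ k * norm (fourier f \<xi>)"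
      by (rule mult_right_mono) simp
    also have "\<dots> = norm (fourier (iter_pderiv (replicate k b) f) \<xi>)"
      by (simp add: fourier_iter_pderiv[OF f b] norm_mult norm_power)
    also have "\<dots> \<le> I b" unfolding I_def by (rule norm_fourier_le)
    finally show ?thesis .
  qed
  show "\<exists>M. \<forall>\<xi>. norm \<xi> ^ k * norm (fourier f \<xi>) \<le> M"
  proof (intro exI allI)
    fix \<xi> :: 'a
    have "infnorm \<xi> \<in> (\<lambda>b. \<bar>\<xi> \<bullet> b\<bar>) ` Basis"
      unfolding infnorm_Max by (rule Max_in) auto
    then obtain b where b: "b \<in> Basis" "infnorm \<xi> = \<bar>\<xi> \<bullet> b\<bar>" by auto
    have "norm \<xi> ^ k \<le> (sqrt DIM('a) * \<bar>\<xi> \<bullet> b\<bar>) ^ k"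
      using norm_le_infnorm[of \<xi>] b by (intro power_mono) auto
    then have "norm \<xi> ^ k * norm (fourier f \<xi>) \<le> (sqrt DIM('a) * \<bar>\<xi> \<bullet> b\<bar>) ^ k * norm (fourier f \<xi>)"
      by (rule mult_right_mono) simp
    also have "\<dots> = sqrt DIM('a) ^ k * (\<bar>\<xi> \<bullet> b\<bar> ^ k * norm (fourier f \<xi>))"
      by (simp add: power_mult_distrib mult.assoc)
    also have "\<dots> \<le> sqrt DIM('a) ^ k * I b"
      by (intro mult_left_mono coord b) auto
    \<comment> \<open>The direction \<open>b\<close> depends on \<xi>; summing over all directions
      makes the bound uniform.\<close>
    also have "\<dots> \<le> sqrt DIM('a) ^ k * (\<Sum>b\<in>Basis. I b)"
      using b I by (intro mult_left_mono member_le_sum) auto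
    finally show "norm \<xi> ^ k * norm (fourier f \<xi>) \<le> sqrt DIM('a) ^ k * (\<Sum>b\<in>Basis. I b)" .
  qed
qed

section \<open>Fourier inversion by Gaussian summation\<close>

lemma gauss_multiplication_formula:
  fixes f :: "'a::euclidean_space \<Rightarrow> complex"
  assumes f: "integrable lborel f" and v: "0 < v"
  shows "(LINT \<xi>|lborel. of_real (exp (- v * symb \<xi>)) * fourier f \<xi>) = (LINT y|lborel. of_real (gauss v y) * f y)"
proof -
  have [measurable]: "f \<in> borel_measurable borel" using borel_measurable_integrable[OF f] by simp
  \<comment> \<open>With this variance \<open>gauss w\<close> is the multiple \<open>c\<close> of
    the factor \<open>exp (- v * symb \<xi>)\<close>, so the formula becomes
    \<open>gauss_convolution\<close> evaluated at the point 0.\<close>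
  define w where "w = 1 / (4 * pi\<^sup>2 * v)"
  have w: "0 < w" using v by (simp add: w_def)
  define c where "c = complex_of_real (1 / sqrt (2 * pi * w)) ^ DIM('a)"
  have c: "c \<noteq> 0" using w by (simp add: c_def)
  have gw: "of_real (gauss w \<xi>) = c * of_real (exp (- v * symb \<xi>))" for \<xi> :: 'a
  proof -
    have "(norm \<xi>)\<^sup>2 / (2 * w) = v * symb \<xi>" using v by (simp add: w_def symb_def)
    then show ?thesis by (simp add: gauss_def c_def del: of_real_exp)
  qed
  have gv: "c * of_real (gauss v y) = of_real (exp (- w * symb y))" for y :: 'a
  proof -
    have "symb y * w = (norm y)\<^sup>2 / (2 * v)" using v by (simp add: w_def symb_def)
    moreover have "1 / sqrt (2 * pi * w) * (1 / sqrt (2 * pi * v)) = 1"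
    proof -
      have "(2 * pi * w) * (2 * pi * v) = 1" using v by (simp add: w_def power2_eq_square)
      then have "sqrt (2 * pi * w) * sqrt (2 * pi * v) = 1" by (metis real_sqrt_mult real_sqrt_one)
      then show ?thesis by simp
    qed
    then have "(1 / sqrt (2 * pi * w)) ^ DIM('a) * (1 / sqrt (2 * pi * v)) ^ DIM('a) = 1"
      by (metis power_mult_distrib power_one)
    ultimately have "(1 / sqrt (2 * pi * w)) ^ DIM('a) * gauss v y = exp (- w * symb y)"
      unfolding gauss_def by (simp add: mult.assoc[symmetric] mult.commute)
    then show ?thesis unfolding c_def by (metis of_real_mult of_real_power)
  qed
  have "c * (LINT \<xi>|lborel. of_real (exp (- v * symb \<xi>)) * fourier f \<xi>)
    = (LINT \<xi>|lborel. of_real (gauss w \<xi>) * fourier f \<xi>)"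
    unfolding gw by (simp add: mult.assoc)
  also have "\<dots> = (LINT y|lborel. of_real (gauss w (0 - y)) * inv_fourier f (- (0 - y)))"
    by (subst lborel_integral_reflect[symmetric, of _ 0]) (simp_all add: fourier_eq_inv_fourier)
  also have "\<dots> = (LINT y|lborel. of_real (gauss w (0 - y)) * inv_fourier f y)" by simp
  also have "\<dots> = inv_fourier (\<lambda>\<xi>. of_real (exp (- w * symb \<xi>)) * f \<xi>) 0"
    by (rule gauss_convolution[OF f w])
  also have "\<dots> = c * (LINT y|lborel. of_real (gauss v y) * f y)"
    unfolding inv_fourier_def gv[symmetric] by (simp add: mult.assoc)
  finally show ?thesis using c by simp
qed

text \<open>The variances are squares \<open>d^2\<close>, so that substituting
  \<open>y = d *\<^sub>R z\<close> fixes the Gaussian and moves the dilation into \<open>f\<close>.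
  Continuity at 0 and the bound \<open>B\<close> then allow dominated convergence.\<close>

lemma gauss_approximate_identity:
  fixes f :: "'a::euclidean_space \<Rightarrow> complex"
  assumes [measurable]: "f \<in> borel_measurable borel" and cont: "isCont f 0" and bound: "\<And>x. norm (f x) \<le> B"
  shows "(\<lambda>j. LINT y|lborel. of_real (gauss ((inverse (real (Suc j)))\<^sup>2) y) * f y) \<longlonglongrightarrow> f 0"
proof -
  define d where "d j = inverse (real (Suc j))" for j
  have d: "0 < d j" for j by (simp add: d_def)
  have d0: "d \<longlonglongrightarrow> 0" unfolding d_def by (rule LIMSEQ_inverse_real_of_nat)
  have scale: "(LINT y|lborel. of_real (gauss ((d j)\<^sup>2) y) * f y) = (LINT z|lborel. of_real (gauss 1 z) * f (d j *\<^sub>R z))" for j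
  proof -
    have lb: "lborel = density (distr lborel borel (\<lambda>z::'a. 0 + d j *\<^sub>R z)) (\<lambda>_. ennreal (d j ^ DIM('a)))"
      using lborel_affine[of "d j" "0::'a"] d[of j] by simp
    have "(LINT y|lborel. of_real (gauss ((d j)\<^sup>2) y) * f y)
      = (LINT y|density (distr lborel borel (\<lambda>z::'a. 0 + d j *\<^sub>R z)) (\<lambda>_. ennreal (d j ^ DIM('a))). of_real (gauss ((d j)\<^sup>2) y) * f y)"
      by (rule arg_cong[OF lb])
    also have "\<dots> = (LINT y|distr lborel borel (\<lambda>z::'a. 0 + d j *\<^sub>R z). d j ^ DIM('a) *\<^sub>R (of_real (gauss ((d j)\<^sup>2) y) * f y))"
      using d[of j] by (subst integral_density) auto
    also have "\<dots> = (LINT z|lborel. d j ^ DIM('a) *\<^sub>R (of_real (gauss ((d j)\<^sup>2) (0 + d j *\<^sub>R z)) * f (0 + d j *\<^sub>R z)))"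
      by (rule integral_distr) auto
    also have "\<dots> = (LINT z|lborel. of_real (gauss 1 z) * f (d j *\<^sub>R z))"
    proof (intro Bochner_Integration.integral_cong refl)
      fix z :: 'a
      have "d j ^ DIM('a) * gauss ((d j)\<^sup>2) (d j *\<^sub>R z) = gauss 1 z"
        using d[of j] by (simp add: gauss_def real_sqrt_mult power_divide power_mult_distrib)
      then show "d j ^ DIM('a) *\<^sub>R (of_real (gauss ((d j)\<^sup>2) (0 + d j *\<^sub>R z)) * f (0 + d j *\<^sub>R z))
        = of_real (gauss 1 z) * f (d j *\<^sub>R z)"
        unfolding scaleR_conv_of_real by (metis add_0 mult.assoc of_real_mult)
    qed
    finally show ?thesis .
  qed
  have lim: "(\<lambda>j. LINT z|lborel. of_real (gauss 1 z) * f (d j *\<^sub>R z)) \<longlonglongrightarrow> (LINT z|lborel. of_real (gauss 1 (z :: 'a)) * f 0)"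
  proof (rule integral_dominated_convergence)
    show "integrable lborel (\<lambda>z. gauss 1 (z :: 'a) * B)"
      by (intro integrable_mult_left integrable_gauss) simp
    show "AE z in lborel. norm (of_real (gauss 1 z) * f (d j *\<^sub>R z)) \<le> gauss 1 z * B" for j
      using bound gauss_nonneg[of 1] by (intro always_eventually allI) (simp add: norm_mult abs_of_nonneg gauss_nonneg mult_left_mono)
    show "AE z in lborel. (\<lambda>j. of_real (gauss 1 z) * f (d j *\<^sub>R z)) \<longlonglongrightarrow> of_real (gauss 1 z) * f 0"
    proof (intro always_eventually allI tendsto_mult_left)
      fix z :: 'a
      have "(\<lambda>j. d j *\<^sub>R z) \<longlonglongrightarrow> 0 *\<^sub>R z" by (intro tendsto_scaleR d0 tendsto_const)
      then show "(\<lambda>j. f (d j *\<^sub>R z)) \<longlonglongrightarrow> f 0" by (intro isCont_tendsto_compose[OF cont]) simp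
    qed
  qed simp_all
  \<comment> \<open>The total mass of the Gaussian is read off as its transform at frequency
    0.\<close>
  have "(LINT z|lborel. of_real (gauss 1 (z :: 'a)) * f 0) = (LINT z|lborel. of_real (gauss 1 (z :: 'a)) * cis (2 * pi * (z \<bullet> 0))) * f 0"
    by (subst integral_mult_left_zero[symmetric]) simp
  also have "\<dots> = f 0" by (subst fourier_gauss) (simp_all add: symb_def)
  finally have eq: "(LINT z|lborel. of_real (gauss 1 (z :: 'a)) * f 0) = f 0" .
  show ?thesis using lim unfolding eq d_def[symmetric] scale .
qed

text \<open>Translation reduces the claim to the point 0. In the multiplication formula the Gaussian
  side tends to the value there, while the exponential side tends to the integral of the
  transform.\<close>

lemma fourier_inversion:
  fixes f :: "'a::euclidean_space \<Rightarrow> complex"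
  assumes f: "integrable lborel f" and cont: "\<And>x. isCont f x" and bound: "\<And>x. norm (f x) \<le> B"
    and F: "integrable lborel (fourier f)"
  shows "inv_fourier (fourier f) x = f x"
proof -
  have fm [measurable]: "f \<in> borel_measurable borel" using borel_measurable_integrable[OF f] by simp
  define g where "g y = f (x + y)" for y
  have [measurable]: "g \<in> borel_measurable borel" unfolding g_def by simp
  have "integrable (distr lborel borel ((+) x)) f" using f by (simp add: lborel_distr_plus)
  then have gi: "integrable lborel g" unfolding g_def by (subst (asm) integrable_distr_eq) auto
  have Fg: "fourier g \<xi> = cis (2 * pi * (x \<bullet> \<xi>)) * fourier f \<xi>" for \<xi>
    unfolding g_def by (rule fourier_translate[OF fm])
  define d where "d j = (inverse (real (Suc j)))\<^sup>2" for j
  have d: "0 < d j" for j by (simp add: d_def)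
  have "d \<longlonglongrightarrow> 0\<^sup>2" unfolding d_def by (intro tendsto_power LIMSEQ_inverse_real_of_nat)
  then have d0: "d \<longlonglongrightarrow> 0" by simp
  have "(\<lambda>j. LINT y|lborel. of_real (gauss (d j) y) * g y) \<longlonglongrightarrow> g 0"
    unfolding d_def
  proof (rule gauss_approximate_identity)
    show "isCont g 0" unfolding g_def by (rule isCont_o2[where g = f]) (use cont in auto)
    show "norm (g y) \<le> B" for y by (simp add: g_def bound)
  qed simp
  moreover have "(LINT y|lborel. of_real (gauss (d j) y) * g y) = (LINT \<xi>|lborel. of_real (exp (- d j * symb \<xi>)) * fourier g \<xi>)" for j
    by (rule gauss_multiplication_formula[OF gi d, symmetric])
  moreover have "(\<lambda>j. LINT \<xi>|lborel. of_real (exp (- d j * symb \<xi>)) * fourier g \<xi>) \<longlonglongrightarrow> (LINT \<xi>|lborel. fourier g \<xi>)"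
  proof (rule integral_dominated_convergence)
    show "integrable lborel (\<lambda>\<xi>. norm (fourier f \<xi>))" using F by simp
    show "AE \<xi> in lborel. norm (of_real (exp (- d j * symb \<xi>)) * fourier g \<xi>) \<le> norm (fourier f \<xi>)" for j
      using d[of j] by (intro always_eventually allI) (simp add: Fg norm_mult mult_left_le_one_le)
    show "AE \<xi> in lborel. (\<lambda>j. of_real (exp (- d j * symb \<xi>)) * fourier g \<xi>) \<longlonglongrightarrow> fourier g \<xi>"
    proof (intro always_eventually allI)
      fix \<xi> :: 'a
      have "(\<lambda>j. complex_of_real (exp (- d j * symb \<xi>)) * fourier g \<xi>) \<longlonglongrightarrow> of_real (exp (- 0 * symb \<xi>)) * fourier g \<xi>"
        by (intro tendsto_intros d0)
      then show "(\<lambda>j. complex_of_real (exp (- d j * symb \<xi>)) * fourier g \<xi>) \<longlonglongrightarrow> fourier g \<xi>" by simp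
    qed
  qed simp_all
  ultimately have "g 0 = (LINT \<xi>|lborel. fourier g \<xi>)" by (simp add: LIMSEQ_unique)
  then show ?thesis by (simp add: g_def inv_fourier_def Fg)
qed

text \<open>Identifies \<open>f\<close> with the inverse transform for which the pointwise
  inequality has been proved.\<close>

lemma schwartz_inversion:
  assumes f: "f \<in> schwartz"
  shows "inv_fourier (fourier f) x = f x"
proof -
  have r: "rapidly_decreasing f" using schwartz_rapidly_decreasing[OF f, of "[]"] by simp
  obtain M where M: "\<And>y. norm y ^ 0 * norm (f y) \<le> M"
    using r unfolding rapidly_decreasing_def by blast
  have "iter_pderiv [] f differentiable (at y)" for y
    using f unfolding schwartz_def smooth_def by (auto dest: spec[of _ "[]"])
  then have cont: "isCont f y" for y
    by (simp add: differentiable_imp_continuous_within)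
  show ?thesis
  proof (rule fourier_inversion[where B = M])
    show "integrable lborel f" by (rule rapidly_decreasing_integrable[OF r])
    show "integrable lborel (fourier f)"
      by (rule rapidly_decreasing_integrable[OF rapidly_decreasing_fourier[OF f]])
    show "norm (f y) \<le> M" for y using M[of y] by simp
  qed (rule cont)
qed

subsection \<open>The weighted interpolation inequality\<close>

lemma iterated_maximal_cmult:
  assumes F: "F \<in> borel_measurable borel"
  shows "(maximal lborel ^^ k) (\<lambda>x. c * F x) = (\<lambda>x. c * (maximal lborel ^^ k) F x)"
proof (induction k)
  case (Suc k)
  have "maximal lborel (\<lambda>x. c * (maximal lborel ^^ k) F x) x = c * maximal lborel ((maximal lborel ^^ k) F) x" for x
    using iterated_maximal_measurable[OF F, where \<mu> = lborel and k = k] by (intro maximal_cmult) auto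
  then show ?case by (simp add: Suc.IH fun_eq_iff)
qed simp

text \<open>The passage from powers of \<open>symb\<close> to powers of the norm introduces the
  constants \<open>c s\<close> and \<open>c t\<close>; they cancel because
  \<open>c s powr (t / s) = c t\<close> and the maximal operator is homogeneous.\<close>

lemma schwartz_fractional_interpolation:
  fixes s t :: real
  assumes t: "0 < t" "t < s"
  obtains C k where "0 < C"
    "\<And>f (x :: 'a::euclidean_space). f \<in> schwartz \<Longrightarrow>
      ennreal (norm (frac_deriv t f x))
      \<le> ennreal C * (ennreal_powr ((maximal lborel ^^ k) (\<lambda>y. ennreal (norm (f y))) x) (1 - t / s)
         * ennreal_powr ((maximal lborel ^^ k) (\<lambda>y. ennreal (norm (frac_deriv s f y))) x) (t / s))"
proof -
  obtain C k where C: "0 < C"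
    and *: "\<And>h (x :: 'a). integrable lborel h \<Longrightarrow>
      integrable lborel (\<lambda>\<xi>. of_real (symb \<xi> powr (s / 2)) * h \<xi>) \<Longrightarrow>
      ennreal (norm (inv_fourier (\<lambda>\<xi>. of_real (symb \<xi> powr (t / 2)) * h \<xi>) x))
      \<le> ennreal C * (ennreal_powr ((maximal lborel ^^ k) (\<lambda>y. ennreal (norm (inv_fourier h y))) x) (1 - t / s)
         * ennreal_powr ((maximal lborel ^^ k)
              (\<lambda>y. ennreal (norm (inv_fourier (\<lambda>\<xi>. of_real (symb \<xi> powr (s / 2)) * h \<xi>) y))) x) (t / s))"
    using fractional_maximal_interpolation[OF t] by blast
  define c where "c r = (2 * pi\<^sup>2) powr (r / 2)" for r
  have c: "0 < c r" for r by (simp add: c_def)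
  have cst: "c s powr (t / s) = c t" using t by (simp add: c_def powr_powr)
  have symb_powr: "symb \<xi> powr (r / 2) = c r * norm \<xi> powr r" for r and \<xi> :: 'a
  proof -
    have "((norm \<xi>)\<^sup>2) powr (r / 2) = norm \<xi> powr r"
    proof (cases "\<xi> = 0")
      case False
      then have "(norm \<xi>)\<^sup>2 = norm \<xi> powr 2" by simp
      then show ?thesis by (simp only: powr_powr) simp
    qed simp
    then show ?thesis by (simp add: symb_def c_def powr_mult)
  qed
  have sym: "inv_fourier (\<lambda>\<xi>. of_real (symb \<xi> powr (r / 2)) * fourier f \<xi>) x = of_real (c r) * frac_deriv r f x"
    for r f and x :: 'a
    unfolding frac_deriv_def inv_fourier_def symb_powr
    by (subst integral_mult_right_zero[symmetric]) (simp add: mult_ac)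
  have main: "ennreal (norm (frac_deriv t f x))
      \<le> ennreal C * (ennreal_powr ((maximal lborel ^^ k) (\<lambda>y. ennreal (norm (f y))) x) (1 - t / s)
         * ennreal_powr ((maximal lborel ^^ k) (\<lambda>y. ennreal (norm (frac_deriv s f y))) x) (t / s))"
    (is "?N \<le> ennreal C * (ennreal_powr ?A _ * ennreal_powr ?B _)")
    if f: "f \<in> schwartz" for f and x :: 'a
  proof -
    have F: "rapidly_decreasing (fourier f)" by (rule rapidly_decreasing_fourier[OF f])
    have int: "integrable lborel (\<lambda>\<xi>. of_real (symb \<xi> powr (s / 2)) * fourier f \<xi>)"
    proof -
      have "integrable lborel (\<lambda>\<xi>. of_real (c s) * (of_real (norm \<xi> powr s) * fourier f \<xi>))"
        using t by (intro integrable_mult_right rapidly_decreasing_integrable rapidly_decreasing_powr F) auto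
      then show ?thesis by (simp add: symb_powr mult.assoc)
    qed
    have [measurable]: "frac_deriv s f \<in> borel_measurable borel"
    proof -
      have [measurable]: "fourier f \<in> borel_measurable borel" using F by (simp add: rapidly_decreasing_def)
      show ?thesis unfolding frac_deriv_def by (intro borel_measurable_inv_fourier) measurable
    qed
    have "(maximal lborel ^^ k) (\<lambda>y. ennreal (norm (of_real (c s) * frac_deriv s f y)))
      = (\<lambda>x. ennreal (c s) * (maximal lborel ^^ k) (\<lambda>y. ennreal (norm (frac_deriv s f y))) x)"
      using c[of s] by (subst iterated_maximal_cmult[symmetric]) (simp_all add: norm_mult ennreal_mult)
    then have "ennreal (norm (of_real (c t) * frac_deriv t f x))
      \<le> ennreal C * (ennreal_powr ?A (1 - t / s) * ennreal_powr (ennreal (c s) * ?B) (t / s))"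
      using *[OF rapidly_decreasing_integrable[OF F] int, of x]
      unfolding sym schwartz_inversion[OF f] by simp
    then have "ennreal (c t) * ?N \<le> ennreal (c t) * (ennreal C * (ennreal_powr ?A (1 - t / s) * ennreal_powr ?B (t / s)))"
      using c[of t] c[of s] cst by (simp add: norm_mult ennreal_mult ennreal_powr_mult ennreal_powr_ennreal mult_ac)
    then show ?thesis
      using c[of t] by (subst (asm) ennreal_mult_le_mult_iff) (auto simp: ennreal_eq_0_iff not_le)
  qed
  show ?thesis by (rule that[OF C main])
qed

lemma wLp_norm_eq:
  "wLp_norm p w F = ennreal_powr (\<integral>\<^sup>+x. ennreal_powr (ennreal (weight w x) * ennreal (norm (F x))) p \<partial>lborel) (1 / p)"
  unfolding wLp_norm_def Lp_norm_def
  by (simp add: ennreal_mult[symmetric] weight_nonneg ennreal_powr_ennreal norm_mult)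

theorem theorem1p1:
  fixes n :: nat and p q r s t \<theta> :: real
    and \<alpha> \<beta> \<gamma> :: "nat \<Rightarrow> real" and \<alpha>\<theta> \<beta>\<theta> \<gamma>\<theta> :: real
  assumes "n = CARD('m::finite) + 1"
    and "1 < p" and "1 < q" and "1 < r"
    and "0 < t" and "t < s" and "\<theta> = t / s"
    and "1 / r = \<theta> / p + (1 - \<theta>) / q"
    and "p *\<^sub>R (\<alpha> 1, \<beta> 1, \<gamma> 1) \<in> (region_A n \<union> region_B n) \<inter> (region_C n p \<union> region_D n p)"
    and "q *\<^sub>R (\<alpha> 0, \<beta> 0, \<gamma> 0) \<in> (region_A n \<union> region_B n) \<inter> (region_C n q \<union> region_D n q)"
    and "\<forall>j\<in>{0,1}. \<forall>k\<in>{0,1}. \<forall>l\<in>{0,1}. (\<alpha> j, \<beta> k, \<gamma> l) \<in> region_A n \<union> region_B n"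
    and "(\<alpha>\<theta>, \<beta>\<theta>, \<gamma>\<theta>) = \<theta> *\<^sub>R (\<alpha> 1, \<beta> 1, \<gamma> 1) + (1 - \<theta>) *\<^sub>R (\<alpha> 0, \<beta> 0, \<gamma> 0)"
  shows "\<exists>C>0. \<forall>f \<in> (schwartz :: ((real ^ 'm) \<times> real \<Rightarrow> complex) set).
    wLp_norm r (\<alpha>\<theta>, \<beta>\<theta>, \<gamma>\<theta>) (frac_deriv t f)
      \<le> ennreal C
        * ennreal_powr (wLp_norm p (\<alpha> 1, \<beta> 1, \<gamma> 1) (frac_deriv s f)) \<theta>
        * ennreal_powr (wLp_norm q (\<alpha> 0, \<beta> 0, \<gamma> 0) f) (1 - \<theta>)"
proof -
  note n = assms(1) and p = assms(2) and q = assms(3) and r = assms(4) and \<theta>_def = assms(7)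
  have \<theta>: "0 < \<theta>" "\<theta> < 1" using assms(5-7) by auto
  let ?wP = "(\<alpha> 1, \<beta> 1, \<gamma> 1)" and ?wQ = "(\<alpha> 0, \<beta> 0, \<gamma> 0)" and ?wR = "(\<alpha>\<theta>, \<beta>\<theta>, \<gamma>\<theta>)"
  \<comment> \<open>The Hoelder exponent: the relation between \<open>p\<close>, \<open>q\<close>
    and \<open>r\<close> says precisely that \<open>1 - a = r * (1 - \<theta>) / q\<close>, whence
    \<open>p * a = r * \<theta>\<close> and \<open>q * (1 - a) = r * (1 - \<theta>)\<close>.\<close>
  define a where "a = r * \<theta> / p"
  have a1: "1 - a = r * (1 - \<theta>) / q"
  proof -
    have "1 = r * (\<theta> / p + (1 - \<theta>) / q)" using assms(8) r by (metis nonzero_mult_div_cancel_left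
          mult.right_neutral not_one_less_zero order_less_irrefl times_divide_eq_right divide_self zero_less_one)
    then show ?thesis by (simp add: a_def distrib_left)
  qed
  have a: "0 < a" "a < 1"
  proof -
    show "0 < a" using \<theta> p r by (simp add: a_def)
    have "0 < r * (1 - \<theta>) / q" using \<theta> q r by simp
    then show "a < 1" using a1 by linarith
  qed
  obtain C k where C: "0 < C"
    and pt: "\<And>f (x :: (real ^ 'm) \<times> real). f \<in> schwartz \<Longrightarrow>
      ennreal (norm (frac_deriv t f x))
      \<le> ennreal C * (ennreal_powr ((maximal lborel ^^ k) (\<lambda>y. ennreal (norm (f y))) x) (1 - t / s)
         * ennreal_powr ((maximal lborel ^^ k) (\<lambda>y. ennreal (norm (frac_deriv s f y))) x) (t / s))"
    using schwartz_fractional_interpolation[OF assms(5,6)] by blast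
  obtain C1 where C1: "0 \<le> C1"
    "\<And>F. F \<in> borel_measurable (borel :: ((real ^ 'm) \<times> real) measure) \<Longrightarrow>
      (\<integral>\<^sup>+x. ennreal_powr (ennreal (weight ?wP x) * (maximal lborel ^^ k) F x) p \<partial>lborel)
      \<le> ennreal C1 * (\<integral>\<^sup>+x. ennreal_powr (ennreal (weight ?wP x) * F x) p \<partial>lborel)"
    using iterated_maximal_power_weight_bound[OF p assms(9)[unfolded n], where k = k] by blast
  obtain C0 where C0: "0 \<le> C0"
    "\<And>F. F \<in> borel_measurable (borel :: ((real ^ 'm) \<times> real) measure) \<Longrightarrow>
      (\<integral>\<^sup>+x. ennreal_powr (ennreal (weight ?wQ x) * (maximal lborel ^^ k) F x) q \<partial>lborel)
      \<le> ennreal C0 * (\<integral>\<^sup>+x. ennreal_powr (ennreal (weight ?wQ x) * F x) q \<partial>lborel)"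
    using iterated_maximal_power_weight_bound[OF q assms(10)[unfolded n], where k = k] by blast
  have weight_split: "weight ?wR x = weight ?wP x powr \<theta> * weight ?wQ x powr (1 - \<theta>)" for x :: "(real ^ 'm) \<times> real"
  proof -
    have e: "\<alpha>\<theta> = \<alpha> 1 * \<theta> + \<alpha> 0 * (1 - \<theta>)" "\<beta>\<theta> = \<beta> 1 * \<theta> + \<beta> 0 * (1 - \<theta>)" "\<gamma>\<theta> = \<gamma> 1 * \<theta> + \<gamma> 0 * (1 - \<theta>)"
      using assms(12) by (simp_all add: mult.commute)
    show ?thesis unfolding weight_def case_prod_conv e powr_add powr_mult powr_powr by (simp only: mult_ac)
  qed
  \<comment> \<open>The operator constants \<open>C1\<close> and \<open>C0\<close> enter with powers
    \<open>a\<close> and \<open>1 - a\<close> and are then raised to the power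
    \<open>1 / r\<close>.\<close>
  let ?K = "C * C1 powr (\<theta> / p) * C0 powr ((1 - \<theta>) / q)"
  have main: "wLp_norm r ?wR (frac_deriv t f)
      \<le> ennreal ?K * ennreal_powr (wLp_norm p ?wP (frac_deriv s f)) \<theta> * ennreal_powr (wLp_norm q ?wQ f) (1 - \<theta>)"
    if f: "f \<in> schwartz" for f :: "(real ^ 'm) \<times> real \<Rightarrow> complex"
  proof -
    have [measurable]: "f \<in> borel_measurable borel"
      using schwartz_rapidly_decreasing[OF f, of "[]"] by (simp add: rapidly_decreasing_def)
    have [measurable]: "frac_deriv s f \<in> borel_measurable borel"
      unfolding frac_deriv_def by (intro borel_measurable_inv_fourier) simp
    define F1 where "F1 = (\<lambda>x. ennreal (norm (frac_deriv s f x)))"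
    define F0 where "F0 = (\<lambda>x. ennreal (norm (f x)))"
    have F [measurable]: "F1 \<in> borel_measurable borel" "F0 \<in> borel_measurable borel"
      by (simp_all add: F1_def F0_def)
    have [measurable]: "(maximal lborel ^^ k) F1 \<in> borel_measurable borel" "(maximal lborel ^^ k) F0 \<in> borel_measurable borel"
      by (intro iterated_maximal_measurable F)+
    define U1 where "U1 x = ennreal (weight ?wP x) * (maximal lborel ^^ k) F1 x" for x
    define U0 where "U0 x = ennreal (weight ?wQ x) * (maximal lborel ^^ k) F0 x" for x
    have [measurable]: "U1 \<in> borel_measurable borel" "U0 \<in> borel_measurable borel"
      unfolding U1_def U0_def by measurable
    define I1 where "I1 = (\<integral>\<^sup>+x. ennreal_powr (ennreal (weight ?wP x) * F1 x) p \<partial>lborel)"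
    define I0 where "I0 = (\<integral>\<^sup>+x. ennreal_powr (ennreal (weight ?wQ x) * F0 x) q \<partial>lborel)"
    have point: "ennreal_powr (ennreal (weight ?wR x) * ennreal (norm (frac_deriv t f x))) r
      \<le> ennreal (C powr r) * (ennreal_powr (ennreal_powr (U1 x) p) a * ennreal_powr (ennreal_powr (U0 x) q) (1 - a))" for x
    proof -
      have w: "ennreal (weight ?wR x) = ennreal_powr (ennreal (weight ?wP x)) \<theta> * ennreal_powr (ennreal (weight ?wQ x)) (1 - \<theta>)"
        by (simp add: weight_split ennreal_powr_ennreal weight_nonneg ennreal_mult)
      have "ennreal (weight ?wR x) * ennreal (norm (frac_deriv t f x))
        \<le> ennreal (weight ?wR x) * (ennreal C * (ennreal_powr ((maximal lborel ^^ k) F0 x) (1 - \<theta>) * ennreal_powr ((maximal lborel ^^ k) F1 x) \<theta>))"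
        unfolding F0_def F1_def \<theta>_def by (intro mult_left_mono pt f) auto
      also have "\<dots> = ennreal C * (ennreal_powr (U1 x) \<theta> * ennreal_powr (U0 x) (1 - \<theta>))"
        unfolding w U1_def U0_def ennreal_powr_mult by (simp only: mult_ac)
      finally have "ennreal_powr (ennreal (weight ?wR x) * ennreal (norm (frac_deriv t f x))) r
        \<le> ennreal_powr (ennreal C * (ennreal_powr (U1 x) \<theta> * ennreal_powr (U0 x) (1 - \<theta>))) r"
        using r by (intro ennreal_powr_mono) auto
      also have "\<dots> = ennreal (C powr r) * (ennreal_powr (ennreal_powr (U1 x) p) a * ennreal_powr (ennreal_powr (U0 x) q) (1 - a))"
        using C p q unfolding a1 ennreal_powr_mult ennreal_powr_powr by (simp add: ennreal_powr_ennreal a_def mult.commute)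
      finally show ?thesis .
    qed
    have "(\<integral>\<^sup>+x. ennreal_powr (ennreal (weight ?wR x) * ennreal (norm (frac_deriv t f x))) r \<partial>lborel)
      \<le> (\<integral>\<^sup>+x. ennreal (C powr r) * (ennreal_powr (ennreal_powr (U1 x) p) a * ennreal_powr (ennreal_powr (U0 x) q) (1 - a)) \<partial>lborel)"
      by (intro nn_integral_mono point)
    also have "\<dots> = ennreal (C powr r) * (\<integral>\<^sup>+x. ennreal_powr (ennreal_powr (U1 x) p) a * ennreal_powr (ennreal_powr (U0 x) q) (1 - a) \<partial>lborel)"
      by (rule nn_integral_cmult) simp
    also have "\<dots> \<le> ennreal (C powr r) * (ennreal_powr (\<integral>\<^sup>+x. ennreal_powr (U1 x) p \<partial>lborel) a * ennreal_powr (\<integral>\<^sup>+x. ennreal_powr (U0 x) q \<partial>lborel) (1 - a))"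
      by (intro mult_left_mono nn_integral_Holder a) auto
    also have "\<dots> \<le> ennreal (C powr r) * (ennreal_powr (ennreal C1 * I1) a * ennreal_powr (ennreal C0 * I0) (1 - a))"
      unfolding U1_def U0_def I1_def I0_def using a
      by (intro mult_left_mono mult_mono ennreal_powr_mono C1 C0 F) auto
    finally have "wLp_norm r ?wR (frac_deriv t f)
      \<le> ennreal_powr (ennreal (C powr r) * (ennreal_powr (ennreal C1 * I1) a * ennreal_powr (ennreal C0 * I0) (1 - a))) (1 / r)"
      unfolding wLp_norm_eq using r by (intro ennreal_powr_mono) auto
    also have "\<dots> = ennreal C * ((ennreal (C1 powr (\<theta> / p)) * ennreal_powr I1 (\<theta> / p)) * (ennreal (C0 powr ((1 - \<theta>) / q)) * ennreal_powr I0 ((1 - \<theta>) / q)))"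
      using C C1(1) C0(1) r unfolding a1 ennreal_powr_mult ennreal_powr_powr
      by (simp add: ennreal_powr_ennreal a_def powr_powr)
    also have "\<dots> = ennreal ?K * ennreal_powr (wLp_norm p ?wP (frac_deriv s f)) \<theta> * ennreal_powr (wLp_norm q ?wQ f) (1 - \<theta>)"
      using C C1(1) C0(1)
      by (simp add: wLp_norm_eq I1_def I0_def F1_def F0_def ennreal_powr_powr ennreal_mult mult_ac)
    finally show ?thesis .
  qed
  \<comment> \<open>\<open>C1\<close> and \<open>C0\<close> are only known to be nonnegative, so
    \<open>?K\<close> is increased by 1 to obtain a positive constant.\<close>
  have "wLp_norm r ?wR (frac_deriv t f)
      \<le> ennreal (?K + 1) * ennreal_powr (wLp_norm p ?wP (frac_deriv s f)) \<theta> * ennreal_powr (wLp_norm q ?wQ f) (1 - \<theta>)"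
    if f: "f \<in> schwartz" for f :: "(real ^ 'm) \<times> real \<Rightarrow> complex"
    by (rule order.trans[OF main[OF f]]) (intro mult_right_mono ennreal_leI, auto)
  moreover have "0 < ?K + 1" using C by (simp add: add_nonneg_pos)
  ultimately show ?thesis by blast
qed

end
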